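(* Let $A_1,A_2$ be finite-dimensional complex Hilbert spaces. For non-commutative graphs $S_1\subseteq\mathcal{L}(A_1)$ and $S_2\subseteq\mathcal{L}(A_2)$, $$\widetilde{\vartheta}(S_1\otimes S_2)=\widetilde{\vartheta}(S_1)\,\widetilde{\vartheta}(S_2).$$
   Context: $\mathcal{L}(A)$ is the space of linear operators on $A$. A non-commutative graph is a linear subspace $S\subseteq\mathcal{L}(A)$ with $\mathbf{1}\in S$ and $S=S^\dagger$. $S_1\otimes S_2\subseteq\mathcal{L}(A_1\otimes A_2)$ is the linear span of all $X_1\otimes X_2$, $X_i\in S_i$. $S^\perp$ is the orthogonal complement in $\mathcal{L}(A)$ with respect to the Hilbert-Schmidt inner product $\operatorname{Tr}X^\dagger Y$. $\|\cdot\|$ is the operator norm. Define $\vartheta(S):=\max\{\|\mathbf{1}+T\|: T\in S^\perp,\ \mathbf{1}+T\ge 0\}$ and the quantum Lovász function $$\widetilde{\vartheta}(S):=\sup_{n\in\mathbb{N}}\vartheta\bigl(S\otimes\mathcal{L}(\mathbb{C}^n)\bigr)=\sup_n\max\{\|\mathbf{1}+T\|: T\in S^\perp\otimes\mathcal{L}(\mathbb{C}^n),\ \mathbf{1}+T\ge 0\}.$$ *)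

theory Defs
  imports
    "Jordan_Normal_Form.Schur_Decomposition"
    "Jordan_Normal_Form.VS_Connect"
begin

(* A finite-dimensional complex Hilbert space of dimension d is represented, via an orthonormal
   basis, as carrier_vec d with inner product (\<bullet>c), so that L(A) is carrier_mat d d and the
   adjoint is mat_adjoint.  Sets of operators on such a space come with d as an explicit
   parameter. *)

definition mat_trace :: "complex mat \<Rightarrow> complex" where
  "mat_trace A = (\<Sum>i<dim_row A. A $$ (i, i))"

definition hs_inner :: "complex mat \<Rightarrow> complex mat \<Rightarrow> complex" where
  "hs_inner X Y = mat_trace (mat_adjoint X * Y)"

definition vec_norm :: "complex vec \<Rightarrow> real" where
  "vec_norm v = sqrt (Re (v \<bullet>c v))"

(* The unit ball rather than the unit sphere, so that the norm is 0 in dimension 0. *)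
definition op_norm :: "complex mat \<Rightarrow> real" where
  "op_norm A = (SUP v \<in> {v \<in> carrier_vec (dim_col A). vec_norm v \<le> 1}. vec_norm (A *\<^sub>v v))"

(* The order on complex numbers is that of HOL-Library.Complex_Order: 0 \<le> z means that z is real
   and nonnegative.  Over the complex numbers this forces A to be Hermitian. *)
definition psd :: "complex mat \<Rightarrow> bool" where
  "psd A \<longleftrightarrow> square_mat A \<and> (\<forall>v \<in> carrier_vec (dim_row A). 0 \<le> (A *\<^sub>v v) \<bullet>c v)"

(* Kronecker product: X \<otimes> Y in the product basis, where the basis vector e_i \<otimes> f_k of the tensor
   product has index i * dim + k with dim the dimension of the second factor. *)
definition kron :: "complex mat \<Rightarrow> complex mat \<Rightarrow> complex mat" where
  "kron X Y = mat (dim_row X * dim_row Y) (dim_col X * dim_col Y)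
     (\<lambda>(i, j). X $$ (i div dim_row Y, j div dim_col Y) * Y $$ (i mod dim_row Y, j mod dim_col Y))"

definition noncomm_graph :: "nat \<Rightarrow> complex mat set \<Rightarrow> bool" where
  "noncomm_graph d S \<longleftrightarrow>
     VectorSpace.subspace class_ring S (module_mat TYPE(complex) d d) \<and> 1\<^sub>m d \<in> S \<and> S = mat_adjoint ` S"

definition tensor_space :: "nat \<Rightarrow> nat \<Rightarrow> complex mat set \<Rightarrow> complex mat set \<Rightarrow> complex mat set" where
  "tensor_space d1 d2 S1 S2 =
     LinearCombinations.module.span class_ring (module_mat TYPE(complex) (d1 * d2) (d1 * d2))
       {kron X1 X2 | X1 X2. X1 \<in> S1 \<and> X2 \<in> S2}"

definition orth_compl :: "nat \<Rightarrow> complex mat set \<Rightarrow> complex mat set" where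
  "orth_compl d S = {T \<in> carrier_mat d d. \<forall>X \<in> S. hs_inner X T = 0}"

(* For a non-commutative graph S the supremum is a maximum: since 1 \<in> S, every feasible T is
   traceless, so 1 + T is positive semidefinite with trace d; hence the feasible set is compact, and
   it contains 0. *)
definition lovasz_theta :: "nat \<Rightarrow> complex mat set \<Rightarrow> real" where
  "lovasz_theta d S =
     (SUP T \<in> {T \<in> orth_compl d S. psd (1\<^sub>m d + T)}. op_norm (1\<^sub>m d + T))"

(* For a non-commutative graph S this is a supremum of a set of reals bounded by d^2: a feasible
   P = 1 + T has partial trace d * 1 over the first factor, and P is at most d times the tensor
   product of the identity with that partial trace. *)
definition quantum_lovasz_theta :: "nat \<Rightarrow> complex mat set \<Rightarrow> real" where
  "quantum_lovasz_theta d S =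
     (SUP n \<in> {1..}. lovasz_theta (d * n) (tensor_space d n S (carrier_mat n n)))"

end

theory Submission
  imports Defs
begin

text \<open>The quantity \<open>\<theta>\<close> of a non-commutative graph \<open>S\<close> is the value of a semidefinite program. Its dual
  asks for the least \<open>\<mu>\<close> such that some \<open>Y \<in> S \<otimes> L(A)\<close> dominates the unnormalised maximally entangled
  projection and has partial trace \<open>\<mu> 1\<close>. Tensor products of primal feasible points are primal
  feasible, which gives one inequality; tensor products of dual feasible points are dual feasible,
  which with weak and strong duality gives the other.

  Strong duality comes from Hahn-Banach. On \<open>S \<otimes> L(A)\<close> consider the operators \<open>w\<close> with partial trace \<open>0\<close>
  and let \<open>p(h)\<close> be the least \<open>t\<close> with \<open>h \<le> t 1 + w\<close> for some such \<open>w\<close>. A linear functional below \<open>p\<close>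
  that agrees with \<open>p\<close> at the entangled projection is a positive operator \<open>Q\<close> whose restriction to
  \<open>S \<otimes> L(A)\<close> depends on the partial trace only, so it equals \<open>1 \<otimes> \<rho> + T\<close> with \<open>T\<close> orthogonal to
  \<open>S \<otimes> L(A)\<close>; conjugation with \<open>1 \<otimes> \<rho>\<^sup>-\<^sup>1\<^sup>/\<^sup>2\<close> (after a perturbation of \<open>\<rho>\<close>) makes it primal feasible.\<close>

section \<open>Nonnegative kernels and Cholesky factorisation\<close>

text \<open>The ancilla makes the duality work: the conjugation that turns a dual functional into a
  primal point acts on the second factor alone, and that factor is an ancilla of the dimension of
  the system, one of those in the supremum over \<open>n\<close>. Suprema are avoided until the end.
  A number \<open>c\<close> is tested by the predicate \<open>theta_bound\<close>, and the value is
  recovered as the least nonnegative such \<open>c\<close>. For positive operators a bound on the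
  quadratic form is a bound on the norm, so only forms occur before the return to matrices. Duality
  is used up to an arbitrary \<open>\<epsilon>\<close>, which is removed from the product of two
  bounds.

  Feasibility is conjugate-linear in the test operator, and the slices of a product of dual points
  are pure tensors. Both inequalities are therefore argued with the set of pure tensors, and its
  span enters only in the comparison with matrices. With operators encoded as functions on an index
  set, the regrouping of system and ancilla factors in a product is a bijection of index
  sets.\<close>

definition qform :: "'i set \<Rightarrow> ('i \<Rightarrow> 'i \<Rightarrow> complex) \<Rightarrow> ('i \<Rightarrow> complex) \<Rightarrow> complex" where
  "qform J A v = (\<Sum>x\<in>J. \<Sum>y\<in>J. cnj (v x) * A x y * v y)"

definition nonneg_kernel :: "'i set \<Rightarrow> ('i \<Rightarrow> 'i \<Rightarrow> complex) \<Rightarrow> bool" where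
  "nonneg_kernel J A \<longleftrightarrow> (\<forall>v. Im (qform J A v) = 0 \<and> 0 \<le> Re (qform J A v))"

definition sqnorm :: "'i set \<Rightarrow> ('i \<Rightarrow> complex) \<Rightarrow> real" where
  "sqnorm J v = (\<Sum>x\<in>J. (cmod (v x))\<^sup>2)"

lemma sqnorm_nonneg: "0 \<le> sqnorm J v"
  by (simp add: sqnorm_def sum_nonneg)

lemma nonneg_kernelD:
  assumes "nonneg_kernel J A"
  shows "Im (qform J A v) = 0" "0 \<le> Re (qform J A v)"
  using assms by (auto simp: nonneg_kernel_def)

lemma qform_cong:
  assumes "\<And>x y. x \<in> J \<Longrightarrow> y \<in> J \<Longrightarrow> A x y = B x y" "\<And>x. x \<in> J \<Longrightarrow> v x = w x"
  shows "qform J A v = qform J B w"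
  unfolding qform_def using assms by (intro sum.cong) auto

lemma nonneg_kernel_cong:
  assumes "\<And>x y. x \<in> J \<Longrightarrow> y \<in> J \<Longrightarrow> A x y = B x y"
  shows "nonneg_kernel J A \<longleftrightarrow> nonneg_kernel J B"
proof -
  have "qform J A v = qform J B v" for v
    using assms by (rule qform_cong) simp_all
  then show ?thesis by (simp add: nonneg_kernel_def)
qed

lemma qform_alt: "qform J A v = (\<Sum>x\<in>J. cnj (v x) * (\<Sum>y\<in>J. A x y * v y))"
  unfolding qform_def by (simp add: sum_distrib_left mult.assoc)

lemma qform_add: "qform J (\<lambda>x y. A x y + B x y) v = qform J A v + qform J B v"
  by (simp add: qform_def algebra_simps sum.distrib)

lemma qform_diff: "qform J (\<lambda>x y. A x y - B x y) v = qform J A v - qform J B v"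
  by (simp add: qform_def algebra_simps sum_subtractf)

lemma qform_scale: "qform J (\<lambda>x y. c * A x y) v = c * qform J A v"
  by (simp add: qform_def sum_distrib_left mult_ac)

lemma qform_id:
  assumes "finite J"
  shows "qform J (\<lambda>x y. if x = y then 1 else 0) v = of_real (sqnorm J v)"
proof -
  have "qform J (\<lambda>x y. if x = y then 1 else 0) v = (\<Sum>x\<in>J. \<Sum>y\<in>J. if x = y then cnj (v x) * v x else 0)"
    unfolding qform_def by (intro sum.cong) auto
  also have "\<dots> = (\<Sum>x\<in>J. cnj (v x) * v x)"
    using assms by simp
  also have "\<dots> = of_real (sqnorm J v)"
    unfolding sqnorm_def of_real_sum
    by (rule sum.cong[OF refl]) (simp only: complex_norm_square mult.commute)
  finally show ?thesis .
qed

lemma nonneg_kernel_add: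
  "nonneg_kernel J A \<Longrightarrow> nonneg_kernel J B \<Longrightarrow> nonneg_kernel J (\<lambda>x y. A x y + B x y)"
  by (auto simp: nonneg_kernel_def qform_add)

lemma nonneg_kernel_id: "finite J \<Longrightarrow> nonneg_kernel J (\<lambda>x y. if x = y then 1 else 0)"
  by (simp add: nonneg_kernel_def qform_id sqnorm_nonneg)

lemma nonneg_kernel_scale:
  "0 \<le> t \<Longrightarrow> nonneg_kernel J A \<Longrightarrow> nonneg_kernel J (\<lambda>x y. complex_of_real t * A x y)"
  by (auto simp: nonneg_kernel_def qform_scale)

text \<open>The test vector is a sum of two indicators rather than a case distinction, so that
  \<open>x = y\<close> is allowed; with \<open>y = x\<close> and \<open>b = 0\<close> it reads off a
  diagonal entry.\<close>

lemma qform_two_point: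
  assumes "finite J" "x \<in> J" "y \<in> J"
  shows "qform J A (\<lambda>z. (if z = x then a else 0) + (if z = y then b else 0)) =
    cnj a * A x x * a + cnj a * A x y * b + cnj b * A y x * a + cnj b * A y y * b"
proof -
  let ?v = "\<lambda>z. (if z = x then a else 0) + (if z = y then b else 0)"
  have 1: "(\<Sum>y'\<in>J. A x' y' * ?v y') = A x' x * a + A x' y * b" for x'
  proof -
    have "(\<Sum>y'\<in>J. A x' y' * ?v y') =
      (\<Sum>y'\<in>J. if y' = x then A x' y' * a else 0) + (\<Sum>y'\<in>J. if y' = y then A x' y' * b else 0)"
      by (simp only: sum.distrib [symmetric]) (intro sum.cong, auto simp: algebra_simps)
    then show ?thesis using assms by simp
  qed
  have "qform J A ?v = (\<Sum>x'\<in>J. cnj (?v x') * (\<Sum>y'\<in>J. A x' y' * ?v y'))"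
    by (rule qform_alt)
  also have "\<dots> = (\<Sum>x'\<in>J. cnj (?v x') * (A x' x * a + A x' y * b))"
    by (simp only: 1)
  also have "\<dots> = (\<Sum>x'\<in>J. if x' = x then cnj a * (A x' x * a + A x' y * b) else 0) +
      (\<Sum>x'\<in>J. if x' = y then cnj b * (A x' x * a + A x' y * b) else 0)"
    by (simp only: sum.distrib [symmetric]) (intro sum.cong, auto simp: algebra_simps)
  also have "\<dots> = cnj a * (A x x * a + A x y * b) + cnj b * (A y x * a + A y y * b)"
    using assms by simp
  finally show ?thesis by (simp add: algebra_simps)
qed

lemma nonneg_kernel_diag:
  assumes "nonneg_kernel J A" "finite J" "x \<in> J"
  shows "Im (A x x) = 0" "0 \<le> Re (A x x)"
  using nonneg_kernelD[OF assms(1), of "\<lambda>z. (if z = x then 1 else 0) + (if z = x then 0 else 0)"]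
  unfolding qform_two_point[OF assms(2,3,3)] by simp_all

text \<open>Polarisation: the forms at e_x + e_y and at e_x + \<i> e_y are real, and so are the
  diagonal entries. The first kills the imaginary part of \<open>A x y + A y x\<close>, the second
  the real part of \<open>A x y - A y x\<close>.\<close>

lemma nonneg_kernel_hermitian:
  assumes "nonneg_kernel J A" "finite J" "x \<in> J" "y \<in> J"
  shows "A x y = cnj (A y x)"
proof -
  note d = nonneg_kernel_diag[OF assms(1,2,3)] nonneg_kernel_diag[OF assms(1,2,4)]
  have "Im (A x y + A y x) = 0"
    using nonneg_kernelD(1)[OF assms(1), of "\<lambda>z. (if z = x then 1 else 0) + (if z = y then 1 else 0)"] d
    unfolding qform_two_point[OF assms(2,3,4)] by simp
  moreover have "Re (A x y) = Re (A y x)"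
    using nonneg_kernelD(1)[OF assms(1), of "\<lambda>z. (if z = x then 1 else 0) + (if z = y then \<i> else 0)"] d
    unfolding qform_two_point[OF assms(2,3,4)] by simp
  ultimately show ?thesis by (simp add: complex_eq_iff)
qed

text \<open>Along the vectors - t (A x y) e_x + e_y the form is affine in \<open>t\<close> with
  slope -2 times the squared modulus of \<open>A x y\<close>, so a nonzero entry would make it
  negative for large \<open>t\<close>.\<close>

lemma nonneg_kernel_zero_row:
  assumes "nonneg_kernel J A" "finite J" "x \<in> J" "y \<in> J" "A x x = 0"
  shows "A x y = 0"
proof (rule ccontr)
  assume ne: "A x y \<noteq> 0"
  define m where "m = (cmod (A x y))\<^sup>2"
  have m: "m > 0" using ne by (simp add: m_def)
  \<comment> \<open>Chosen so that the form has real part exactly -1.\<close>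
  define t where "t = (Re (A y y) + 1) / (2 * m)"
  have herm: "A y x = cnj (A x y)" by (rule nonneg_kernel_hermitian[OF assms(1,2,4,3)])
  have mm: "A x y * cnj (A x y) = complex_of_real m"
    by (simp add: m_def flip: complex_norm_square)
  have "qform J A (\<lambda>z. (if z = x then - of_real t * A x y else 0) + (if z = y then 1 else 0))
      = - 2 * of_real t * (A x y * cnj (A x y)) + A y y"
    unfolding qform_two_point[OF assms(2,3,4)] assms(5) herm by simp
  also have "Re \<dots> = - 2 * t * m + Re (A y y)" unfolding mm by simp
  also have "\<dots> = - 1" using m by (simp add: t_def field_simps)
  finally show False
    using nonneg_kernelD(2)[OF assms(1), of "\<lambda>z. (if z = x then - of_real t * A x y else 0) + (if z = y then 1 else 0)"]
    by simp
qed

lemma qform_gram: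
  assumes "\<And>x y. x \<in> J \<Longrightarrow> y \<in> J \<Longrightarrow> A x y = (\<Sum>r\<in>R. w r x * cnj (w r y))"
  shows "qform J A v = (\<Sum>r\<in>R. of_real ((cmod (\<Sum>x\<in>J. cnj (w r x) * v x))\<^sup>2))"
proof -
  have "qform J A v = (\<Sum>x\<in>J. \<Sum>y\<in>J. \<Sum>r\<in>R. cnj (v x) * w r x * (cnj (w r y) * v y))"
    unfolding qform_def by (intro sum.cong refl) (simp add: assms sum_distrib_left sum_distrib_right mult_ac)
  also have "\<dots> = (\<Sum>x\<in>J. \<Sum>r\<in>R. \<Sum>y\<in>J. cnj (v x) * w r x * (cnj (w r y) * v y))"
    by (rule sum.cong[OF refl]) (rule sum.swap)
  also have "\<dots> = (\<Sum>r\<in>R. \<Sum>x\<in>J. \<Sum>y\<in>J. cnj (v x) * w r x * (cnj (w r y) * v y))"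
    by (rule sum.swap)
  also have "\<dots> = (\<Sum>r\<in>R. (\<Sum>x\<in>J. cnj (v x) * w r x) * (\<Sum>y\<in>J. cnj (w r y) * v y))"
    by (simp only: sum_product)
  also have "\<dots> = (\<Sum>r\<in>R. of_real ((cmod (\<Sum>x\<in>J. cnj (w r x) * v x))\<^sup>2))"
  proof (intro sum.cong refl)
    fix r
    have "(\<Sum>x\<in>J. cnj (v x) * w r x) = cnj (\<Sum>x\<in>J. cnj (w r x) * v x)"
      by (simp add: mult.commute)
    then show "(\<Sum>x\<in>J. cnj (v x) * w r x) * (\<Sum>y\<in>J. cnj (w r y) * v y) =
        of_real ((cmod (\<Sum>x\<in>J. cnj (w r x) * v x))\<^sup>2)"
      by (simp only: complex_norm_square mult.commute [of "cnj _"])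
  qed
  finally show ?thesis .
qed

lemma nonneg_kernel_gram:
  assumes "\<And>x y. x \<in> J \<Longrightarrow> y \<in> J \<Longrightarrow> A x y = (\<Sum>r\<in>R. w r x * cnj (w r y))"
  shows "nonneg_kernel J A"
  unfolding nonneg_kernel_def
proof
  fix v
  have "qform J A v = of_real (\<Sum>r\<in>R. (cmod (\<Sum>x\<in>J. cnj (w r x) * v x))\<^sup>2)"
    by (subst qform_gram[OF assms]) simp_all
  then show "Im (qform J A v) = 0 \<and> 0 \<le> Re (qform J A v)"
    by (simp add: sum_nonneg)
qed

text \<open>One step of Gaussian elimination leaves a nonnegative kernel, the Schur complement.\<close>

lemma cholesky:
  assumes "finite J" "nonneg_kernel J A"
  shows "\<exists>w. \<forall>x\<in>J. \<forall>y\<in>J. A x y = (\<Sum>r\<in>J. w r x * cnj (w r y))"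
  using assms
proof (induction J arbitrary: A rule: finite_induct)
  case empty
  then show ?case by simp
next
  case (insert i J)
  note fin = finite.insertI[OF insert.hyps(1), of i]
  note [simp] = insert.hyps
  \<comment> \<open>For a pivot 0 the quotient is 0 and \<open>B\<close> is \<open>A\<close>. This
    is the right value, because the pivot row then vanishes by \<open>zero\<close>.\<close>
  define B where "B = (\<lambda>x y. A x y - A x i * A i y / A i i)"
  have zero: "A i y = 0" if "A i i = 0" "y \<in> insert i J" for y
    using nonneg_kernel_zero_row[OF insert.prems fin _ that(2,1)] by simp
  have "nonneg_kernel J B"
    unfolding nonneg_kernel_def
  proof
    fix v
    define s where "s = (\<Sum>y\<in>J. A i y * v y)"
    \<comment> \<open>The value at \<open>i\<close> solves row \<open>i\<close> of
      \<open>A u = 0\<close>, so that the form of \<open>A\<close> at \<open>u\<close> becomes the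
      form of \<open>B\<close> at \<open>v\<close>.\<close>
    define u where "u = (\<lambda>x. if x = i then - s / A i i else v x)"
    have uJ: "(\<Sum>x\<in>J. f x (u x)) = (\<Sum>x\<in>J. f x (v x))" for f :: "'a \<Rightarrow> complex \<Rightarrow> complex"
      by (rule sum.cong) (auto simp: u_def)
    have s0: "s = 0" if "A i i = 0"
      unfolding s_def by (rule sum.neutral) (simp add: zero[OF that])
    have inner: "(\<Sum>y\<in>insert i J. A x y * u y) = A x i * u i + (\<Sum>y\<in>J. A x y * v y)" for x
      using uJ[of "\<lambda>y z. A x y * z"] by simp
    have "(\<Sum>y\<in>insert i J. A i y * u y) = 0"
      unfolding inner using s0 by (simp add: u_def s_def)
    then have "qform (insert i J) A u = (\<Sum>x\<in>J. cnj (u x) * (\<Sum>y\<in>insert i J. A x y * u y))"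
      unfolding qform_alt by simp
    also have "\<dots> = (\<Sum>x\<in>J. cnj (v x) * (A x i * u i + (\<Sum>y\<in>J. A x y * v y)))"
      unfolding inner by (rule uJ)
    also have "\<dots> = (\<Sum>x\<in>J. cnj (v x) * (\<Sum>y\<in>J. B x y * v y))"
    proof (intro sum.cong refl arg_cong2[where f = "(*)"])
      fix x
      have "(\<Sum>y\<in>J. B x y * v y) = (\<Sum>y\<in>J. A x y * v y) - (\<Sum>y\<in>J. A x i / A i i * (A i y * v y))"
        by (simp add: B_def algebra_simps sum_subtractf)
      also have "\<dots> = (\<Sum>y\<in>J. A x y * v y) - A x i / A i i * s"
        by (simp add: s_def sum_distrib_left)
      finally show "A x i * u i + (\<Sum>y\<in>J. A x y * v y) = (\<Sum>y\<in>J. B x y * v y)"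
        by (simp add: u_def)
    qed
    also have "\<dots> = qform J B v"
      by (rule qform_alt [symmetric])
    finally show "Im (qform J B v) = 0 \<and> 0 \<le> Re (qform J B v)"
      using nonneg_kernelD[OF insert.prems, of u] by simp
  qed
  then obtain w where w: "\<And>x y. x \<in> J \<Longrightarrow> y \<in> J \<Longrightarrow> B x y = (\<Sum>r\<in>J. w r x * cnj (w r y))"
    using insert.IH by blast
  \<comment> \<open>The new Gram vector is the pivot column over the square root of the pivot (0 if
    the pivot is 0); the Gram vectors of \<open>B\<close> are extended by 0 at
    \<open>i\<close>.\<close>
  define w' where "w' = (\<lambda>r x. if r = i then A x i / of_real (sqrt (Re (A i i))) else if x = i then 0 else w r x)"
  have diag: "A i i = of_real (Re (A i i))" "0 \<le> Re (A i i)"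
    using nonneg_kernel_diag[OF insert.prems fin, of i] by (simp_all add: complex_eq_iff)
  have herm: "cnj (A y i) = A i y" if "y \<in> insert i J" for y
    using nonneg_kernel_hermitian[OF insert.prems fin, of i y] that by simp
  have "A x y = (\<Sum>r\<in>insert i J. w' r x * cnj (w' r y))" if xy: "x \<in> insert i J" "y \<in> insert i J" for x y
  proof -
    have sq: "complex_of_real (sqrt (Re (A i i))) * complex_of_real (sqrt (Re (A i i))) = A i i"
      using diag by (simp flip: of_real_mult)
    have "w' i x * cnj (w' i y) = A x i * cnj (A y i) /
        (complex_of_real (sqrt (Re (A i i))) * complex_of_real (sqrt (Re (A i i))))"
      by (simp add: w'_def)
    then have 1: "w' i x * cnj (w' i y) = A x i * A i y / A i i"
      by (simp only: sq herm[OF xy(2)])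
    have 2: "(\<Sum>r\<in>J. w' r x * cnj (w' r y)) = (if x = i \<or> y = i then 0 else \<Sum>r\<in>J. w r x * cnj (w r y))"
      using insert.hyps by (auto simp: w'_def intro!: sum.neutral sum.cong)
    have x0: "A x i = 0" if "A i i = 0"
      using zero[OF that xy(1)] herm[OF xy(1)] by (metis complex_cnj_zero_iff)
    have y0: "A i y = 0" if "A i i = 0"
      using zero[OF that xy(2)] .
    show ?thesis
    proof (cases "x = i \<or> y = i")
      case True
      have "(\<Sum>r\<in>insert i J. w' r x * cnj (w' r y)) = A x i * A i y / A i i"
        using 1 2 True by simp
      then show ?thesis using True x0 y0 by auto
    next
      case False
      then have "A x y - A x i * A i y / A i i = (\<Sum>r\<in>J. w' r x * cnj (w' r y))"
        using 2 w[of x y] xy by (simp add: B_def)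
      then show ?thesis using 1 by (simp add: diff_eq_eq)
    qed
  qed
  then show ?case by blast
qed

section \<open>Feasible kernels, weak duality and tensor products\<close>

text \<open>Operators are encoded as kernels on an index set and matter only on that set. \<open>P\<close> stands for \<open>1 + T\<close>;
  the linear condition says that \<open>T\<close> is orthogonal to \<open>S \<otimes> L(\<complex>\<^sup>K)\<close>.\<close>

definition feasible :: "'a set \<Rightarrow> 'k set \<Rightarrow> ('a \<Rightarrow> 'a \<Rightarrow> complex) set \<Rightarrow> ('a \<times> 'k \<Rightarrow> 'a \<times> 'k \<Rightarrow> complex) \<Rightarrow> bool" where
  "feasible I K S P \<longleftrightarrow> nonneg_kernel (I \<times> K) P \<and>
    (\<forall>X\<in>S. \<forall>k\<in>K. \<forall>l\<in>K. (\<Sum>i\<in>I. \<Sum>j\<in>I. cnj (X i j) * P (i, k) (j, l)) =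
      (if k = l then \<Sum>i\<in>I. cnj (X i i) else 0))"

text \<open>An upper bound for the primal values over all ancillas, as an inequality of forms. Being
  a predicate, it makes sense before any supremum is known to be finite.\<close>

definition theta_bound :: "'a set \<Rightarrow> ('a \<Rightarrow> 'a \<Rightarrow> complex) set \<Rightarrow> real \<Rightarrow> bool" where
  "theta_bound I S c \<longleftrightarrow> (\<forall>n\<ge>1. \<forall>P. feasible I {..<n::nat} S P \<longrightarrow>
    (\<forall>v. Re (qform (I \<times> {..<n}) P v) \<le> c * sqnorm (I \<times> {..<n}) v))"

definition entangled :: "'a \<times> 'a \<Rightarrow> 'a \<times> 'a \<Rightarrow> complex" where
  "entangled x y = (if fst x = snd x \<and> fst y = snd y then 1 else 0)"

text \<open>The dual feasible points \<open>Y\<close> of value \<open>\<mu>\<close>. Membership in \<open>S \<otimes> L(A)\<close> is expressed by slices.\<close>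

definition dual_witness :: "'a set \<Rightarrow> ('a \<Rightarrow> 'a \<Rightarrow> complex) set \<Rightarrow> real \<Rightarrow> ('a \<times> 'a \<Rightarrow> 'a \<times> 'a \<Rightarrow> complex) \<Rightarrow> bool" where
  "dual_witness I S \<mu> Y \<longleftrightarrow>
    (\<forall>a\<in>I. \<forall>b\<in>I. (\<lambda>i j. Y (i, a) (j, b)) \<in> S) \<and>
    (\<forall>a\<in>I. \<forall>b\<in>I. (\<Sum>i\<in>I. Y (i, a) (i, b)) = (if a = b then of_real \<mu> else 0)) \<and>
    nonneg_kernel (I \<times> I) (\<lambda>x y. Y x y - entangled x y)"

definition tensor :: "('a \<Rightarrow> 'a \<Rightarrow> complex) \<Rightarrow> ('b \<Rightarrow> 'b \<Rightarrow> complex) \<Rightarrow> 'a \<times> 'b \<Rightarrow> 'a \<times> 'b \<Rightarrow> complex" where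
  "tensor A B x y = A (fst x) (fst y) * B (snd x) (snd y)"

text \<open>Exchange of the two middle factors; the same formula, with types renamed, is its
  inverse. It links pairs of (system, ancilla) indices, where a product of two points lives, with
  (system pair, ancilla pair) indices, where feasibility for the tensor product is stated.\<close>

definition shuffle :: "('a \<times> 'b) \<times> ('c \<times> 'd) \<Rightarrow> ('a \<times> 'c) \<times> ('b \<times> 'd)" where
  "shuffle x = ((fst (fst x), fst (snd x)), (snd (fst x), snd (snd x)))"

lemma bij_betw_shuffle: "bij_betw shuffle ((A \<times> B) \<times> (C \<times> D)) ((A \<times> C) \<times> (B \<times> D))"
  by (rule bij_betw_byWitness[where f' = shuffle]) (auto simp: shuffle_def)

section \<open>Change of index set\<close>

lemma qform_reindex:
  assumes "bij_betw f J' J"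
  shows "qform J' (\<lambda>x y. A (f x) (f y)) (\<lambda>x. v (f x)) = qform J A v"
  unfolding qform_def
  by (simp add: sum.reindex_bij_betw[OF assms, of "\<lambda>x. \<Sum>y\<in>J. cnj (v x) * A x y * v y"]
    sum.reindex_bij_betw[OF assms, of "\<lambda>y. cnj (v (f _)) * A (f _) y * v y"])

lemma sqnorm_reindex:
  assumes "bij_betw f J' J"
  shows "sqnorm J' (\<lambda>x. v (f x)) = sqnorm J v"
  unfolding sqnorm_def by (rule sum.reindex_bij_betw[OF assms])

lemma nonneg_kernel_reindex:
  assumes "bij_betw f J' J" "nonneg_kernel J A"
  shows "nonneg_kernel J' (\<lambda>x y. A (f x) (f y))"
  unfolding nonneg_kernel_def
proof
  fix v :: "'a \<Rightarrow> complex"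
  define w where "w = (\<lambda>x. v (inv_into J' f x) :: complex)"
  have "qform J' (\<lambda>x y. A (f x) (f y)) v = qform J' (\<lambda>x y. A (f x) (f y)) (\<lambda>x. w (f x))"
    using assms(1) by (intro qform_cong) (simp_all add: w_def bij_betw_inv_into_left)
  also have "\<dots> = qform J A w"
    by (rule qform_reindex[OF assms(1)])
  finally show "Im (qform J' (\<lambda>x y. A (f x) (f y)) v) = 0 \<and> 0 \<le> Re (qform J' (\<lambda>x y. A (f x) (f y)) v)"
    using nonneg_kernelD[OF assms(2), of w] by simp
qed

lemma bij_betw_map_prod:
  assumes "bij_betw f A A'" "bij_betw g B B'"
  shows "bij_betw (map_prod f g) (A \<times> B) (A' \<times> B')"
  using assms unfolding bij_betw_def by (auto simp: map_prod_inj_on map_prod_surj_on)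

lemma feasible_reindex:
  assumes f: "bij_betw f I' I" and g: "bij_betw g K' K" and "feasible I K S P"
  shows "feasible I' K' ((\<lambda>X i j. X (f i) (f j)) ` S) (\<lambda>x y. P (map_prod f g x) (map_prod f g y))"
proof -
  have "(\<Sum>i\<in>I'. \<Sum>j\<in>I'. cnj (X (f i) (f j)) * P (f i, g k) (f j, g l)) =
      (if k = l then \<Sum>i\<in>I'. cnj (X (f i) (f i)) else 0)"
    if "X \<in> S" "k \<in> K'" "l \<in> K'" for X k l
  proof -
    have mem: "g k \<in> K" "g l \<in> K" and eq: "g k = g l \<longleftrightarrow> k = l"
      using that g by (auto simp: bij_betw_def dest: inj_onD)
    have "(\<Sum>i\<in>I'. \<Sum>j\<in>I'. cnj (X (f i) (f j)) * P (f i, g k) (f j, g l)) =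
      (\<Sum>i\<in>I. \<Sum>j\<in>I. cnj (X i j) * P (i, g k) (j, g l))"
      by (simp add: sum.reindex_bij_betw[OF f, of "\<lambda>j. cnj (X (f _) j) * P (f _, g k) (j, g l)"]
        sum.reindex_bij_betw[OF f, of "\<lambda>i. \<Sum>j\<in>I. cnj (X i j) * P (i, g k) (j, g l)"])
    also have "\<dots> = (if k = l then \<Sum>i\<in>I. cnj (X i i) else 0)"
      using assms(3) that(1) mem by (simp add: feasible_def eq)
    also have "(\<Sum>i\<in>I. cnj (X i i)) = (\<Sum>i\<in>I'. cnj (X (f i) (f i)))"
      by (rule sum.reindex_bij_betw[OF f, symmetric])
    finally show ?thesis .
  qed
  then show ?thesis
    using nonneg_kernel_reindex[OF bij_betw_map_prod[OF f g], of P] assms(3)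
    by (simp add: feasible_def)
qed

text \<open>\<open>theta_bound\<close> speaks only of the ancillas \<open>{..<n}\<close>.
  Enumerating \<open>K\<close> makes it available for products of ancillas and for a copy of the
  system.\<close>

lemma theta_boundD:
  assumes "theta_bound I S c" "feasible I K S P" "finite K" "K \<noteq> {}"
  shows "Re (qform (I \<times> K) P v) \<le> c * sqnorm (I \<times> K) v"
proof -
  obtain g where g: "bij_betw g {..<card K} K"
    using ex_bij_betw_nat_finite[OF assms(3)] by (auto simp: lessThan_atLeast0)
  have n: "1 \<le> card K"
    using assms(3,4) by (simp add: Suc_le_eq card_gt_0_iff)
  have id: "bij_betw (\<lambda>i. i) I I"
    by (simp add: bij_betw_def inj_on_def)
  note b = bij_betw_map_prod[OF id g]
  show ?thesis
    using assms(1) n feasible_reindex[OF id g assms(2)]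
      qform_reindex[OF b, of P v] sqnorm_reindex[OF b, of v]
    unfolding theta_bound_def by (simp only: image_ident) metis
qed

section \<open>Weak duality\<close>

lemma sum_Times: "sum f (A \<times> B) = (\<Sum>a\<in>A. \<Sum>b\<in>B. f (a, b))"
  by (simp add: sum.cartesian_product)

lemma qform_Times:
  "qform (I \<times> K) P v = (\<Sum>i\<in>I. \<Sum>k\<in>K. \<Sum>j\<in>I. \<Sum>l\<in>K. cnj (v (i, k)) * P (i, k) (j, l) * v (j, l))"
  by (simp add: qform_def sum_Times)

text \<open>The vector \<open>v\<close>, read as an operator between the ancilla and a second copy
  of the system, turns \<open>P\<close> into an operator on \<open>I \<times> I\<close> that is
  paired with \<open>Y\<close>. Writing \<open>Y\<close> as \<open>entangled\<close> plus a Gram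
  kernel, the pairing is the form of \<open>P\<close> at \<open>v\<close> plus nonnegative terms.
  Computed slice by slice from feasibility, it is \<open>\<mu>\<close> times the squared norm of
  \<open>v\<close>.\<close>

lemma weak_duality:
  assumes "finite I" "finite K" "feasible I K S P" "dual_witness I S \<mu> Y"
  shows "Re (qform (I \<times> K) P v) \<le> \<mu> * sqnorm (I \<times> K) v"
proof -
  define T where "T = (\<lambda>Z. \<Sum>i\<in>I. \<Sum>k\<in>K. \<Sum>j\<in>I. \<Sum>l\<in>K. \<Sum>a\<in>I. \<Sum>b\<in>I.
    cnj (v (a, k)) * v (b, l) * (cnj (Z (i, a) (j, b)) * P (i, k) (j, l)))"
  obtain w where "\<forall>x\<in>I\<times>I. \<forall>y\<in>I\<times>I. Y x y - entangled x y = (\<Sum>r\<in>I\<times>I. w r x * cnj (w r y))"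
    using cholesky[of "I \<times> I" "\<lambda>x y. Y x y - entangled x y"] assms(1,4) unfolding dual_witness_def by auto
  then have w: "Y x y = entangled x y + (\<Sum>r\<in>I\<times>I. w r x * cnj (w r y))" if "x \<in> I \<times> I" "y \<in> I \<times> I" for x y
    using that by (simp only: diff_eq_eq add.commute[of "entangled x y"])
  have Tcong: "T Z = T Z'" if "\<And>x y. x \<in> I \<times> I \<Longrightarrow> y \<in> I \<times> I \<Longrightarrow> Z x y = Z' x y" for Z Z'
    unfolding T_def using that by (intro sum.cong refl) simp
  have Tsum: "T (\<lambda>x y. \<Sum>r\<in>R. Z r x y) = (\<Sum>r\<in>R. T (Z r))" if "finite R" for R :: "('a \<times> 'a) set" and Z
    using that by (induction R rule: finite_induct)
      (simp_all add: T_def ring_distribs sum.distrib)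
  have Tadd: "T (\<lambda>x y. Z x y + Z' x y) = T Z + T Z'" for Z Z'
    by (simp add: T_def ring_distribs sum.distrib)
  have "T Y = T (\<lambda>x y. entangled x y + (\<Sum>r\<in>I\<times>I. w r x * cnj (w r y)))"
    by (rule Tcong) (rule w)
  also have "\<dots> = T entangled + (\<Sum>r\<in>I\<times>I. T (\<lambda>x y. w r x * cnj (w r y)))"
    using assms(1) by (simp add: Tadd Tsum)
  also have "T entangled = qform (I \<times> K) P v"
    unfolding qform_Times T_def
  proof (intro sum.cong refl)
    fix i k j l assume "i \<in> I" "j \<in> I"
    then have "(\<Sum>a\<in>I. \<Sum>b\<in>I. cnj (v (a, k)) * v (b, l) * (cnj (entangled (i, a) (j, b)) * P (i, k) (j, l))) =
      (\<Sum>a\<in>I. \<Sum>b\<in>I. if j = b then (if i = a then cnj (v (a, k)) * v (b, l) * P (i, k) (j, l) else 0) else 0)"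
      by (intro sum.cong) (auto simp: entangled_def)
    also have "\<dots> = cnj (v (i, k)) * P (i, k) (j, l) * v (j, l)"
      using \<open>finite I\<close> \<open>i \<in> I\<close> \<open>j \<in> I\<close> by simp
    finally show "(\<Sum>a\<in>I. \<Sum>b\<in>I. cnj (v (a, k)) * v (b, l) * (cnj (entangled (i, a) (j, b)) * P (i, k) (j, l))) =
      cnj (v (i, k)) * P (i, k) (j, l) * v (j, l)" .
  qed
  \<comment> \<open>A rank-one summand of \<open>Y - entangled\<close> contributes the form of
    \<open>P\<close> at the contraction of \<open>w r\<close> with \<open>v\<close>, hence a
    nonnegative number.\<close>
  also have "(\<lambda>r. T (\<lambda>x y. w r x * cnj (w r y))) =
      (\<lambda>r. qform (I \<times> K) P (\<lambda>(j, l). \<Sum>b\<in>I. w r (j, b) * v (b, l)))"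
  proof
    fix r
    show "T (\<lambda>x y. w r x * cnj (w r y)) = qform (I \<times> K) P (\<lambda>(j, l). \<Sum>b\<in>I. w r (j, b) * v (b, l))"
      unfolding qform_Times T_def
    proof (intro sum.cong refl)
      fix i k j l
      have "cnj (case (i, k) of (j, l) \<Rightarrow> \<Sum>b\<in>I. w r (j, b) * v (b, l)) * P (i, k) (j, l) *
          (case (j, l) of (j, l) \<Rightarrow> \<Sum>b\<in>I. w r (j, b) * v (b, l)) =
        P (i, k) (j, l) * ((\<Sum>a\<in>I. cnj (w r (i, a) * v (a, k))) * (\<Sum>b\<in>I. w r (j, b) * v (b, l)))"
        by (simp add: mult_ac)
      also have "\<dots> = (\<Sum>a\<in>I. \<Sum>b\<in>I. cnj (v (a, k)) * v (b, l) * (cnj (w r (i, a) * cnj (w r (j, b))) * P (i, k) (j, l)))"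
        unfolding sum_product unfolding sum_distrib_left by (intro sum.cong refl) simp
      finally show "(\<Sum>a\<in>I. \<Sum>b\<in>I. cnj (v (a, k)) * v (b, l) * (cnj (w r (i, a) * cnj (w r (j, b))) * P (i, k) (j, l))) =
        cnj (case (i, k) of (j, l) \<Rightarrow> \<Sum>b\<in>I. w r (j, b) * v (b, l)) * P (i, k) (j, l) *
          (case (j, l) of (j, l) \<Rightarrow> \<Sum>b\<in>I. w r (j, b) * v (b, l))" by simp
    qed
  qed
  finally have TY: "T Y = qform (I \<times> K) P v +
    (\<Sum>r\<in>I \<times> I. qform (I \<times> K) P (\<lambda>(j, l). \<Sum>b\<in>I. w r (j, b) * v (b, l)))" .
  \<comment> \<open>The sums over \<open>i\<close> and \<open>j\<close> are moved inside, where
    feasibility applies to the slice of \<open>Y\<close> at \<open>(a, b)\<close>, a member of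
    \<open>S\<close>.\<close>
  have "T Y = (\<Sum>a\<in>I. \<Sum>b\<in>I. \<Sum>k\<in>K. \<Sum>l\<in>K. \<Sum>i\<in>I. \<Sum>j\<in>I.
      cnj (v (a, k)) * v (b, l) * (cnj (Y (i, a) (j, b)) * P (i, k) (j, l)))"
    unfolding T_def sum.cartesian_product
    by (rule sum.reindex_bij_witness[where i = "\<lambda>(a, b, k, l, i, j). (i, k, j, l, a, b)"
       and j = "\<lambda>(i, k, j, l, a, b). (a, b, k, l, i, j)"]) auto
  also have "\<dots> = (\<Sum>a\<in>I. \<Sum>b\<in>I. \<Sum>k\<in>K. \<Sum>l\<in>K. cnj (v (a, k)) * v (b, l) *
      (\<Sum>i\<in>I. \<Sum>j\<in>I. cnj (Y (i, a) (j, b)) * P (i, k) (j, l)))"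
    by (simp only: sum_distrib_left)
  also have "\<dots> = (\<Sum>a\<in>I. \<Sum>b\<in>I. \<Sum>k\<in>K. \<Sum>l\<in>K.
      if k = l then (if a = b then cnj (v (a, k)) * v (b, l) * of_real \<mu> else 0) else 0)"
  proof (intro sum.cong refl)
    fix a b k l assume m: "a \<in> I" "b \<in> I" "k \<in> K" "l \<in> K"
    have "(\<Sum>i\<in>I. \<Sum>j\<in>I. cnj (Y (i, a) (j, b)) * P (i, k) (j, l)) =
        (if k = l then \<Sum>i\<in>I. cnj (Y (i, a) (i, b)) else 0)"
      using assms(3,4) m by (auto simp: feasible_def dual_witness_def)
    also have "(\<Sum>i\<in>I. cnj (Y (i, a) (i, b))) = cnj (if a = b then of_real \<mu> else 0)"
      using assms(4) m unfolding dual_witness_def by (simp flip: cnj_sum)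
    finally show "cnj (v (a, k)) * v (b, l) * (\<Sum>i\<in>I. \<Sum>j\<in>I. cnj (Y (i, a) (j, b)) * P (i, k) (j, l)) =
      (if k = l then (if a = b then cnj (v (a, k)) * v (b, l) * of_real \<mu> else 0) else 0)"
      by simp
  qed
  also have "\<dots> = (\<Sum>a\<in>I. \<Sum>b\<in>I. \<Sum>k\<in>K. if a = b then cnj (v (a, k)) * v (b, k) * of_real \<mu> else 0)"
    using assms(2) by (intro sum.cong refl) simp
  also have "\<dots> = (\<Sum>a\<in>I. \<Sum>b\<in>I. if a = b then (\<Sum>k\<in>K. cnj (v (a, k)) * v (b, k) * of_real \<mu>) else 0)"
    by (intro sum.cong refl) simp
  also have "\<dots> = (\<Sum>a\<in>I. \<Sum>k\<in>K. cnj (v (a, k)) * v (a, k) * of_real \<mu>)"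
    using assms(1) by simp
  also have "\<dots> = (\<Sum>a\<in>I. \<Sum>k\<in>K. of_real (\<mu> * (cmod (v (a, k)))\<^sup>2))"
  proof (intro sum.cong refl)
    fix a k
    show "cnj (v (a, k)) * v (a, k) * of_real \<mu> = of_real (\<mu> * (cmod (v (a, k)))\<^sup>2)"
      unfolding of_real_mult complex_norm_square by simp
  qed
  also have "\<dots> = of_real (\<mu> * sqnorm (I \<times> K) v)"
    by (simp add: sqnorm_def sum.cartesian_product sum_distrib_left split_def)
  finally have "Re (T Y) = \<mu> * sqnorm (I \<times> K) v" by simp
  moreover have "0 \<le> Re (\<Sum>r\<in>I \<times> I. qform (I \<times> K) P (\<lambda>(j, l). \<Sum>b\<in>I. w r (j, b) * v (b, l)))"
    using assms(3) unfolding feasible_def Re_sum by (intro sum_nonneg) (blast dest: nonneg_kernelD)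
  ultimately show ?thesis using TY by simp
qed

section \<open>Tensor products of primal and dual points\<close>

lemma nonneg_kernel_tensor:
  assumes "finite I" "finite J" "nonneg_kernel I A" "nonneg_kernel J B"
  shows "nonneg_kernel (I \<times> J) (tensor A B)"
proof -
  \<comment> \<open>Products of Gram vectors of the factors are Gram vectors of the tensor
    product.\<close>
  obtain w u where "\<forall>x\<in>I. \<forall>y\<in>I. A x y = (\<Sum>r\<in>I. w r x * cnj (w r y))"
    and "\<forall>x\<in>J. \<forall>y\<in>J. B x y = (\<Sum>r\<in>J. u r x * cnj (u r y))"
    using cholesky[OF assms(1,3)] cholesky[OF assms(2,4)] by blast
  then have "tensor A B x y =
      (\<Sum>r\<in>I\<times>J. (w (fst r) (fst x) * u (snd r) (snd x)) * cnj (w (fst r) (fst y) * u (snd r) (snd y)))"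
    if "x \<in> I \<times> J" "y \<in> I \<times> J" for x y
    using that by (auto simp: tensor_def sum_product sum.cartesian_product split_def mult_ac intro!: sum.cong)
  then show ?thesis by (rule nonneg_kernel_gram)
qed

lemma qform_tensor:
  "qform (I \<times> J) (tensor A B) (\<lambda>x. v (fst x) * w (snd x)) = qform I A v * qform J B w"
proof -
  have "qform (I \<times> J) (tensor A B) (\<lambda>x. v (fst x) * w (snd x)) =
    (\<Sum>i\<in>I. \<Sum>k\<in>J. \<Sum>j\<in>I. \<Sum>l\<in>J. (cnj (v i) * A i j * v j) * (cnj (w k) * B k l * w l))"
    unfolding qform_Times by (intro sum.cong refl) (simp add: tensor_def)
  also have "\<dots> = qform I A v * qform J B w"
    unfolding qform_def by (simp only: sum_product)
  finally show ?thesis .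
qed

lemma sqnorm_tensor:
  "sqnorm (I \<times> J) (\<lambda>x. v (fst x) * w (snd x)) = sqnorm I v * sqnorm J w"
  by (simp add: sqnorm_def sum_product sum.cartesian_product split_def norm_mult power_mult_distrib)

text \<open>Pure tensors only. The feasibility condition is conjugate-linear in the test operator,
  so it holds on the span once it holds here (\<open>theta_bound_tensor_space\<close>).\<close>

definition tensor_set :: "('a \<Rightarrow> 'a \<Rightarrow> complex) set \<Rightarrow> ('b \<Rightarrow> 'b \<Rightarrow> complex) set \<Rightarrow> ('a \<times> 'b \<Rightarrow> 'a \<times> 'b \<Rightarrow> complex) set" where
  "tensor_set S1 S2 = {tensor X1 X2 | X1 X2. X1 \<in> S1 \<and> X2 \<in> S2}"

text \<open>For a pure tensor the contraction with the product point factorises into the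
  contractions of the factors. The right-hand side does so too, since traces multiply and
  \<open>k = l\<close> means equality of both components.\<close>

lemma feasible_tensor:
  assumes "finite I1" "finite I2" "finite K1" "finite K2"
    and "feasible I1 K1 S1 P1" "feasible I2 K2 S2 P2"
  shows "feasible (I1 \<times> I2) (K1 \<times> K2) (tensor_set S1 S2) (\<lambda>x y. tensor P1 P2 (shuffle x) (shuffle y))"
  unfolding feasible_def
proof (intro conjI ballI)
  show "nonneg_kernel ((I1 \<times> I2) \<times> (K1 \<times> K2)) (\<lambda>x y. tensor P1 P2 (shuffle x) (shuffle y))"
    using assms by (intro nonneg_kernel_reindex[OF bij_betw_shuffle] nonneg_kernel_tensor) (auto simp: feasible_def)
  fix X k l assume "X \<in> tensor_set S1 S2" and kl: "k \<in> K1 \<times> K2" "l \<in> K1 \<times> K2"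
  then obtain X1 X2 where X: "X = tensor X1 X2" "X1 \<in> S1" "X2 \<in> S2"
    unfolding tensor_set_def by blast
  obtain k1 k2 l1 l2 where kl': "k = (k1, k2)" "l = (l1, l2)" "k1 \<in> K1" "k2 \<in> K2" "l1 \<in> K1" "l2 \<in> K2"
    using kl by auto
  have "(\<Sum>i\<in>I1\<times>I2. \<Sum>j\<in>I1\<times>I2. cnj (X i j) * tensor P1 P2 (shuffle (i, k)) (shuffle (j, l))) =
    (\<Sum>i1\<in>I1. \<Sum>i2\<in>I2. \<Sum>j1\<in>I1. \<Sum>j2\<in>I2.
      (cnj (X1 i1 j1) * P1 (i1, k1) (j1, l1)) * (cnj (X2 i2 j2) * P2 (i2, k2) (j2, l2)))"
    by (simp add: X kl' tensor_def shuffle_def mult_ac sum_Times)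
  also have "\<dots> = (\<Sum>i\<in>I1. \<Sum>j\<in>I1. cnj (X1 i j) * P1 (i, k1) (j, l1)) *
      (\<Sum>i\<in>I2. \<Sum>j\<in>I2. cnj (X2 i j) * P2 (i, k2) (j, l2))"
    by (simp only: sum_product)
  also have "\<dots> = (if k1 = l1 then \<Sum>i\<in>I1. cnj (X1 i i) else 0) * (if k2 = l2 then \<Sum>i\<in>I2. cnj (X2 i i) else 0)"
    using assms(5,6) X kl' by (simp add: feasible_def)
  also have "\<dots> = (if k = l then \<Sum>i\<in>I1\<times>I2. cnj (X i i) else 0)"
    by (simp add: kl' X tensor_def sum_product sum.cartesian_product split_def)
  finally show "(\<Sum>i\<in>I1\<times>I2. \<Sum>j\<in>I1\<times>I2. cnj (X i j) * tensor P1 P2 (shuffle (i, k)) (shuffle (j, l))) =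
    (if k = l then \<Sum>i\<in>I1\<times>I2. cnj (X i i) else 0)" .
qed

text \<open>The product point is tested on product vectors only; this already bounds the product of
  any two primal values, which is what supermultiplicativity requires.\<close>

lemma theta_bound_tensorD:
  assumes "finite I1" "finite I2" "finite K1" "finite K2" "K1 \<noteq> {}" "K2 \<noteq> {}"
    and "feasible I1 K1 S1 P1" "feasible I2 K2 S2 P2"
    and "theta_bound (I1 \<times> I2) (tensor_set S1 S2) c"
  shows "Re (qform (I1 \<times> K1) P1 v1) * Re (qform (I2 \<times> K2) P2 v2) \<le>
    c * (sqnorm (I1 \<times> K1) v1 * sqnorm (I2 \<times> K2) v2)"
proof -
  let ?v = "\<lambda>x. v1 (fst x) * v2 (snd x)"
  have "Re (qform ((I1 \<times> I2) \<times> (K1 \<times> K2)) (\<lambda>x y. tensor P1 P2 (shuffle x) (shuffle y)) (\<lambda>x. ?v (shuffle x)))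
    \<le> c * sqnorm ((I1 \<times> I2) \<times> (K1 \<times> K2)) (\<lambda>x. ?v (shuffle x))"
    using assms by (intro theta_boundD[OF assms(9)] feasible_tensor) auto
  \<comment> \<open>Makes the real part of the product of the two forms the product of their real
    parts.\<close>
  moreover have "Im (qform (I1 \<times> K1) P1 v1) = 0"
    using assms(7) by (auto simp: feasible_def dest: nonneg_kernelD)
  ultimately show ?thesis
    unfolding qform_reindex[OF bij_betw_shuffle, where A = "tensor P1 P2" and v = ?v] sqnorm_reindex[OF bij_betw_shuffle, where v = ?v]
      qform_tensor sqnorm_tensor
    by simp
qed

lemma nonneg_kernel_entangled: "nonneg_kernel J entangled"
  by (rule nonneg_kernel_gram[where R = "{()}" and w = "\<lambda>_ x. if fst x = snd x then 1 else 0"])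
    (simp add: entangled_def)

text \<open>Up to the exchange of factors, \<open>entangled\<close> on the product is the tensor
  product of the smaller ones. With E for \<open>entangled\<close>, positivity follows from Y1
  \<otimes> Y2 - E \<otimes> E = (Y1 - E) \<otimes> Y2 + E \<otimes> (Y2 - E), where Y2 = (Y2 - E) +
  E is nonnegative.\<close>

lemma dual_witness_tensor:
  assumes "finite I1" "finite I2" "dual_witness I1 S1 \<mu>1 Y1" "dual_witness I2 S2 \<mu>2 Y2"
  shows "dual_witness (I1 \<times> I2) (tensor_set S1 S2) (\<mu>1 * \<mu>2) (\<lambda>x y. tensor Y1 Y2 (shuffle x) (shuffle y))"
  unfolding dual_witness_def
proof (intro conjI ballI)
  fix a b assume ab: "a \<in> I1 \<times> I2" "b \<in> I1 \<times> I2"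
  obtain a1 a2 b1 b2 where ab': "a = (a1, a2)" "b = (b1, b2)" "a1 \<in> I1" "a2 \<in> I2" "b1 \<in> I1" "b2 \<in> I2"
    using ab by auto
  have "(\<lambda>i j. tensor Y1 Y2 (shuffle (i, a)) (shuffle (j, b))) =
      tensor (\<lambda>i j. Y1 (i, a1) (j, b1)) (\<lambda>i j. Y2 (i, a2) (j, b2))"
    by (simp add: fun_eq_iff tensor_def shuffle_def ab')
  moreover have "(\<lambda>i j. Y1 (i, a1) (j, b1)) \<in> S1" "(\<lambda>i j. Y2 (i, a2) (j, b2)) \<in> S2"
    using assms(3,4) ab' by (simp_all add: dual_witness_def)
  ultimately show "(\<lambda>i j. tensor Y1 Y2 (shuffle (i, a)) (shuffle (j, b))) \<in> tensor_set S1 S2"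
    unfolding tensor_set_def by blast
  have "(\<Sum>i\<in>I1\<times>I2. tensor Y1 Y2 (shuffle (i, a)) (shuffle (i, b))) =
    (\<Sum>i\<in>I1. Y1 (i, a1) (i, b1)) * (\<Sum>i\<in>I2. Y2 (i, a2) (i, b2))"
    by (simp add: sum_product sum.cartesian_product split_def ab' tensor_def shuffle_def)
  also have "\<dots> = (if a = b then of_real (\<mu>1 * \<mu>2) else 0)"
    using assms(3,4) ab' by (simp add: dual_witness_def)
  finally show "(\<Sum>i\<in>I1\<times>I2. tensor Y1 Y2 (shuffle (i, a)) (shuffle (i, b))) =
    (if a = b then of_real (\<mu>1 * \<mu>2) else 0)" .
next
  let ?Z1 = "\<lambda>x y. Y1 x y - entangled x y" and ?Z2 = "\<lambda>x y. Y2 x y - entangled x y"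
  have Z: "nonneg_kernel (I1 \<times> I1) ?Z1" "nonneg_kernel (I2 \<times> I2) ?Z2"
    using assms(3,4) by (simp_all add: dual_witness_def)
  have Y2: "nonneg_kernel (I2 \<times> I2) Y2"
    using nonneg_kernel_add[OF Z(2) nonneg_kernel_entangled] by simp
  have "nonneg_kernel ((I1 \<times> I1) \<times> (I2 \<times> I2)) (\<lambda>x y. tensor ?Z1 Y2 x y + tensor entangled ?Z2 x y)"
    using assms(1,2) Z Y2 by (intro nonneg_kernel_add nonneg_kernel_tensor nonneg_kernel_entangled) auto
  moreover have "tensor ?Z1 Y2 (shuffle x) (shuffle y) + tensor entangled ?Z2 (shuffle x) (shuffle y) =
      tensor Y1 Y2 (shuffle x) (shuffle y) - entangled x y" for x y :: "('a \<times> 'b) \<times> 'a \<times> 'b"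
    by (auto simp: tensor_def shuffle_def entangled_def algebra_simps prod_eq_iff)
  ultimately show "nonneg_kernel ((I1 \<times> I2) \<times> I1 \<times> I2) (\<lambda>x y. tensor Y1 Y2 (shuffle x) (shuffle y) - entangled x y)"
    using nonneg_kernel_reindex[OF bij_betw_shuffle[of I1 I2 I1 I2],
      of "\<lambda>x y. tensor ?Z1 Y2 x y + tensor entangled ?Z2 x y"] by simp
qed

section \<open>Hahn-Banach for sublinear functions on finitely many coordinates\<close>

text \<open>Scalars are real although coordinates are complex: the functional is found as a
  real-linear one, and complex coefficients are assembled afterwards. Scaling is asked as an
  inequality, which is easier to verify for infima; \<open>sublinear_scale\<close> derives equality
  from the factor 1/r.\<close>

definition sublinear :: "(('j \<Rightarrow> complex) \<Rightarrow> real) \<Rightarrow> bool" where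
  "sublinear p \<longleftrightarrow> (\<forall>f g. p (\<lambda>j. f j + g j) \<le> p f + p g) \<and>
    (\<forall>r\<ge>0. \<forall>f. p (\<lambda>j. of_real r * f j) \<le> r * p f)"

lemma sublinear_add: "sublinear p \<Longrightarrow> p (\<lambda>j. f j + g j) \<le> p f + p g"
  by (simp add: sublinear_def)

lemma sublinear_scale_le: "sublinear p \<Longrightarrow> 0 \<le> r \<Longrightarrow> p (\<lambda>j. of_real r * f j) \<le> r * p f"
  by (simp add: sublinear_def)

lemma sublinear_zero: "sublinear p \<Longrightarrow> p (\<lambda>j. 0) = 0"
  using sublinear_add[of p "\<lambda>j. 0" "\<lambda>j. 0"] sublinear_scale_le[of p 0 "\<lambda>j. 0"] by simp

lemma sublinear_uminus: "sublinear p \<Longrightarrow> - p (\<lambda>j. - f j) \<le> p f"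
  using sublinear_add[of p f "\<lambda>j. - f j"] sublinear_zero[of p] by simp

lemma sublinear_scale:
  assumes "sublinear p" "0 \<le> r"
  shows "p (\<lambda>j. of_real r * f j) = r * p f"
proof (cases "r = 0")
  case True
  then show ?thesis using sublinear_zero[OF assms(1)] by simp
next
  case False
  then have "r > 0" using assms(2) by simp
  have "p f = p (\<lambda>j. of_real (inverse r) * (of_real r * f j))"
    using False by (simp add: mult.assoc [symmetric] flip: of_real_mult)
  also have "\<dots> \<le> inverse r * p (\<lambda>j. of_real r * f j)"
    using \<open>r > 0\<close> by (intro sublinear_scale_le[OF assms(1)]) simp
  finally have "r * p f \<le> p (\<lambda>j. of_real r * f j)"
    using \<open>r > 0\<close> by (simp add: field_simps)
  then show ?thesis using sublinear_scale_le[OF assms, of f] by simp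
qed

text \<open>The largest sublinear function below \<open>p\<close> that is linear along \<open>x\<close> with value \<open>p x\<close> at \<open>x\<close>.\<close>

definition tighten :: "(('j \<Rightarrow> complex) \<Rightarrow> real) \<Rightarrow> ('j \<Rightarrow> complex) \<Rightarrow> ('j \<Rightarrow> complex) \<Rightarrow> real" where
  "tighten p x f = (INF s\<in>{0..}. p (\<lambda>j. f j + of_real s * x j) - s * p x)"

lemma tighten_le:
  assumes "sublinear p" "0 \<le> s"
  shows "tighten p x f \<le> p (\<lambda>j. f j + of_real s * x j) - s * p x"
  unfolding tighten_def
proof (rule cINF_lower)
  show "bdd_below ((\<lambda>s. p (\<lambda>j. f j + of_real s * x j) - s * p x) ` {0..})"
  \<comment> \<open>Subadditivity applied to s x = (f + s x) + (- f) bounds all terms below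
    independently of \<open>s\<close>.\<close>
  proof (rule bdd_belowI2[where m = "- p (\<lambda>j. - f j)"])
    fix s :: real assume "s \<in> {0..}"
    have "s * p x = p (\<lambda>j. (f j + of_real s * x j) + - f j)"
      using sublinear_scale[OF assms(1), of s x] \<open>s \<in> {0..}\<close> by simp
    also have "\<dots> \<le> p (\<lambda>j. f j + of_real s * x j) + p (\<lambda>j. - f j)"
      by (rule sublinear_add[OF assms(1)])
    finally show "- p (\<lambda>j. - f j) \<le> p (\<lambda>j. f j + of_real s * x j) - s * p x" by simp
  qed
qed (use assms in simp)

lemma tighten_greatest:
  assumes "\<And>s. 0 \<le> s \<Longrightarrow> b \<le> p (\<lambda>j. f j + of_real s * x j) - s * p x"
  shows "b \<le> tighten p x f"
  unfolding tighten_def using assms by (intro cINF_greatest) auto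

lemma sublinear_tighten:
  assumes "sublinear p"
  shows "sublinear (tighten p x)"
  unfolding sublinear_def
proof (intro conjI allI impI)
  fix f g
  have "tighten p x (\<lambda>j. f j + g j) - (p (\<lambda>j. g j + of_real t * x j) - t * p x) \<le>
      p (\<lambda>j. f j + of_real s * x j) - s * p x" if "0 \<le> s" "0 \<le> t" for s t
  proof -
    have "tighten p x (\<lambda>j. f j + g j) \<le> p (\<lambda>j. (f j + g j) + of_real (s + t) * x j) - (s + t) * p x"
      using that by (intro tighten_le[OF assms]) simp
    also have "(\<lambda>j. (f j + g j) + of_real (s + t) * x j) =
        (\<lambda>j. (f j + of_real s * x j) + (g j + of_real t * x j))"
      by (simp add: algebra_simps)
    finally show ?thesis
      using sublinear_add[OF assms, of "\<lambda>j. f j + of_real s * x j" "\<lambda>j. g j + of_real t * x j"]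
      by (simp add: algebra_simps)
  qed
  then have "tighten p x (\<lambda>j. f j + g j) - (p (\<lambda>j. g j + of_real t * x j) - t * p x) \<le> tighten p x f"
    if "0 \<le> t" for t using that by (intro tighten_greatest)
  then have "tighten p x (\<lambda>j. f j + g j) - tighten p x f \<le> tighten p x g"
    by (intro tighten_greatest) (simp add: algebra_simps)
  then show "tighten p x (\<lambda>j. f j + g j) \<le> tighten p x f + tighten p x g" by simp
next
  fix r :: real and f assume "0 \<le> r"
  show "tighten p x (\<lambda>j. of_real r * f j) \<le> r * tighten p x f"
  proof (cases "r = 0")
    case True
    then show ?thesis using tighten_le[OF assms, of 0 x "\<lambda>j. 0"] sublinear_zero[OF assms] by simp
  next
    case False
    then have r: "r > 0" using \<open>0 \<le> r\<close> by simp
    have "tighten p x (\<lambda>j. of_real r * f j) / r \<le> tighten p x f"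
    proof (rule tighten_greatest)
      fix s :: real assume s: "0 \<le> s"
      have "tighten p x (\<lambda>j. of_real r * f j) \<le>
          p (\<lambda>j. of_real r * f j + of_real (r * s) * x j) - r * s * p x"
        using r s by (intro tighten_le[OF assms]) simp
      also have "(\<lambda>j. of_real r * f j + of_real (r * s) * x j) = (\<lambda>j. of_real r * (f j + of_real s * x j))"
        by (simp add: algebra_simps)
      also have "p \<dots> \<le> r * p (\<lambda>j. f j + of_real s * x j)"
        using r by (intro sublinear_scale_le[OF assms]) simp
      finally show "tighten p x (\<lambda>j. of_real r * f j) / r \<le> p (\<lambda>j. f j + of_real s * x j) - s * p x"
        using r by (simp add: field_simps)
    qed
    then show ?thesis using r by (simp add: field_simps)
  qed
qed

lemma tighten_below: "sublinear p \<Longrightarrow> tighten p x f \<le> p f"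
  using tighten_le[of p 0 x f] by simp

text \<open>The choice \<open>s = 1\<close> in the infimum. With \<open>tighten_below\<close> it
  forces every sublinear function below \<open>tighten p x\<close> to take the value
  \<open>p x\<close> at \<open>x\<close> and its negative at - x.\<close>

lemma tighten_uminus: "sublinear p \<Longrightarrow> tighten p x (\<lambda>j. - x j) \<le> - p x"
  using tighten_le[of p 1 x "\<lambda>j. - x j"] sublinear_zero[of p] by simp

text \<open>One tightening per direction takes the place of a maximality argument. Later tightenings
  do not spoil earlier directions: if \<open>q\<close> lies below \<open>tighten p x\<close>, then q
  (- x) \<le> - p x \<le> - q x.\<close>

lemma sublinear_linearize:
  assumes "sublinear p"
  shows "\<exists>q. sublinear q \<and> (\<forall>f. q f \<le> p f) \<and> (\<forall>x\<in>set xs. q (\<lambda>j. - x j) \<le> - q x)"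
  using assms
proof (induction xs arbitrary: p)
  case Nil
  then show ?case by auto
next
  case (Cons x xs)
  obtain q where q: "sublinear q" "\<And>f. q f \<le> tighten p x f" "\<forall>y\<in>set xs. q (\<lambda>j. - y j) \<le> - q y"
    using Cons.IH[OF sublinear_tighten[OF Cons.prems, of x]] by blast
  have le: "q f \<le> p f" for f
    using q(2) tighten_below[OF Cons.prems] order_trans by blast
  have "q (\<lambda>j. - x j) \<le> - q x"
    using q(2)[of "\<lambda>j. - x j"] tighten_uminus[OF Cons.prems, of x] le[of x] by simp
  then show ?case using q le by auto
qed

text \<open>Subadditivity gives one inequality for \<open>t\<close> of either sign; applied with - t
  at the shifted point, it gives the other.\<close>

lemma sublinear_linear_direction:
  assumes "sublinear q" "q (\<lambda>j. - x j) \<le> - q x"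
  shows "q (\<lambda>j. f j + of_real t * x j) = q f + t * q x"
proof -
  have le: "q (\<lambda>j. g j + of_real t * x j) \<le> q g + t * q x" for g t
  proof (cases "0 \<le> t")
    case True
    then show ?thesis
      using sublinear_add[OF assms(1), of g "\<lambda>j. of_real t * x j"] sublinear_scale[OF assms(1), of t x] by simp
  next
    case False
    have "q (\<lambda>j. of_real (- t) * - x j) = - t * q (\<lambda>j. - x j)"
      using False by (intro sublinear_scale[OF assms(1)]) simp
    also have "\<dots> \<le> - t * - q x"
      using False assms(2) by (intro mult_left_mono) auto
    finally show ?thesis
      using sublinear_add[OF assms(1), of g "\<lambda>j. of_real t * x j"] by simp
  qed
  have "q f \<le> q (\<lambda>j. f j + of_real t * x j) + - t * q x"
    using le[of "\<lambda>j. f j + of_real t * x j" "- t"] by simp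
  then show ?thesis using le[of f t] by simp
qed

text \<open>Tightening along \<open>x0\<close> before all other directions guarantees that the
  functional attains \<open>p\<close> there. Tightening along 1 and \<i> at every coordinate then
  makes it linear.\<close>

lemma hahn_banach_finite:
  fixes p :: "('j \<Rightarrow> complex) \<Rightarrow> real"
  assumes "finite J" "sublinear p" and cong: "\<And>f g. (\<And>j. j \<in> J \<Longrightarrow> f j = g j) \<Longrightarrow> p f = p g"
  shows "\<exists>c. Re (\<Sum>j\<in>J. c j * x0 j) = p x0 \<and> (\<forall>f. Re (\<Sum>j\<in>J. c j * f j) \<le> p f)"
proof -
  define e where "e = (\<lambda>(a::complex) k j. if j = (k::'j) then a else 0)"
  \<comment> \<open>Linearity is known only along the coordinate directions in \<open>J\<close>, so
    vectors are cut off outside \<open>J\<close>; by \<open>cong\<close> this leaves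
    \<open>p\<close> unchanged.\<close>
  define rst where "rst = (\<lambda>A (f :: 'j \<Rightarrow> complex) j. if j \<in> A then f j else 0)"
  obtain js where js: "set js = J" using finite_list[OF assms(1)] by blast
  obtain q where q: "sublinear q" "\<And>f. q f \<le> tighten p (rst J x0) f"
    and lin: "\<forall>x\<in>set (map (e 1) js @ map (e \<i>) js). q (\<lambda>j. - x j) \<le> - q x"
    using sublinear_linearize[OF sublinear_tighten[OF assms(2), of "rst J x0"]] by blast
  have le: "q f \<le> p f" for f
    using q(2) tighten_below[OF assms(2)] order_trans by blast
  have "q (\<lambda>j. - rst J x0 j) \<le> - p (rst J x0)"
    using q(2)[of "\<lambda>j. - rst J x0 j"] tighten_uminus[OF assms(2)] order_trans by blast
  then have x0: "q (rst J x0) = p (rst J x0)"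
    using sublinear_uminus[OF q(1), of "rst J x0"] le[of "rst J x0"] by simp
  have e: "q (\<lambda>j. - e 1 k j) \<le> - q (e 1 k)" "q (\<lambda>j. - e \<i> k j) \<le> - q (e \<i> k)" if "k \<in> J" for k
    using lin that js by auto
  \<comment> \<open>The coefficient for which
    \<open>Re (c k * z) = Re z * q (e 1 k) + Im z * q (e \<i> k)\<close>.\<close>
  define c where "c = (\<lambda>k. Complex (q (e 1 k)) (- q (e \<i> k)))"
  have repr: "q (rst A f) = Re (\<Sum>j\<in>A. c j * f j)" if "finite A" "A \<subseteq> J" for A f
    using that
  proof (induction A rule: finite_induct)
    case empty
    then show ?case by (simp add: rst_def sublinear_zero[OF q(1)])
  next
    case (insert k A)
    have eq: "rst (insert k A) f = (\<lambda>j. (rst A f j + of_real (Re (f k)) * e 1 k j) + of_real (Im (f k)) * e \<i> k j)"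
      using insert.hyps by (auto simp: rst_def e_def fun_eq_iff complex_eq_iff)
    have "q (rst (insert k A) f) = q (rst A f) + Re (f k) * q (e 1 k) + Im (f k) * q (e \<i> k)"
      unfolding eq using sublinear_linear_direction[OF q(1) e(1)] sublinear_linear_direction[OF q(1) e(2)] insert.prems by simp
    then show ?case using insert by (simp add: c_def)
  qed
  have pr: "p (rst J f) = p f" for f
    by (rule cong) (simp add: rst_def)
  show ?thesis
    using repr[OF assms(1) subset_refl] x0 le[of "rst J _"] pr by metis
qed

section \<open>Strong duality\<close>

text \<open>Any factor \<open>L\<close> with \<open>\<rho> + \<epsilon> = L L\<^sup>*\<close> can
  play the part of the square root, so a Cholesky factor is taken. It is invertible because the form
  of \<open>\<rho> + \<epsilon>\<close> at a vector is at least \<open>\<epsilon>\<close> times its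
  squared norm.\<close>

lemma kernel_inverse:
  fixes \<rho> :: "nat \<Rightarrow> nat \<Rightarrow> complex"
  assumes "nonneg_kernel {..<d} \<rho>" "\<epsilon> > 0"
  shows "\<exists>L N. (\<forall>a\<in>{..<d}. \<forall>b\<in>{..<d}. \<rho> a b + (if a = b then of_real \<epsilon> else 0) = (\<Sum>r<d. L a r * cnj (L b r))) \<and>
    (\<forall>a\<in>{..<d}. \<forall>b\<in>{..<d}. (\<Sum>r<d. N a r * L r b) = (if a = b then 1 else 0)) \<and>
    (\<forall>a\<in>{..<d}. \<forall>b\<in>{..<d}. (\<Sum>r<d. L a r * N r b) = (if a = b then 1 else 0))"
proof -
  define \<sigma> where "\<sigma> = (\<lambda>a b. \<rho> a b + of_real \<epsilon> * (if a = b then 1 else 0))"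
  have q: "qform {..<d} \<sigma> v = qform {..<d} \<rho> v + of_real (\<epsilon> * sqnorm {..<d} v)" for v
    unfolding \<sigma>_def qform_add qform_scale by (simp add: qform_id)
  have "nonneg_kernel {..<d} \<sigma>"
    unfolding \<sigma>_def using assms by (intro nonneg_kernel_add nonneg_kernel_scale nonneg_kernel_id) auto
  then obtain w where "\<forall>a\<in>{..<d}. \<forall>b\<in>{..<d}. \<sigma> a b = (\<Sum>r\<in>{..<d}. w r a * cnj (w r b))"
    using cholesky by blast
  then have w: "\<sigma> a b = (\<Sum>r<d. w r a * cnj (w r b))" if "a < d" "b < d" for a b
    using that by auto
  define M where "M = mat d d (\<lambda>(a, r). w r a)"
  have M: "M \<in> carrier_mat d d" by (simp add: M_def)
  have "det M \<noteq> 0"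
  proof
    assume "det M = 0"
    then have "det (transpose_mat M) = 0" using det_transpose[OF M] by simp
    then obtain v where v: "v \<in> carrier_vec d" "v \<noteq> 0\<^sub>v d" "transpose_mat M *\<^sub>v v = 0\<^sub>v d"
      using det_0_iff_vec_prod_zero[of "transpose_mat M" d] M by auto
    have s: "(\<Sum>a<d. w r a * v $ a) = 0" if "r < d" for r
    proof -
      have "(transpose_mat M *\<^sub>v v) $ r = (\<Sum>a<d. w r a * v $ a)"
        using that v(1) M by (simp add: scalar_prod_def M_def lessThan_atLeast0)
      then show ?thesis using v(3) that by simp
    qed
    \<comment> \<open>Conjugated because the Gram expansion pairs its argument with the conjugates
      of the vectors \<open>w r\<close>.\<close>
    define u where "u = (\<lambda>a. cnj (v $ a))"
    have "qform {..<d} \<sigma> u = (\<Sum>r<d. of_real ((cmod (\<Sum>a<d. cnj (w r a) * u a))\<^sup>2))"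
      by (rule qform_gram) (simp add: w)
    also have "\<dots> = 0"
    proof (rule sum.neutral, rule ballI)
      fix r assume "r \<in> {..<d}"
      have "(\<Sum>a<d. cnj (w r a) * u a) = cnj (\<Sum>a<d. w r a * v $ a)"
        by (simp add: u_def)
      also have "\<dots> = 0" using s \<open>r \<in> {..<d}\<close> by simp
      finally show "complex_of_real ((cmod (\<Sum>a<d. cnj (w r a) * u a))\<^sup>2) = 0" by simp
    qed
    finally have "Re (qform {..<d} \<sigma> u) = 0" by simp
    then have "Re (qform {..<d} \<rho> u) + \<epsilon> * sqnorm {..<d} u = 0"
      unfolding q by simp
    then have "sqnorm {..<d} u = 0"
      using nonneg_kernelD(2)[OF assms(1), of u] sqnorm_nonneg[of "{..<d}" u] assms(2)
      by (smt (verit) mult_pos_pos)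
    then have "v $ a = 0" if "a < d" for a
      using that by (simp add: sqnorm_def sum_nonneg_eq_0_iff u_def)
    then have "v = 0\<^sub>v d" using v(1) by auto
    then show False using v(2) by simp
  qed
  from det_non_zero_imp_unit[OF M this, of "()"]
  obtain N where N: "N \<in> carrier_mat d d" "N * M = 1\<^sub>m d" "M * N = 1\<^sub>m d"
    unfolding Units_def by (auto simp: ring_mat_simps)
  have "(\<Sum>r<d. N $$ (a, r) * w b r) = (if a = b then 1 else 0)" if "a < d" "b < d" for a b
  proof -
    have "(N * M) $$ (a, b) = (\<Sum>r<d. N $$ (a, r) * w b r)"
      using that N(1) by (simp add: M_def scalar_prod_def lessThan_atLeast0)
    then show ?thesis using that N(2) by simp
  qed
  moreover have "(\<Sum>r<d. w r a * N $$ (r, b)) = (if a = b then 1 else 0)" if "a < d" "b < d" for a b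
  proof -
    have "(M * N) $$ (a, b) = (\<Sum>r<d. w r a * N $$ (r, b))"
      using that N(1) by (simp add: M_def scalar_prod_def lessThan_atLeast0)
    then show ?thesis using that N(3) by simp
  qed
  moreover have "\<rho> a b + (if a = b then of_real \<epsilon> else 0) = (\<Sum>r<d. w r a * cnj (w r b))" if "a < d" "b < d" for a b
    using w[OF that] by (simp add: \<sigma>_def split: if_splits)
  ultimately show ?thesis
    by (intro exI[of _ "\<lambda>a r. w r a"] exI[of _ "\<lambda>a b. N $$ (a, b)"]) simp
qed

text \<open>The program with \<open>1 \<otimes> \<rho>\<close> in place of \<open>1\<close>: after a small perturbation \<open>\<rho>\<close> is invertible,
  say \<open>\<rho> = L L\<^sup>*\<close>, and conjugation with \<open>1 \<otimes> L\<^sup>-\<^sup>1\<close> leads back to the case \<open>\<rho> = 1\<close>.\<close>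

lemma theta_bound_weighted:
  fixes d :: nat
  defines "I \<equiv> {..<d}"
  assumes "theta_bound I S c" "d \<ge> 1" and Q: "nonneg_kernel (I \<times> I) Q"
    and slice: "\<And>X a b. X \<in> S \<Longrightarrow> a \<in> I \<Longrightarrow> b \<in> I \<Longrightarrow>
      (\<Sum>i\<in>I. \<Sum>j\<in>I. cnj (X i j) * Q (i, a) (j, b)) = (\<Sum>i\<in>I. cnj (X i i)) * \<rho> a b"
    and \<rho>: "nonneg_kernel I \<rho>"
  shows "Re (\<Sum>a\<in>I. \<Sum>b\<in>I. Q (a, a) (b, b)) \<le> c * Re (\<Sum>a\<in>I. \<rho> a a)"
proof -
  \<comment> \<open>The vector whose rank-one operator is \<open>entangled\<close>; the form of
    \<open>Q\<close> at \<open>\<phi>\<close> is the left-hand side of the claim.\<close>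
  define \<phi> where "\<phi> = (\<lambda>x :: nat \<times> nat. if fst x = snd x then 1 else 0 :: complex)"
  have fin [simp]: "finite I" by (simp add: I_def)
  have qphi: "qform (I \<times> I) A \<phi> = (\<Sum>a\<in>I. \<Sum>b\<in>I. A (a, a) (b, b))" for A
  proof -
    have "qform (I \<times> I) A \<phi> = (\<Sum>i\<in>I. \<Sum>k\<in>I. \<Sum>j\<in>I. \<Sum>l\<in>I. if j = l then (if i = k then A (i, k) (j, l) else 0) else 0)"
      unfolding qform_Times by (intro sum.cong refl) (simp add: \<phi>_def)
    also have "\<dots> = (\<Sum>i\<in>I. \<Sum>k\<in>I. \<Sum>j\<in>I. if i = k then A (i, k) (j, j) else 0)"
      by (intro sum.cong refl) simp
    also have "\<dots> = (\<Sum>i\<in>I. \<Sum>k\<in>I. if i = k then (\<Sum>j\<in>I. A (i, k) (j, j)) else 0)"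
      by (intro sum.cong refl) simp
    finally show ?thesis by simp
  qed
  have main: "Re (\<Sum>a\<in>I. \<Sum>b\<in>I. Q (a, a) (b, b)) \<le> c * (Re (\<Sum>a\<in>I. \<rho> a a) + \<epsilon> * d)" if \<epsilon>: "\<epsilon> > 0" for \<epsilon> :: real
  proof -
    obtain L N where LL: "\<And>a b. a \<in> I \<Longrightarrow> b \<in> I \<Longrightarrow>
        \<rho> a b + (if a = b then of_real \<epsilon> else 0) = (\<Sum>r\<in>I. L a r * cnj (L b r))"
      and NL: "\<And>a b. a \<in> I \<Longrightarrow> b \<in> I \<Longrightarrow> (\<Sum>r\<in>I. N a r * L r b) = (if a = b then 1 else 0)"
      and LN: "\<And>a b. a \<in> I \<Longrightarrow> b \<in> I \<Longrightarrow> (\<Sum>r\<in>I. L a r * N r b) = (if a = b then 1 else 0)"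
      using kernel_inverse[OF \<rho>[unfolded I_def] \<epsilon>] unfolding I_def by blast
    \<comment> \<open>\<open>Q\<close> is perturbed by the same \<open>\<epsilon>\<close> as
      \<open>\<rho>\<close>. Paired with \<open>X\<close>, the block of the identity at
      \<open>(a, b)\<close> gives the conjugate trace of \<open>X\<close> if \<open>a = b\<close>
      and 0 otherwise, so the slice equation holds for \<open>R\<close> with
      \<open>\<rho> + \<epsilon>\<close>.\<close>
    define R where "R = (\<lambda>x y. Q x y + of_real \<epsilon> * (if x = y then 1 else 0))"
    have R: "nonneg_kernel (I \<times> I) R"
      unfolding R_def using Q \<epsilon> by (intro nonneg_kernel_add nonneg_kernel_scale nonneg_kernel_id) auto
    \<comment> \<open>This is \<open>(1 \<otimes> N) R (1 \<otimes> N)\<^sup>*\<close> with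
      \<open>N\<close> inverse to \<open>L\<close>; on slices it turns \<open>L L\<^sup>*\<close>
      into the identity, as feasibility demands.\<close>
    define P where "P = (\<lambda>x y. \<Sum>a\<in>I. \<Sum>b\<in>I. N (snd x) a * R (fst x, a) (fst y, b) * cnj (N (snd y) b))"
    have qP: "qform (I \<times> I) P v = qform (I \<times> I) R (\<lambda>x. \<Sum>l\<in>I. cnj (N l (snd x)) * v (fst x, l))" for v
    proof -
      have "qform (I \<times> I) P v = (\<Sum>i\<in>I. \<Sum>k\<in>I. \<Sum>j\<in>I. \<Sum>l\<in>I. \<Sum>a\<in>I. \<Sum>b\<in>I.
          cnj (v (i, k)) * (N k a * R (i, a) (j, b) * cnj (N l b)) * v (j, l))"
        unfolding qform_Times by (simp add: P_def sum_distrib_left sum_distrib_right)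
      also have "\<dots> = (\<Sum>i\<in>I. \<Sum>a\<in>I. \<Sum>j\<in>I. \<Sum>b\<in>I. \<Sum>k\<in>I. \<Sum>l\<in>I.
          cnj (v (i, k)) * (N k a * R (i, a) (j, b) * cnj (N l b)) * v (j, l))"
        unfolding sum.cartesian_product
        by (rule sum.reindex_bij_witness[where i = "\<lambda>(i, a, j, b, k, l). (i, k, j, l, a, b)"
          and j = "\<lambda>(i, k, j, l, a, b). (i, a, j, b, k, l)"]) auto
      also have "\<dots> = (\<Sum>i\<in>I. \<Sum>a\<in>I. \<Sum>j\<in>I. \<Sum>b\<in>I. R (i, a) (j, b) *
          ((\<Sum>k\<in>I. cnj (cnj (N k a) * v (i, k))) * (\<Sum>l\<in>I. cnj (N l b) * v (j, l))))"
        unfolding sum_product unfolding sum_distrib_left by (intro sum.cong refl) simp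
      also have "\<dots> = qform (I \<times> I) R (\<lambda>x. \<Sum>l\<in>I. cnj (N l (snd x)) * v (fst x, l))"
        unfolding qform_Times by (intro sum.cong refl) (simp add: mult_ac)
      finally show ?thesis .
    qed
    have "feasible I I S P"
      unfolding feasible_def
    proof (intro conjI ballI)
      show "nonneg_kernel (I \<times> I) P"
        unfolding nonneg_kernel_def qP using nonneg_kernelD[OF R] by blast
      fix X k l assume X: "X \<in> S" and kl: "k \<in> I" "l \<in> I"
      define t where "t = (\<Sum>i\<in>I. cnj (X i i))"
      have inner: "(\<Sum>i\<in>I. \<Sum>j\<in>I. cnj (X i j) * R (i, a) (j, b)) = t * (\<Sum>r\<in>I. L a r * cnj (L b r))"
        if "a \<in> I" "b \<in> I" for a b
      proof -
        have "(\<Sum>i\<in>I. \<Sum>j\<in>I. cnj (X i j) * R (i, a) (j, b)) =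
          (\<Sum>i\<in>I. \<Sum>j\<in>I. cnj (X i j) * Q (i, a) (j, b)) +
          (\<Sum>i\<in>I. \<Sum>j\<in>I. if i = j then cnj (X i j) * (if a = b then of_real \<epsilon> else 0) else 0)"
          unfolding sum.distrib [symmetric] by (intro sum.cong refl) (simp add: R_def ring_distribs)
        also have "(\<Sum>i\<in>I. \<Sum>j\<in>I. if i = j then cnj (X i j) * (if a = b then of_real \<epsilon> else 0) else 0) =
            t * (if a = b then of_real \<epsilon> else 0)"
          by (simp add: sum_distrib_right t_def)
        finally show ?thesis
          by (simp only: slice[OF X that] LL[OF that, symmetric] distrib_left t_def)
      qed
      have "(\<Sum>i\<in>I. \<Sum>j\<in>I. cnj (X i j) * P (i, k) (j, l)) = (\<Sum>i\<in>I. \<Sum>j\<in>I. \<Sum>a\<in>I. \<Sum>b\<in>I.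
          N k a * cnj (N l b) * (cnj (X i j) * R (i, a) (j, b)))"
        by (simp add: P_def sum_distrib_left mult_ac)
      also have "\<dots> = (\<Sum>a\<in>I. \<Sum>b\<in>I. \<Sum>i\<in>I. \<Sum>j\<in>I. N k a * cnj (N l b) * (cnj (X i j) * R (i, a) (j, b)))"
        unfolding sum.cartesian_product
        by (rule sum.reindex_bij_witness[where i = "\<lambda>(a, b, i, j). (i, j, a, b)"
          and j = "\<lambda>(i, j, a, b). (a, b, i, j)"]) auto
      also have "\<dots> = (\<Sum>a\<in>I. \<Sum>b\<in>I. N k a * cnj (N l b) * (t * (\<Sum>r\<in>I. L a r * cnj (L b r))))"
        unfolding sum_distrib_left [symmetric] by (intro sum.cong refl) (simp add: inner)
      also have "\<dots> = (\<Sum>a\<in>I. \<Sum>b\<in>I. \<Sum>r\<in>I. t * ((N k a * L a r) * cnj (N l b * L b r)))"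
        unfolding sum_distrib_left by (intro sum.cong refl) simp
      also have "\<dots> = (\<Sum>r\<in>I. \<Sum>a\<in>I. \<Sum>b\<in>I. t * ((N k a * L a r) * cnj (N l b * L b r)))"
        unfolding sum.cartesian_product
        by (rule sum.reindex_bij_witness[where i = "\<lambda>(r, a, b). (a, b, r)"
          and j = "\<lambda>(a, b, r). (r, a, b)"]) auto
      also have "\<dots> = t * (\<Sum>r\<in>I. (\<Sum>a\<in>I. N k a * L a r) * cnj (\<Sum>b\<in>I. N l b * L b r))"
        unfolding cnj_sum sum_product unfolding sum_distrib_left ..
      also have "(\<Sum>r\<in>I. (\<Sum>a\<in>I. N k a * L a r) * cnj (\<Sum>b\<in>I. N l b * L b r)) =
          (\<Sum>r\<in>I. if k = r then (if l = r then 1 else 0) else 0)"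
        using kl by (intro sum.cong refl) (simp only: NL, simp)
      also have "\<dots> = (if k = l then 1 else 0)"
        using kl by simp
      finally show "(\<Sum>i\<in>I. \<Sum>j\<in>I. cnj (X i j) * P (i, k) (j, l)) = (if k = l then \<Sum>i\<in>I. cnj (X i i) else 0)"
        by (simp add: t_def)
    qed
    define v where "v = (\<lambda>x. cnj (L (fst x) (snd x)))"
    have "qform (I \<times> I) P v = qform (I \<times> I) R \<phi>"
      unfolding qP
    proof (rule qform_cong)
      fix x assume x: "x \<in> I \<times> I"
      have "(\<Sum>l\<in>I. cnj (N l (snd x)) * v (fst x, l)) = cnj (\<Sum>l\<in>I. L (fst x) l * N l (snd x))"
        by (simp add: v_def mult.commute)
      also have "\<dots> = \<phi> x"
        using x by (subst LN) (auto simp: \<phi>_def)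
      finally show "(\<Sum>l\<in>I. cnj (N l (snd x)) * v (fst x, l)) = \<phi> x" .
    qed simp
    moreover have "of_real (sqnorm (I \<times> I) v) = (\<Sum>a\<in>I. \<rho> a a + of_real \<epsilon>)"
    proof -
      have "complex_of_real (sqnorm (I \<times> I) v) = (\<Sum>a\<in>I. \<Sum>r\<in>I. of_real ((cmod (L a r))\<^sup>2))"
        by (simp add: sqnorm_def sum_Times v_def)
      also have "\<dots> = (\<Sum>a\<in>I. \<Sum>r\<in>I. L a r * cnj (L a r))"
        by (simp only: complex_norm_square)
      also have "\<dots> = (\<Sum>a\<in>I. \<rho> a a + of_real \<epsilon>)"
        using LL[symmetric] by (intro sum.cong refl) simp
      finally show ?thesis .
    qed
    then have "sqnorm (I \<times> I) v = Re (\<Sum>a\<in>I. \<rho> a a) + \<epsilon> * d"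
      by (simp add: complex_eq_iff sum.distrib I_def mult.commute)
    moreover have "Re (qform (I \<times> I) P v) \<le> c * sqnorm (I \<times> I) v"
      using \<open>feasible I I S P\<close> assms(2,3) by (intro theta_boundD[OF assms(2)]) (auto simp: I_def lessThan_empty_iff)
    moreover have "qform (I \<times> I) R \<phi> = qform (I \<times> I) Q \<phi> + of_real (\<epsilon> * sqnorm (I \<times> I) \<phi>)"
      unfolding R_def qform_add qform_scale by (simp add: qform_id)
    moreover have "0 \<le> \<epsilon> * sqnorm (I \<times> I) \<phi>"
      using \<epsilon> sqnorm_nonneg[of "I \<times> I" \<phi>] by simp
    ultimately show ?thesis unfolding qphi [symmetric] by simp
  qed
  show ?thesis
  proof (rule field_le_epsilon)
    fix e :: real assume "e > 0"
    \<comment> \<open>The sign of \<open>c\<close> is unknown, hence the absolute value; the summand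
      1 keeps the denominator positive when \<open>c = 0\<close>.\<close>
    define \<epsilon> where "\<epsilon> = e / (\<bar>c\<bar> * d + 1)"
    have pos: "\<bar>c\<bar> * d + 1 > 0" by (simp add: add_nonneg_pos)
    then have "\<epsilon> > 0" using \<open>e > 0\<close> by (simp add: \<epsilon>_def)
    have "c * (\<epsilon> * d) \<le> \<bar>c\<bar> * (\<epsilon> * d)"
      using \<open>\<epsilon> > 0\<close> by (intro mult_right_mono) auto
    also have "\<dots> = \<epsilon> * (\<bar>c\<bar> * d)" by simp
    also have "\<dots> \<le> \<epsilon> * (\<bar>c\<bar> * d + 1)" using \<open>\<epsilon> > 0\<close> by simp
    also have "\<dots> = e" using pos by (simp add: \<epsilon>_def)
    finally show "Re (\<Sum>a\<in>I. \<Sum>b\<in>I. Q (a, a) (b, b)) \<le> c * Re (\<Sum>a\<in>I. \<rho> a a) + e"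
      using main[OF \<open>\<epsilon> > 0\<close>] by (simp add: distrib_left)
  qed
qed

text \<open>A crude constant, but enough to show that some multiple of the identity dominates a
  given kernel.\<close>

lemma qform_bound:
  assumes "finite J"
  shows "Re (qform J A v) \<le> (\<Sum>x\<in>J. \<Sum>y\<in>J. cmod (A x y)) * sqnorm J v"
proof -
  have vle: "cmod (v x) \<le> sqrt (sqnorm J v)" if "x \<in> J" for x
    unfolding sqnorm_def using assms that by (intro real_le_rsqrt member_le_sum) auto
  have "Re (qform J A v) \<le> cmod (qform J A v)" by (rule complex_Re_le_cmod)
  also have "\<dots> \<le> (\<Sum>x\<in>J. \<Sum>y\<in>J. cmod (cnj (v x) * A x y * v y))"
    unfolding qform_def by (intro order_trans[OF norm_sum] sum_mono norm_sum)
  also have "\<dots> \<le> (\<Sum>x\<in>J. \<Sum>y\<in>J. cmod (A x y) * sqnorm J v)"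
  proof (intro sum_mono)
    fix x y assume "x \<in> J" "y \<in> J"
    have "cmod (cnj (v x) * A x y * v y) = cmod (A x y) * (cmod (v x) * cmod (v y))"
      by (simp add: norm_mult)
    also have "\<dots> \<le> cmod (A x y) * (sqrt (sqnorm J v) * sqrt (sqnorm J v))"
      using vle \<open>x \<in> J\<close> \<open>y \<in> J\<close> by (intro mult_left_mono mult_mono) (auto simp: sqnorm_nonneg)
    finally show "cmod (cnj (v x) * A x y * v y) \<le> cmod (A x y) * sqnorm J v"
      by (simp add: sqnorm_nonneg)
  qed
  also have "\<dots> = (\<Sum>x\<in>J. \<Sum>y\<in>J. cmod (A x y)) * sqnorm J v"
    by (simp add: sum_distrib_right)
  finally show ?thesis .
qed

text \<open>\<open>Q\<close> holds the conjugated coefficients of the Hahn-Banach functional. Only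
  real parts of forms are compared, as the arguments of the sublinear function need not be
  Hermitian. The last conclusion carries \<open>\<epsilon>\<close> because the infimum at
  \<open>E\<close> is approached by pairs \<open>(t, w)\<close>.\<close>

lemma kernel_separation:
  fixes W :: "('i \<Rightarrow> 'i \<Rightarrow> complex) set"
  assumes fin: "finite J" and ne: "J \<noteq> {}"
    and add: "\<And>w w'. w \<in> W \<Longrightarrow> w' \<in> W \<Longrightarrow> (\<lambda>x y. w x y + w' x y) \<in> W"
    and scale: "\<And>a w. w \<in> W \<Longrightarrow> (\<lambda>x y. a * w x y) \<in> W"
    and "W \<noteq> {}"
    and traceless: "\<And>w. w \<in> W \<Longrightarrow> (\<Sum>x\<in>J. w x x) = 0"
  shows "\<exists>Q. nonneg_kernel J Q \<and> (\<forall>w\<in>W. (\<Sum>x\<in>J. \<Sum>y\<in>J. cnj (w x y) * Q x y) = 0) \<and>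
    Re (\<Sum>x\<in>J. Q x x) = 1 \<and>
    (\<forall>\<epsilon>>0. \<exists>t w. w \<in> W \<and> t < Re (\<Sum>x\<in>J. \<Sum>y\<in>J. cnj (E x y) * Q x y) + \<epsilon> \<and>
      (\<forall>v. 0 \<le> t * sqnorm J v + Re (qform J w v) - Re (qform J E v)))"
proof -
  define A where "A = (\<lambda>f :: 'i \<times> 'i \<Rightarrow> complex. {t. \<exists>w\<in>W. \<forall>v.
    0 \<le> t * sqnorm J v + Re (qform J w v) - Re (qform J (\<lambda>x y. f (x, y)) v)})"
  define p where "p = (\<lambda>f. Inf (A f))"
  have zero: "(\<lambda>x y. 0) \<in> W"
    using \<open>W \<noteq> {}\<close> scale[of _ 0] by auto
  have nonempty: "A f \<noteq> {}" for f
  proof -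
    have "(\<Sum>x\<in>J. \<Sum>y\<in>J. cmod (f (x, y))) \<in> A f"
      unfolding A_def using qform_bound[OF fin, of "\<lambda>x y. f (x, y)"]
      by (intro CollectI bexI[OF _ zero]) (simp add: qform_def[of _ "\<lambda>x y. 0"])
    then show ?thesis by blast
  qed
  \<comment> \<open>The trace keeps the infimum finite: t 1 + w - f has nonnegative real parts on
    the diagonal, and \<open>w\<close> drops out of their sum.\<close>
  have lower: "(\<Sum>x\<in>J. Re (f (x, x))) / card J \<le> t" if "t \<in> A f" for f t
  proof -
    obtain w where w: "w \<in> W" and *: "\<And>v. 0 \<le> t * sqnorm J v + Re (qform J w v) - Re (qform J (\<lambda>x y. f (x, y)) v)"
      using \<open>t \<in> A f\<close> unfolding A_def by blast
    have "0 \<le> t + Re (w x x) - Re (f (x, x))" if "x \<in> J" for x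
    proof -
      let ?v = "\<lambda>z. (if z = x then 1 else 0) + (if z = x then 0 else 0)"
      have "sqnorm J ?v = (\<Sum>z\<in>J. if z = x then 1 else 0)"
        unfolding sqnorm_def by (intro sum.cong) auto
      then have "sqnorm J ?v = 1" using fin that by simp
      then show ?thesis using *[of ?v] unfolding qform_two_point[OF fin that that] by simp
    qed
    then have "0 \<le> (\<Sum>x\<in>J. t + Re (w x x) - Re (f (x, x)))" by (rule sum_nonneg)
    also have "\<dots> = card J * t + Re (\<Sum>x\<in>J. w x x) - (\<Sum>x\<in>J. Re (f (x, x)))"
      by (simp add: sum.distrib sum_subtractf)
    finally have "(\<Sum>x\<in>J. Re (f (x, x))) \<le> card J * t" using traceless[OF w] by simp
    then show ?thesis using fin ne by (simp add: divide_le_eq card_gt_0_iff mult.commute)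
  qed
  have bdd: "bdd_below (A f)" for f
    using lower by (rule bdd_belowI)
  have p_le: "p f \<le> t" if "t \<in> A f" for f t
    unfolding p_def using that bdd by (rule cInf_lower)
  have p_ge: "b \<le> p f" if "\<And>t. t \<in> A f \<Longrightarrow> b \<le> t" for b f
    unfolding p_def using nonempty that by (rule cInf_greatest)
  have A_add: "t + u \<in> A (\<lambda>z. f z + g z)" if t: "t \<in> A f" and u: "u \<in> A g" for t u f g
  proof -
    obtain w w' where "w \<in> W" "\<And>v. 0 \<le> t * sqnorm J v + Re (qform J w v) - Re (qform J (\<lambda>x y. f (x, y)) v)"
      "w' \<in> W" "\<And>v. 0 \<le> u * sqnorm J v + Re (qform J w' v) - Re (qform J (\<lambda>x y. g (x, y)) v)"
      using t u unfolding A_def by blast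
    note w = this
    have "0 \<le> (t + u) * sqnorm J v + Re (qform J (\<lambda>x y. w x y + w' x y) v) -
        Re (qform J (\<lambda>x y. f (x, y) + g (x, y)) v)" for v
      using w(2)[of v] w(4)[of v] by (simp add: qform_add distrib_right)
    then show ?thesis
      unfolding A_def using add[OF w(1,3)] by blast
  qed
  have A_scale: "r * t \<in> A (\<lambda>z. of_real r * f z)" if t: "t \<in> A f" and r: "0 \<le> r" for r t f
  proof -
    obtain w where w: "w \<in> W" "\<And>v. 0 \<le> t * sqnorm J v + Re (qform J w v) - Re (qform J (\<lambda>x y. f (x, y)) v)"
      using t unfolding A_def by blast
    have "0 \<le> r * (t * sqnorm J v + Re (qform J w v) - Re (qform J (\<lambda>x y. f (x, y)) v))" for v
      using w(2) r by simp
    then show ?thesis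
      unfolding A_def by (intro CollectI bexI[OF _ scale[OF w(1), of "of_real r"]]) (simp add: qform_scale algebra_simps)
  qed
  have "sublinear p"
    unfolding sublinear_def
  proof (intro conjI allI impI)
    fix f g
    have "p (\<lambda>z. f z + g z) - u \<le> t" if "t \<in> A f" "u \<in> A g" for t u
      using p_le[OF A_add[OF that]] by simp
    then have "p (\<lambda>z. f z + g z) - u \<le> p f" if "u \<in> A g" for u
      using that by (intro p_ge)
    then have "p (\<lambda>z. f z + g z) - p f \<le> p g"
      by (intro p_ge) (simp add: algebra_simps)
    then show "p (\<lambda>z. f z + g z) \<le> p f + p g" by simp
  next
    fix r :: real and f :: "'i \<times> 'i \<Rightarrow> complex" assume r: "0 \<le> r"
    show "p (\<lambda>z. of_real r * f z) \<le> r * p f"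
    proof (cases "r = 0")
      case True
      have "p (\<lambda>z. of_real r * f z) \<le> r * t" if "t \<in> A f" for t
        using p_le[OF A_scale[OF that r]] .
      then show ?thesis using nonempty[of f] True by auto
    next
      case False
      have "p (\<lambda>z. of_real r * f z) / r \<le> p f"
      proof (rule p_ge)
        fix t assume "t \<in> A f"
        from p_le[OF A_scale[OF this r]] show "p (\<lambda>z. of_real r * f z) / r \<le> t"
          using False r by (simp add: pos_divide_le_eq mult.commute)
      qed
      then show ?thesis using False r by (simp add: field_simps)
    qed
  qed
  moreover have "p f = p g" if "\<And>z. z \<in> J \<times> J \<Longrightarrow> f z = g z" for f g
  proof -
    have "qform J (\<lambda>x y. f (x, y)) v = qform J (\<lambda>x y. g (x, y)) v" for v
      using that by (intro qform_cong) auto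
    then show ?thesis by (simp add: p_def A_def)
  qed
  ultimately obtain c where cE: "Re (\<Sum>z\<in>J\<times>J. c z * E (fst z) (snd z)) = p (\<lambda>z. E (fst z) (snd z))"
    and cle: "\<And>f. Re (\<Sum>z\<in>J\<times>J. c z * f z) \<le> p f"
    using hahn_banach_finite[of "J \<times> J" p "\<lambda>z. E (fst z) (snd z)"] fin by blast
  define \<Lambda> where "\<Lambda> = (\<lambda>w. \<Sum>x\<in>J. \<Sum>y\<in>J. c (x, y) * w x y)"
  have \<Lambda>_le: "Re (\<Lambda> h) \<le> t" if "w \<in> W" "\<And>v. 0 \<le> t * sqnorm J v + Re (qform J w v) - Re (qform J h v)" for h t w
  proof -
    have "Re (\<Lambda> h) \<le> p (\<lambda>z. h (fst z) (snd z))"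
      using cle[of "\<lambda>z. h (fst z) (snd z)"] by (simp add: \<Lambda>_def sum_Times)
    also have "\<dots> \<le> t" using that by (intro p_le) (auto simp: A_def)
    finally show ?thesis .
  qed
  have \<Lambda>_scale: "\<Lambda> (\<lambda>x y. a * w x y) = a * \<Lambda> w" for a w
    by (simp add: \<Lambda>_def sum_distrib_left mult_ac)
  \<comment> \<open>All complex multiples of \<open>w\<close> lie in \<open>W\<close>, where the
    sublinear function is at most 0. The multiples by 1, -1, \<i> and -\<i> force the complex number
    \<open>\<Lambda> w\<close> to vanish.\<close>
  have \<Lambda>_W: "\<Lambda> w = 0" if "w \<in> W" for w
  proof -
    have "Re (a * \<Lambda> w) \<le> 0" for a
      using \<Lambda>_le[OF scale[OF that, of a], of 0 "\<lambda>x y. a * w x y"] by (simp add: \<Lambda>_scale)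
    from this[of 1] this[of "-1"] this[of \<i>] this[of "-\<i>"] show ?thesis
      by (simp add: complex_eq_iff)
  qed
  define Q where "Q = (\<lambda>x y. cnj (c (x, y)))"
  have Q\<Lambda>: "(\<Sum>x\<in>J. \<Sum>y\<in>J. cnj (w x y) * Q x y) = cnj (\<Lambda> w)" for w
    by (simp add: \<Lambda>_def Q_def mult.commute)
  have "nonneg_kernel J Q"
    unfolding nonneg_kernel_def
  proof
    fix v :: "'i \<Rightarrow> complex"
    let ?h = "\<lambda>x y. v x * cnj (v y)"
    have h: "nonneg_kernel J ?h"
      by (rule nonneg_kernel_gram[where R = "{()}" and w = "\<lambda>_. v"]) simp
    have Qv: "qform J Q v = cnj (\<Lambda> ?h)"
      unfolding qform_def Q\<Lambda> [symmetric] by (intro sum.cong refl) simp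
    \<comment> \<open>For \<open>Re a \<le> 0\<close> the form of \<open>a * ?h\<close> has
      nonpositive real part, so \<open>t = 0\<close> is admissible. Then a = -1 gives the sign of
      the form of \<open>Q\<close>, and a = \<i>, a = -\<i> show that it is real.\<close>
    have le: "Re (a * \<Lambda> ?h) \<le> 0" if "Re a \<le> 0" for a
    proof -
      have "0 \<le> 0 * sqnorm J u + Re (qform J (\<lambda>x y. 0) u) - Re (qform J (\<lambda>x y. a * ?h x y) u)" for u
        using that nonneg_kernelD[OF h, of u] unfolding qform_scale
        by (simp add: qform_def[of _ "\<lambda>x y. 0"] mult_nonpos_nonneg)
      from \<Lambda>_le[OF zero this] show ?thesis by (simp only: \<Lambda>_scale)
    qed
    show "Im (qform J Q v) = 0 \<and> 0 \<le> Re (qform J Q v)"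
      using le[of "-1"] le[of \<i>] le[of "-\<i>"] by (simp add: Qv)
  qed
  moreover have "\<forall>w\<in>W. (\<Sum>x\<in>J. \<Sum>y\<in>J. cnj (w x y) * Q x y) = 0"
    by (simp add: Q\<Lambda> \<Lambda>_W del: cnj_sum)
  moreover have "Re (\<Sum>x\<in>J. Q x x) = 1"
  proof -
    let ?e = "\<lambda>x y. if x = y then 1 else 0"
    \<comment> \<open>The value \<open>t = Re a\<close> is admissible for \<open>a\<close> times the
      identity; a = 1 and a = -1 together give trace exactly 1.\<close>
    have le: "Re (a * \<Lambda> ?e) \<le> Re a" for a
      using \<Lambda>_le[OF zero, of "Re a" "\<lambda>x y. a * ?e x y"] unfolding qform_scale qform_id[OF fin] \<Lambda>_scale
      by (simp add: qform_def[of _ "\<lambda>x y. 0"])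
    have "(\<Sum>x\<in>J. \<Sum>y\<in>J. cnj (?e x y) * Q x y) = (\<Sum>x\<in>J. \<Sum>y\<in>J. if x = y then Q x y else 0)"
      by (intro sum.cong refl) simp
    also have "\<dots> = (\<Sum>x\<in>J. Q x x)" using fin by simp
    finally have "(\<Sum>x\<in>J. Q x x) = cnj (\<Lambda> ?e)"
      unfolding Q\<Lambda> by (rule sym)
    then show ?thesis using le[of 1] le[of "-1"] by simp
  qed
  moreover have "\<exists>t w. w \<in> W \<and> t < Re (\<Sum>x\<in>J. \<Sum>y\<in>J. cnj (E x y) * Q x y) + \<epsilon> \<and>
      (\<forall>v. 0 \<le> t * sqnorm J v + Re (qform J w v) - Re (qform J E v))" if "\<epsilon> > 0" for \<epsilon>
  proof -
    have "Re (cnj (\<Lambda> E)) = p (\<lambda>z. E (fst z) (snd z))"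
      using cE by (simp add: \<Lambda>_def sum_Times)
    then have "Inf (A (\<lambda>z. E (fst z) (snd z))) < Re (cnj (\<Lambda> E)) + \<epsilon>"
      using that by (simp add: p_def)
    from cInf_lessD[OF nonempty this]
    obtain t where "t \<in> A (\<lambda>z. E (fst z) (snd z))" "t < Re (cnj (\<Lambda> E)) + \<epsilon>" by blast
    then show ?thesis unfolding Q\<Lambda> A_def by auto
  qed
  ultimately show ?thesis by blast
qed

definition operator_system :: "('a \<Rightarrow> 'a \<Rightarrow> complex) set \<Rightarrow> bool" where
  "operator_system S \<longleftrightarrow> (\<forall>X\<in>S. \<forall>Y\<in>S. (\<lambda>i j. X i j + Y i j) \<in> S) \<and>
    (\<forall>a. \<forall>X\<in>S. (\<lambda>i j. a * X i j) \<in> S) \<and> (\<forall>X\<in>S. (\<lambda>i j. cnj (X j i)) \<in> S) \<and>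
    (\<lambda>i j. if i = j then 1 else 0) \<in> S"

lemma qform_adjoint: "qform J (\<lambda>x y. cnj (A y x)) v = cnj (qform J A v)"
proof -
  have "qform J (\<lambda>x y. cnj (A y x)) v = (\<Sum>y\<in>J. \<Sum>x\<in>J. cnj (v x) * cnj (A y x) * v y)"
    unfolding qform_def by (rule sum.swap)
  also have "\<dots> = cnj (qform J A v)"
    by (simp add: qform_def mult_ac)
  finally show ?thesis .
qed

text \<open>A factor \<open>d\<close> separates the two normalisations. Since \<open>Q\<close> has
  trace 1, \<open>\<rho>\<close> has trace 1/d and the pairing of \<open>Q\<close> with
  \<open>entangled\<close> is at most c/d. In return, \<open>t\<close> times the identity has
  partial trace t d, so a \<open>t\<close> below (c + \<epsilon>)/d yields a value below c +
  \<epsilon>.\<close>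

lemma strong_duality:
  fixes d :: nat
  defines "I \<equiv> {..<d}"
  assumes S: "operator_system S" and "theta_bound I S c" "d \<ge> 1" "\<epsilon> > 0"
  shows "\<exists>\<mu> Y. \<mu> < c + \<epsilon> \<and> dual_witness I S \<mu> Y"
proof -
  have fin [simp]: "finite I" and ne: "I \<noteq> {}"
    using \<open>d \<ge> 1\<close> by (auto simp: I_def lessThan_empty_iff)
  have card: "(\<Sum>i\<in>I. 1) = of_nat d" by (simp add: I_def)
  have S_add: "(\<lambda>i j. X i j + Y i j) \<in> S" if "X \<in> S" "Y \<in> S" for X Y
    using S that by (auto simp: operator_system_def)
  have S_scale: "(\<lambda>i j. a * X i j) \<in> S" if "X \<in> S" for X a
    using S that by (auto simp: operator_system_def)
  have S_adj: "(\<lambda>i j. cnj (X j i)) \<in> S" if "X \<in> S" for X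
    using S that by (auto simp: operator_system_def)
  have S_id: "(\<lambda>i j. if i = j then 1 else 0) \<in> S"
    using S by (auto simp: operator_system_def)
  have S_zero: "(\<lambda>i j. 0) \<in> S" using S_scale[OF S_id, of 0] by simp
  define W where "W = {w. (\<forall>a\<in>I. \<forall>b\<in>I. (\<lambda>i j. w (i, a) (j, b)) \<in> S) \<and>
    (\<forall>a\<in>I. \<forall>b\<in>I. (\<Sum>i\<in>I. w (i, a) (i, b)) = 0)}"
  have "\<exists>Q. nonneg_kernel (I \<times> I) Q \<and>
      (\<forall>w\<in>W. (\<Sum>x\<in>I \<times> I. \<Sum>y\<in>I \<times> I. cnj (w x y) * Q x y) = 0) \<and>
      Re (\<Sum>x\<in>I \<times> I. Q x x) = 1 \<and>
      (\<forall>\<epsilon>>0. \<exists>t w. w \<in> W \<and> t < Re (\<Sum>x\<in>I \<times> I. \<Sum>y\<in>I \<times> I. cnj (entangled x y) * Q x y) + \<epsilon> \<and>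
        (\<forall>v. 0 \<le> t * sqnorm (I \<times> I) v + Re (qform (I \<times> I) w v) - Re (qform (I \<times> I) entangled v)))"
  proof (rule kernel_separation)
    show "I \<times> I \<noteq> {}" using ne by simp
    have "(\<lambda>x y. 0) \<in> W" using S_zero by (simp add: W_def)
    then show "W \<noteq> {}" by blast
    show "(\<lambda>x y. w x y + w' x y) \<in> W" if "w \<in> W" "w' \<in> W" for w w'
      using that S_add by (simp add: W_def sum.distrib)
    show "(\<lambda>x y. a * w x y) \<in> W" if "w \<in> W" for a w
      using that S_scale by (simp add: W_def flip: sum_distrib_left)
    show "(\<Sum>x\<in>I \<times> I. w x x) = 0" if "w \<in> W" for w
    proof -
      have "(\<Sum>x\<in>I \<times> I. w x x) = (\<Sum>a\<in>I. \<Sum>i\<in>I. w (i, a) (i, a))"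
        unfolding sum_Times by (rule sum.swap)
      then show ?thesis using that by (simp add: W_def)
    qed
  qed simp
  then obtain Q where Q: "nonneg_kernel (I \<times> I) Q"
    and QW: "\<And>w. w \<in> W \<Longrightarrow> (\<Sum>x\<in>I \<times> I. \<Sum>y\<in>I \<times> I. cnj (w x y) * Q x y) = 0"
    and Qtr: "Re (\<Sum>x\<in>I \<times> I. Q x x) = 1"
    and Qapprox: "\<And>\<epsilon>. \<epsilon> > 0 \<Longrightarrow> \<exists>t w. w \<in> W \<and>
      t < Re (\<Sum>x\<in>I \<times> I. \<Sum>y\<in>I \<times> I. cnj (entangled x y) * Q x y) + \<epsilon> \<and>
        (\<forall>v. 0 \<le> t * sqnorm (I \<times> I) v + Re (qform (I \<times> I) w v) - Re (qform (I \<times> I) entangled v))"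
    by blast
  \<comment> \<open>The only candidate: the slice equation at \<open>X = 1\<close> says that the
    partial trace of \<open>Q\<close> over the first factor is \<open>d\<close> times
    \<open>\<rho>\<close>.\<close>
  define \<rho> where "\<rho> = (\<lambda>a b. (\<Sum>i\<in>I. Q (i, a) (i, b)) / of_nat d)"
  have slice: "(\<Sum>i\<in>I. \<Sum>j\<in>I. cnj (X i j) * Q (i, a) (j, b)) = (\<Sum>i\<in>I. cnj (X i i)) * \<rho> a b"
    if X: "X \<in> S" and ab: "a \<in> I" "b \<in> I" for X a b
  proof -
    \<comment> \<open>Subtracting the mean of the diagonal makes \<open>X\<close> traceless. Placed
      in the single block \<open>(a, b)\<close>, the result lies in \<open>W\<close>, and its
      pairing with \<open>Q\<close> is 0.\<close>
    define \<tau> where "\<tau> = (\<Sum>i\<in>I. X i i) / of_nat d"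
    define Z where "Z = (\<lambda>i j. X i j + - \<tau> * (if i = j then 1 else 0))"
    define w where "w = (\<lambda>x y. if snd x = a \<and> snd y = b then Z (fst x) (fst y) else 0)"
    have "Z \<in> S" unfolding Z_def by (intro S_add X S_scale S_id)
    moreover have "(\<Sum>i\<in>I. Z i i) = 0"
      using \<open>d \<ge> 1\<close> by (simp add: Z_def sum_subtractf \<tau>_def I_def)
    moreover have "(\<lambda>i j. w (i, a') (j, b')) = (if a' = a \<and> b' = b then Z else (\<lambda>i j. 0))" for a' b'
      by (cases "a' = a"; cases "b' = b") (simp_all add: w_def)
    moreover have "(\<Sum>i\<in>I. w (i, a') (i, b')) = (if a' = a \<and> b' = b then \<Sum>i\<in>I. Z i i else 0)" for a' b'
      by (cases "a' = a"; cases "b' = b") (simp_all add: w_def)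
    ultimately have "w \<in> W" using S_zero by (simp add: W_def)
    then have "0 = (\<Sum>x\<in>I \<times> I. \<Sum>y\<in>I \<times> I. cnj (w x y) * Q x y)"
      using QW by simp
    also have "\<dots> = (\<Sum>i\<in>I. \<Sum>k\<in>I. \<Sum>j\<in>I. \<Sum>l\<in>I.
        if l = b then (if k = a then cnj (Z i j) * Q (i, k) (j, l) else 0) else 0)"
      unfolding sum_Times by (intro sum.cong refl) (simp add: w_def)
    also have "\<dots> = (\<Sum>i\<in>I. \<Sum>k\<in>I. \<Sum>j\<in>I. if k = a then cnj (Z i j) * Q (i, k) (j, b) else 0)"
      using ab by (intro sum.cong refl) simp
    also have "\<dots> = (\<Sum>i\<in>I. \<Sum>k\<in>I. if k = a then \<Sum>j\<in>I. cnj (Z i j) * Q (i, k) (j, b) else 0)"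
      by (intro sum.cong refl) simp
    also have "\<dots> = (\<Sum>i\<in>I. \<Sum>j\<in>I. cnj (Z i j) * Q (i, a) (j, b))"
      using ab by simp
    also have "\<dots> = (\<Sum>i\<in>I. \<Sum>j\<in>I. cnj (X i j) * Q (i, a) (j, b)) +
        (\<Sum>i\<in>I. \<Sum>j\<in>I. if i = j then - cnj \<tau> * Q (i, a) (j, b) else 0)"
      unfolding sum.distrib [symmetric] by (intro sum.cong refl) (simp add: Z_def ring_distribs)
    also have "(\<Sum>i\<in>I. \<Sum>j\<in>I. if i = j then - cnj \<tau> * Q (i, a) (j, b) else 0) =
        - cnj \<tau> * (\<Sum>i\<in>I. Q (i, a) (i, b))"
      unfolding sum_distrib_left by (intro sum.cong refl) simp
    also have "\<dots> = - ((\<Sum>i\<in>I. cnj (X i i)) * \<rho> a b)"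
      by (simp add: \<tau>_def \<rho>_def)
    finally show ?thesis by simp
  qed
  have "nonneg_kernel I \<rho>"
    unfolding nonneg_kernel_def
  proof
    fix v
    \<comment> \<open>\<open>v\<close> placed in block \<open>i\<close>; the form of
      \<open>\<rho>\<close> at \<open>v\<close> is the average over \<open>i\<close> of the forms of
      \<open>Q\<close> at these vectors.\<close>
    define u where "u = (\<lambda>i (x :: nat \<times> nat). if fst x = i then v (snd x) else 0 :: complex)"
    have "qform (I \<times> I) Q (u i) = (\<Sum>a\<in>I. \<Sum>b\<in>I. cnj (v a) * Q (i, a) (i, b) * v b)" if "i \<in> I" for i
    proof -
      have "qform (I \<times> I) Q (u i) = (\<Sum>j\<in>I. \<Sum>a\<in>I. \<Sum>k\<in>I.
          if k = i then \<Sum>b\<in>I. (if j = i then cnj (v a) * Q (j, a) (k, b) * v b else 0) else 0)"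
        unfolding qform_Times by (intro sum.cong refl) (auto simp: u_def intro!: sum.cong sum.neutral)
      also have "\<dots> = (\<Sum>j\<in>I. if j = i then \<Sum>a\<in>I. \<Sum>b\<in>I. cnj (v a) * Q (j, a) (i, b) * v b else 0)"
        using that by (intro sum.cong refl) simp
      finally show ?thesis using that by simp
    qed
    then have "(\<Sum>i\<in>I. qform (I \<times> I) Q (u i)) = (\<Sum>i\<in>I. \<Sum>a\<in>I. \<Sum>b\<in>I. cnj (v a) * Q (i, a) (i, b) * v b)"
      by (intro sum.cong refl)
    also have "\<dots> = (\<Sum>a\<in>I. \<Sum>b\<in>I. \<Sum>i\<in>I. cnj (v a) * Q (i, a) (i, b) * v b)"
      unfolding sum.cartesian_product
      by (rule sum.reindex_bij_witness[where i = "\<lambda>(a, b, i). (i, a, b)" and j = "\<lambda>(i, a, b). (a, b, i)"]) auto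
    also have "\<dots> = of_nat d * qform I \<rho> v"
    proof -
      have "of_nat d * \<rho> a b = (\<Sum>i\<in>I. Q (i, a) (i, b))" for a b
        using \<open>d \<ge> 1\<close> by (simp add: \<rho>_def)
      then have "of_nat d * qform I \<rho> v = qform I (\<lambda>a b. \<Sum>i\<in>I. Q (i, a) (i, b)) v"
        by (simp only: qform_scale [symmetric])
      then show ?thesis
        by (simp add: qform_def sum_distrib_left sum_distrib_right)
    qed
    finally have eq: "qform I \<rho> v = (\<Sum>i\<in>I. qform (I \<times> I) Q (u i)) / of_nat d"
      using \<open>d \<ge> 1\<close> by simp
    show "Im (qform I \<rho> v) = 0 \<and> 0 \<le> Re (qform I \<rho> v)"
      using nonneg_kernelD[OF Q] by (simp add: eq sum_nonneg)
  qed
  moreover have "Re (\<Sum>a\<in>I. \<rho> a a) = 1 / d"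
  proof -
    have "(\<Sum>a\<in>I. \<rho> a a) = (\<Sum>a\<in>I. \<Sum>i\<in>I. Q (i, a) (i, a)) / of_nat d"
      by (simp add: \<rho>_def sum_divide_distrib)
    also have "(\<Sum>a\<in>I. \<Sum>i\<in>I. Q (i, a) (i, a)) = (\<Sum>x\<in>I \<times> I. Q x x)"
      unfolding sum_Times by (rule sum.swap)
    finally show ?thesis using Qtr by simp
  qed
  ultimately have "Re (\<Sum>a\<in>I. \<Sum>b\<in>I. Q (a, a) (b, b)) \<le> c * (1 / d)"
    using theta_bound_weighted[of d S c Q \<rho>] assms(3,4) Q slice unfolding I_def by simp
  moreover have "(\<Sum>x\<in>I \<times> I. \<Sum>y\<in>I \<times> I. cnj (entangled x y) * Q x y) = (\<Sum>a\<in>I. \<Sum>b\<in>I. Q (a, a) (b, b))"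
  proof -
    have "(\<Sum>x\<in>I \<times> I. \<Sum>y\<in>I \<times> I. cnj (entangled x y) * Q x y) = (\<Sum>i\<in>I. \<Sum>k\<in>I. \<Sum>j\<in>I. \<Sum>l\<in>I.
        if j = l then (if i = k then Q (i, k) (j, l) else 0) else 0)"
      unfolding sum_Times by (intro sum.cong refl) (simp add: entangled_def)
    also have "\<dots> = (\<Sum>i\<in>I. \<Sum>k\<in>I. if i = k then \<Sum>j\<in>I. Q (i, k) (j, j) else 0)"
      by (intro sum.cong refl) simp
    finally show ?thesis by simp
  qed
  ultimately have E: "Re (\<Sum>x\<in>I \<times> I. \<Sum>y\<in>I \<times> I. cnj (entangled x y) * Q x y) \<le> c / d"
    by simp
  have "\<epsilon> / d > 0" using \<open>\<epsilon> > 0\<close> \<open>d \<ge> 1\<close> by simp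
  from Qapprox[OF this] obtain t w where w: "w \<in> W"
    and "t < Re (\<Sum>x\<in>I \<times> I. \<Sum>y\<in>I \<times> I. cnj (entangled x y) * Q x y) + \<epsilon> / d"
    and tw: "\<And>v. 0 \<le> t * sqnorm (I \<times> I) v + Re (qform (I \<times> I) w v) - Re (qform (I \<times> I) entangled v)"
    by blast
  with E have t: "t < c / d + \<epsilon> / d" by linarith
  \<comment> \<open>Only the real part of the form of \<open>w\<close> is under control, so
    \<open>w\<close> is replaced by its Hermitian part. Closure of \<open>S\<close> under adjoints,
    applied to the slice at \<open>(b, a)\<close>, keeps the slice at \<open>(a, b)\<close> in
    \<open>S\<close>.\<close>
  define Y where "Y = (\<lambda>x y. of_real t * (if x = y then 1 else 0) + 1 / 2 * (w x y + cnj (w y x)))"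
  have "dual_witness I S (t * d) Y"
    unfolding dual_witness_def
  proof (intro conjI ballI)
    fix a b assume ab: "a \<in> I" "b \<in> I"
    have "(\<lambda>i j. Y (i, a) (j, b)) = (\<lambda>i j. (of_real t * (if a = b then 1 else 0)) * (if i = j then 1 else 0) +
        1 / 2 * (w (i, a) (j, b) + cnj (w (j, b) (i, a))))"
      by (auto simp: Y_def fun_eq_iff)
    moreover have "(\<lambda>i j. w (i, a) (j, b)) \<in> S" "(\<lambda>i j. w (i, b) (j, a)) \<in> S"
      using w ab by (auto simp: W_def)
    ultimately show "(\<lambda>i j. Y (i, a) (j, b)) \<in> S"
      using S_adj[of "\<lambda>i j. w (i, b) (j, a)"] by (simp only:) (intro S_add S_scale S_id, simp_all)
    have "(\<Sum>i\<in>I. Y (i, a) (i, b)) = (\<Sum>i\<in>I. if a = b then of_real t else 0) +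
        1 / 2 * ((\<Sum>i\<in>I. w (i, a) (i, b)) + cnj (\<Sum>i\<in>I. w (i, b) (i, a)))"
      by (simp add: Y_def sum.distrib flip: sum_divide_distrib)
    also have "\<dots> = (if a = b then of_real (t * d) else 0)"
      using w ab by (simp add: W_def I_def del: cnj_sum)
    finally show "(\<Sum>i\<in>I. Y (i, a) (i, b)) = (if a = b then of_real (t * d) else 0)" .
  next
    have "qform (I \<times> I) (\<lambda>x y. Y x y - entangled x y) v =
        of_real (t * sqnorm (I \<times> I) v + Re (qform (I \<times> I) w v) - Re (qform (I \<times> I) entangled v))" for v
    proof -
      have "Im (qform (I \<times> I) entangled v) = 0"
        by (rule nonneg_kernelD[OF nonneg_kernel_entangled])
      then show ?thesis
        unfolding Y_def qform_diff qform_add qform_scale qform_adjoint by (simp add: qform_id complex_eq_iff)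
    qed
    then show "nonneg_kernel (I \<times> I) (\<lambda>x y. Y x y - entangled x y)"
      using tw by (simp add: nonneg_kernel_def)
  qed
  moreover have "t * d < c + \<epsilon>"
    using t \<open>d \<ge> 1\<close> by (simp add: field_simps)
  ultimately show ?thesis by blast
qed

section \<open>Passage between matrices and kernels\<close>

text \<open>Only the d \<times> d block is constrained, so no convention about values outside is
  imposed; the identity kernel, nonzero on the whole diagonal, belongs to it whenever the identity
  matrix is in \<open>S\<close>.\<close>

definition kernels :: "nat \<Rightarrow> complex mat set \<Rightarrow> (nat \<Rightarrow> nat \<Rightarrow> complex) set" where
  "kernels d S = {f. mat d d (\<lambda>(i, j). f i j) \<in> S}"

definition entries :: "complex mat \<Rightarrow> nat \<Rightarrow> nat \<Rightarrow> complex" where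
  "entries M i j = M $$ (i, j)"

text \<open>Position of a pair in the product basis, by the index convention of
  \<open>kron\<close>.\<close>

definition enc :: "nat \<Rightarrow> nat \<times> nat \<Rightarrow> nat" where
  "enc n x = fst x * n + snd x"

definition dec :: "nat \<Rightarrow> nat \<Rightarrow> nat \<times> nat" where
  "dec n p = (p div n, p mod n)"

lemma dec_enc: "snd x < n \<Longrightarrow> dec n (enc n x) = x"
  by (simp add: dec_def enc_def prod_eq_iff)

lemma enc_dec: "enc n (dec n p) = p"
  by (simp add: dec_def enc_def)

lemma enc_less: "x \<in> {..<d} \<times> {..<n} \<Longrightarrow> enc n x < d * n"
proof -
  assume x: "x \<in> {..<d} \<times> {..<n}"
  have "enc n x < (fst x + 1) * n" using x by (auto simp: enc_def)
  also have "\<dots> \<le> d * n" using x by (intro mult_le_mono1) auto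
  finally show ?thesis .
qed

lemma dec_mem: "p < d * n \<Longrightarrow> dec n p \<in> {..<d} \<times> {..<n}"
  by (cases "n = 0") (auto simp: dec_def less_mult_imp_div_less)

lemma bij_betw_enc: "bij_betw (enc n) ({..<d} \<times> {..<n}) {..<d * n}"
  by (rule bij_betw_byWitness[where f' = "dec n"])
    (auto simp: dec_enc enc_dec dec_mem intro: enc_less dest: dec_mem)

lemma bij_betw_dec: "bij_betw (dec n) {..<d * n} ({..<d} \<times> {..<n})"
  by (rule bij_betw_byWitness[where f' = "enc n"])
    (auto simp: dec_enc enc_dec intro: enc_less dest: dec_mem)

lemma kron_carrier:
  "X \<in> carrier_mat d d \<Longrightarrow> Y \<in> carrier_mat n n \<Longrightarrow> kron X Y \<in> carrier_mat (d * n) (d * n)"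
  by (auto simp: kron_def)

lemma entries_kron:
  assumes "X \<in> carrier_mat d d" "Y \<in> carrier_mat n n" "p < d * n" "q < d * n"
  shows "entries (kron X Y) p q = tensor (entries X) (entries Y) (dec n p) (dec n q)"
  using assms by (auto simp: entries_def kron_def tensor_def dec_def)

lemma mat_entries: "M \<in> carrier_mat d d \<Longrightarrow> mat d d (\<lambda>(i, j). entries M i j) = M"
  by (auto simp: entries_def)

lemma entries_kernels: "S \<subseteq> carrier_mat d d \<Longrightarrow> X \<in> S \<Longrightarrow> entries X \<in> kernels d S"
  by (auto simp: kernels_def mat_entries)

section \<open>Spans and subspaces of matrices\<close>

lemma span_superset:
  assumes "G \<subseteq> carrier_mat m m"
  shows "G \<subseteq> LinearCombinations.module.span class_ring (module_mat TYPE(complex) m m) G"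
proof -
  interpret V: vectorspace "class_ring :: complex ring" "module_mat TYPE(complex) m m"
    by (rule matrix_vs)
  show ?thesis using assms by (intro V.in_own_span) (simp add: module_mat_simps)
qed

lemma span_carrier:
  assumes "G \<subseteq> carrier_mat m m"
  shows "LinearCombinations.module.span class_ring (module_mat TYPE(complex) m m) G \<subseteq> carrier_mat m m"
proof -
  interpret V: vectorspace "class_ring :: complex ring" "module_mat TYPE(complex) m m"
    by (rule matrix_vs)
  show ?thesis using V.span_is_subset2[of G] assms by (simp add: module_mat_simps)
qed

text \<open>The matrices with property \<open>C\<close> form a submodule containing the generators,
  hence containing their span.\<close>

lemma mat_span_induct:
  assumes X: "X \<in> LinearCombinations.module.span class_ring (module_mat TYPE(complex) m m) G"
    and G: "G \<subseteq> carrier_mat m m"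
    and "C (0\<^sub>m m m)" "\<And>X. X \<in> G \<Longrightarrow> C X"
    and "\<And>X Y. X \<in> carrier_mat m m \<Longrightarrow> Y \<in> carrier_mat m m \<Longrightarrow> C X \<Longrightarrow> C Y \<Longrightarrow> C (X + Y)"
    and "\<And>a X. X \<in> carrier_mat m m \<Longrightarrow> C X \<Longrightarrow> C (a \<cdot>\<^sub>m X)"
  shows "C X"
proof -
  interpret V: vectorspace "class_ring :: complex ring" "module_mat TYPE(complex) m m"
    by (rule matrix_vs)
  have "submodule class_ring {X \<in> carrier_mat m m. C X} (module_mat TYPE(complex) m m)"
    using assms(3-) by unfold_locales (auto simp: module_mat_simps)
  from V.span_is_subset[OF _ this, of G] show ?thesis
    using G assms(4) X by auto
qed

lemma subspaceD:
  assumes "VectorSpace.subspace class_ring S (module_mat TYPE(complex) d d)"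
  shows "S \<subseteq> carrier_mat d d" "\<And>X Y. X \<in> S \<Longrightarrow> Y \<in> S \<Longrightarrow> X + Y \<in> S" "\<And>a X. X \<in> S \<Longrightarrow> a \<cdot>\<^sub>m X \<in> S"
proof -
  have s: "submodule class_ring S (module_mat TYPE(complex) d d)"
    using assms by (simp add: VectorSpace.subspace_def)
  show "S \<subseteq> carrier_mat d d"
    using submodule.subset[OF s] by (simp add: module_mat_simps)
  show "X + Y \<in> S" if "X \<in> S" "Y \<in> S" for X Y
    using submodule.m_closed[OF s that] by (simp add: module_mat_simps)
  show "a \<cdot>\<^sub>m X \<in> S" if "X \<in> S" for a X
    using submodule.smult_closed[OF s _ that, of a] by (simp add: module_mat_simps)
qed

lemma mat_adjoint_carrier: "A \<in> carrier_mat d d \<Longrightarrow> mat_adjoint A \<in> carrier_mat d d"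
  by (intro carrier_matI) (auto simp: mat_adjoint_def)

lemma index_mat_adjoint:
  "A \<in> carrier_mat d d \<Longrightarrow> i < d \<Longrightarrow> j < d \<Longrightarrow> mat_adjoint A $$ (i, j) = cnj (A $$ (j, i))"
  by (simp add: mat_adjoint_def mat_of_rows_def)

lemma noncomm_graph_carrier: "noncomm_graph d S \<Longrightarrow> S \<subseteq> carrier_mat d d"
  by (simp add: noncomm_graph_def subspaceD)

lemma operator_system_kernels:
  assumes "noncomm_graph d S"
  shows "operator_system (kernels d S)"
proof -
  note S = subspaceD[of S d]
  have sub: "VectorSpace.subspace class_ring S (module_mat TYPE(complex) d d)"
    and one: "1\<^sub>m d \<in> S" and adj: "S = mat_adjoint ` S"
    using assms by (simp_all add: noncomm_graph_def)
  show ?thesis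
    unfolding operator_system_def
  proof (intro conjI ballI allI)
    fix f g assume "f \<in> kernels d S" "g \<in> kernels d S"
    moreover have "mat d d (\<lambda>(i, j). f i j + g i j) = mat d d (\<lambda>(i, j). f i j) + mat d d (\<lambda>(i, j). g i j)"
      by (rule eq_matI) auto
    ultimately show "(\<lambda>i j. f i j + g i j) \<in> kernels d S"
      using S(2)[OF sub] by (simp add: kernels_def)
  next
    fix a f assume "f \<in> kernels d S"
    moreover have "mat d d (\<lambda>(i, j). a * f i j) = a \<cdot>\<^sub>m mat d d (\<lambda>(i, j). f i j)"
      by (rule eq_matI) auto
    ultimately show "(\<lambda>i j. a * f i j) \<in> kernels d S"
      using S(3)[OF sub] by (simp add: kernels_def)
  next
    fix f assume "f \<in> kernels d S"
    then have "mat_adjoint (mat d d (\<lambda>(i, j). f i j)) \<in> S"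
      using adj by (auto simp: kernels_def)
    moreover have "mat_adjoint (mat d d (\<lambda>(i, j). f i j)) = mat d d (\<lambda>(i, j). cnj (f j i))"
      by (rule eq_matI) (simp_all add: index_mat_adjoint[of _ d], simp_all add: mat_adjoint_def)
    ultimately show "(\<lambda>i j. cnj (f j i)) \<in> kernels d S"
      by (simp add: kernels_def)
  next
    have "mat d d (\<lambda>(i, j). if i = j then 1 else 0) = (1\<^sub>m d :: complex mat)"
      by (rule eq_matI) auto
    then show "(\<lambda>i j. if i = j then 1 else 0) \<in> kernels d S"
      using one by (simp add: kernels_def)
  qed
qed

section \<open>Positivity and inner products in terms of entries\<close>

lemma qform_entries:
  assumes "M \<in> carrier_mat m m" "v \<in> carrier_vec m"
  shows "(M *\<^sub>v v) \<bullet>c v = qform {..<m} (entries M) (($) v)"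
proof -
  have "(M *\<^sub>v v) \<bullet>c v = (\<Sum>i<m. (\<Sum>j<m. M $$ (i, j) * v $ j) * cnj (v $ i))"
    using assms by (simp add: scalar_prod_def lessThan_atLeast0)
  then show ?thesis
    by (simp add: qform_alt entries_def mult.commute)
qed

lemma psd_iff:
  assumes "M \<in> carrier_mat m m"
  shows "psd M \<longleftrightarrow> nonneg_kernel {..<m} (entries M)"
proof
  assume M: "psd M"
  show "nonneg_kernel {..<m} (entries M)"
    unfolding nonneg_kernel_def
  proof
    fix v
    have "qform {..<m} (entries M) v = qform {..<m} (entries M) (($) (vec m v))"
      by (rule qform_cong) auto
    also have "\<dots> = (M *\<^sub>v vec m v) \<bullet>c vec m v"
      using assms by (simp add: qform_entries)
    finally have "0 \<le> qform {..<m} (entries M) v"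
      using M assms by (simp add: psd_def)
    then show "Im (qform {..<m} (entries M) v) = 0 \<and> 0 \<le> Re (qform {..<m} (entries M) v)"
      by (simp add: less_eq_complex_def)
  qed
next
  assume M: "nonneg_kernel {..<m} (entries M)"
  show "psd M"
    unfolding psd_def using assms nonneg_kernelD[OF M]
    by (auto simp: qform_entries[OF assms] less_eq_complex_def)
qed

lemma hs_inner_entries:
  assumes "X \<in> carrier_mat m m" "T \<in> carrier_mat m m"
  shows "hs_inner X T = (\<Sum>p<m. \<Sum>q<m. cnj (entries X p q) * entries T p q)"
proof -
  have "hs_inner X T = (\<Sum>q<m. \<Sum>p<m. cnj (X $$ (p, q)) * T $$ (p, q))"
    using assms mat_adjoint_carrier[OF assms(1)]
    by (simp add: hs_inner_def mat_trace_def scalar_prod_def index_mat_adjoint[OF assms(1)] lessThan_atLeast0)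
  also have "\<dots> = (\<Sum>p<m. \<Sum>q<m. cnj (X $$ (p, q)) * T $$ (p, q))"
    by (rule sum.swap)
  finally show ?thesis by (simp add: entries_def)
qed

lemma vec_norm_eq: "v \<in> carrier_vec m \<Longrightarrow> vec_norm v = sqrt (sqnorm {..<m} (($) v))"
proof -
  assume v: "v \<in> carrier_vec m"
  have "v \<bullet>c v = (\<Sum>i<m. v $ i * cnj (v $ i))"
    using v by (simp add: scalar_prod_def lessThan_atLeast0)
  also have "\<dots> = of_real (sqnorm {..<m} (($) v))"
    unfolding sqnorm_def of_real_sum complex_norm_square ..
  finally show ?thesis by (simp add: vec_norm_def)
qed

section \<open>Operator norm and quadratic form\<close>

definition apply_kernel :: "'i set \<Rightarrow> ('i \<Rightarrow> 'i \<Rightarrow> complex) \<Rightarrow> ('i \<Rightarrow> complex) \<Rightarrow> 'i \<Rightarrow> complex" where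
  "apply_kernel J A v x = (\<Sum>y\<in>J. A x y * v y)"

text \<open>Evaluate the nonnegative form at c v - A v. It expands to c^2 <v, A v> - 2 c |A v|^2 +
  <A v, A A v>; bounding the outer terms by c^3 |v|^2 and c |A v|^2 leaves c |A v|^2 \<le> c^3
  |v|^2.\<close>

lemma sqnorm_apply_le:
  assumes fin: "finite J" and A: "nonneg_kernel J A" and c: "0 < c"
    and le: "\<And>v. Re (qform J A v) \<le> c * sqnorm J v"
  shows "sqnorm J (apply_kernel J A v) \<le> c\<^sup>2 * sqnorm J v"
proof -
  define w where "w = apply_kernel J A v"
  define B where "B = (\<lambda>u u'. \<Sum>x\<in>J. cnj (u x) * apply_kernel J A u' x)"
  have q: "qform J A u = B u u" for u
    by (simp add: qform_alt B_def apply_kernel_def)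
  have Bwv: "B w v = of_real (sqnorm J w)"
    unfolding B_def w_def sqnorm_def of_real_sum complex_norm_square by (simp add: mult.commute)
  have "B v w = (\<Sum>x\<in>J. \<Sum>y\<in>J. cnj (v x) * (A x y * w y))"
    by (simp add: B_def apply_kernel_def sum_distrib_left)
  also have "\<dots> = (\<Sum>y\<in>J. \<Sum>x\<in>J. cnj (v x) * (A x y * w y))"
    by (rule sum.swap)
  also have "\<dots> = (\<Sum>y\<in>J. \<Sum>x\<in>J. cnj (cnj (w y) * (A y x * v x)))"
  proof (intro sum.cong refl)
    fix x y assume "x \<in> J" "y \<in> J"
    then have "A x y = cnj (A y x)" by (intro nonneg_kernel_hermitian[OF A fin])
    then show "cnj (v x) * (A x y * w y) = cnj (cnj (w y) * (A y x * v x))"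
      by (simp add: mult_ac)
  qed
  also have "\<dots> = cnj (B w v)"
    by (simp add: B_def apply_kernel_def sum_distrib_left)
  finally have Bvw: "B v w = of_real (sqnorm J w)" using Bwv by simp
  have left: "B (\<lambda>x. of_real c * u x - u' x) z = of_real c * B u z - B u' z" for u u' z
    by (simp add: B_def left_diff_distrib sum_subtractf sum_distrib_left mult.assoc)
  have "apply_kernel J A (\<lambda>x. of_real c * u x - u' x) x =
      of_real c * apply_kernel J A u x - apply_kernel J A u' x" for u u' x
    by (simp add: apply_kernel_def right_diff_distrib sum_subtractf sum_distrib_left mult.left_commute)
  then have right: "B z (\<lambda>x. of_real c * u x - u' x) = of_real c * B z u - B z u'" for u u' z
    by (simp add: B_def right_diff_distrib sum_subtractf sum_distrib_left mult.left_commute)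
  have "B (\<lambda>x. of_real c * v x - w x) (\<lambda>x. of_real c * v x - w x) =
      of_real (c\<^sup>2) * B v v - of_real c * B v w - of_real c * B w v + B w w"
    unfolding left right by (simp add: right_diff_distrib power2_eq_square)
  then have "qform J A (\<lambda>x. of_real c * v x - w x) =
      of_real (c\<^sup>2) * B v v - 2 * of_real (c * sqnorm J w) + B w w"
    unfolding q Bvw Bwv by simp
  then have "0 \<le> c\<^sup>2 * Re (B v v) - 2 * (c * sqnorm J w) + Re (B w w)"
    using nonneg_kernelD(2)[OF A, of "\<lambda>x. of_real c * v x - w x"] by simp
  moreover have "c\<^sup>2 * Re (B v v) \<le> c\<^sup>2 * (c * sqnorm J v)"
    using le[of v] unfolding q by (rule mult_left_mono) simp
  moreover have "Re (B w w) \<le> c * sqnorm J w"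
    using le[of w] unfolding q .
  ultimately have "0 \<le> c\<^sup>2 * (c * sqnorm J v) - c * sqnorm J w"
    by linarith
  also have "\<dots> = c * (c\<^sup>2 * sqnorm J v - sqnorm J w)"
    by (simp only: right_diff_distrib mult.left_commute)
  finally have "0 \<le> c * (c\<^sup>2 * sqnorm J v - sqnorm J w)" .
  then show ?thesis using c by (simp add: zero_le_mult_iff w_def)
qed

text \<open>Cauchy-Schwarz in the weighted form a b \<le> (k/2) a^2 + b^2/(2 k), summed over
  coordinates. The weight \<open>k\<close> makes both halves contribute k/2.\<close>

lemma qform_le_apply:
  assumes "0 < k" "\<And>v. sqnorm J (apply_kernel J A v) \<le> k\<^sup>2 * sqnorm J v"
  shows "Re (qform J A v) \<le> k * sqnorm J v"
proof -
  let ?w = "apply_kernel J A v"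
  have "Re (qform J A v) = (\<Sum>x\<in>J. Re (cnj (v x) * ?w x))"
    unfolding qform_alt apply_kernel_def by (rule Re_sum)
  also have "\<dots> \<le> (\<Sum>x\<in>J. k / 2 * (cmod (v x))\<^sup>2 + (cmod (?w x))\<^sup>2 / (2 * k))"
  proof (intro sum_mono)
    fix x
    have "Re (cnj (v x) * ?w x) \<le> cmod (v x) * cmod (?w x)"
      by (rule order_trans[OF complex_Re_le_cmod]) (simp add: norm_mult)
    moreover have "0 \<le> (k * cmod (v x) - cmod (?w x))\<^sup>2" by simp
    then have "2 * k * (cmod (v x) * cmod (?w x)) \<le> k\<^sup>2 * (cmod (v x))\<^sup>2 + (cmod (?w x))\<^sup>2"
      by (simp add: power2_eq_square algebra_simps)
    then have "2 * k * (cmod (v x) * cmod (?w x)) / (2 * k) \<le> (k\<^sup>2 * (cmod (v x))\<^sup>2 + (cmod (?w x))\<^sup>2) / (2 * k)"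
      using assms(1) by (intro divide_right_mono) auto
    then have "cmod (v x) * cmod (?w x) \<le> k / 2 * (cmod (v x))\<^sup>2 + (cmod (?w x))\<^sup>2 / (2 * k)"
      using assms(1) by (simp add: add_divide_distrib power2_eq_square)
    ultimately show "Re (cnj (v x) * ?w x) \<le> k / 2 * (cmod (v x))\<^sup>2 + (cmod (?w x))\<^sup>2 / (2 * k)"
      by linarith
  qed
  also have "\<dots> = k / 2 * sqnorm J v + sqnorm J ?w / (2 * k)"
    by (simp add: sqnorm_def sum.distrib sum_distrib_left sum_divide_distrib)
  also have "\<dots> \<le> k / 2 * sqnorm J v + k\<^sup>2 * sqnorm J v / (2 * k)"
    using assms by (intro add_left_mono divide_right_mono) auto
  also have "\<dots> = k * sqnorm J v"
    using assms(1) by (simp add: power2_eq_square)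
  finally show ?thesis .
qed

lemma vec_norm_apply:
  assumes "M \<in> carrier_mat m m" "v \<in> carrier_vec m"
  shows "vec_norm (M *\<^sub>v v) = sqrt (sqnorm {..<m} (apply_kernel {..<m} (entries M) (($) v)))"
proof -
  have "sqnorm {..<m} (($) (M *\<^sub>v v)) = sqnorm {..<m} (apply_kernel {..<m} (entries M) (($) v))"
    unfolding sqnorm_def
    by (intro sum.cong refl) (use assms in \<open>simp add: apply_kernel_def entries_def scalar_prod_def lessThan_atLeast0\<close>)
  then show ?thesis using assms by (simp add: vec_norm_eq[of _ m])
qed

text \<open>The pointwise conclusion is stated besides the bound on the supremum because it shows
  that the supremum is over a bounded set.\<close>

lemma op_norm_le:
  assumes M: "M \<in> carrier_mat m m" and c: "0 < c"
    and le: "\<And>v. sqnorm {..<m} (apply_kernel {..<m} (entries M) v) \<le> c\<^sup>2 * sqnorm {..<m} v"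
  shows "v \<in> carrier_vec m \<Longrightarrow> vec_norm v \<le> 1 \<Longrightarrow> vec_norm (M *\<^sub>v v) \<le> c" "op_norm M \<le> c"
proof -
  show *: "vec_norm (M *\<^sub>v v) \<le> c" if "v \<in> carrier_vec m" "vec_norm v \<le> 1" for v
  proof -
    have "sqnorm {..<m} (($) v) \<le> 1"
      using that by (simp add: vec_norm_eq[of _ m])
    then have "c\<^sup>2 * sqnorm {..<m} (($) v) \<le> c\<^sup>2 * 1"
      by (intro mult_left_mono) auto
    with le[of "($) v"] have "sqnorm {..<m} (apply_kernel {..<m} (entries M) (($) v)) \<le> c\<^sup>2 * 1"
      by (rule order_trans)
    then show ?thesis
      using c unfolding vec_norm_apply[OF M that(1)] by (intro real_le_lsqrt) (auto simp: sqnorm_nonneg)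
  qed
  have "0\<^sub>v m \<in> {v \<in> carrier_vec (dim_col M). vec_norm v \<le> 1}"
    using M by (simp add: vec_norm_eq[of _ m] sqnorm_def)
  then show "op_norm M \<le> c"
    unfolding op_norm_def using M * by (intro cSUP_least) (auto intro!: exI[of _ "0\<^sub>v m"])
qed

text \<open>The constant \<open>c\<close> guarantees that the supremum defining
  \<open>op_norm\<close> is over a bounded set; then, by scaling to unit vectors, the norm itself is
  a valid constant.\<close>

lemma op_norm_nonneg_bound:
  assumes M: "M \<in> carrier_mat m m" and c: "0 < c"
    and le: "\<And>v. sqnorm {..<m} (apply_kernel {..<m} (entries M) v) \<le> c\<^sup>2 * sqnorm {..<m} v"
  shows "0 \<le> op_norm M" "sqnorm {..<m} (apply_kernel {..<m} (entries M) v) \<le> (op_norm M)\<^sup>2 * sqnorm {..<m} v"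
proof -
  have upper: "vec_norm (M *\<^sub>v u) \<le> op_norm M" if "u \<in> carrier_vec m" "vec_norm u \<le> 1" for u
    unfolding op_norm_def
  proof (rule cSUP_upper)
    show "bdd_above ((\<lambda>v. vec_norm (M *\<^sub>v v)) ` {v \<in> carrier_vec (dim_col M). vec_norm v \<le> 1})"
      using M op_norm_le(1)[OF M c le] by (intro bdd_aboveI2[where M = c]) auto
  qed (use M that in auto)
  have z: "vec_norm (0\<^sub>v m) = 0" by (simp add: vec_norm_eq[of _ m] sqnorm_def)
  have "0 \<le> vec_norm (M *\<^sub>v 0\<^sub>v m)"
    using M by (simp add: vec_norm_apply[of M m] sqnorm_nonneg)
  also have "\<dots> \<le> op_norm M" by (rule upper) (simp_all add: z)
  finally show nonneg: "0 \<le> op_norm M" .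
  let ?s = "sqnorm {..<m} v"
  show "sqnorm {..<m} (apply_kernel {..<m} (entries M) v) \<le> (op_norm M)\<^sup>2 * ?s"
  proof (cases "?s = 0")
    case True
    then show ?thesis using le[of v] by simp
  next
    case False
    then have s: "?s > 0" using sqnorm_nonneg[of "{..<m}" v] by simp
    define r where "r = inverse (sqrt ?s)"
    have r2: "r\<^sup>2 = inverse ?s" using s by (simp add: r_def power_inverse del: inverse_eq_divide)
    define u where "u = vec m (\<lambda>i. of_real r * v i)"
    have "sqnorm {..<m} (($) u) = r\<^sup>2 * ?s"
      by (simp add: sqnorm_def u_def norm_mult power_mult_distrib sum_distrib_left)
    then have "vec_norm u \<le> 1" using s by (simp add: vec_norm_eq[of _ m] u_def r2)
    moreover have "u \<in> carrier_vec m" by (simp add: u_def)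
    ultimately have "vec_norm (M *\<^sub>v u) \<le> op_norm M" by (intro upper)
    then have "sqnorm {..<m} (apply_kernel {..<m} (entries M) (($) u)) \<le> (op_norm M)\<^sup>2"
      using M \<open>u \<in> carrier_vec m\<close> by (simp add: vec_norm_apply sqrt_le_D)
    also have "sqnorm {..<m} (apply_kernel {..<m} (entries M) (($) u)) =
        r\<^sup>2 * sqnorm {..<m} (apply_kernel {..<m} (entries M) v)"
    proof -
      have "apply_kernel {..<m} (entries M) (($) u) x = of_real r * apply_kernel {..<m} (entries M) v x" for x
        by (simp add: apply_kernel_def u_def sum_distrib_left mult_ac)
      then show ?thesis
        by (simp add: sqnorm_def norm_mult power_mult_distrib sum_distrib_left)
    qed
    finally show ?thesis using s by (simp add: r2 field_simps)
  qed
qed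

text \<open>Matrices determine kernels on the index set only, whereas \<open>tensor_set\<close> and
  images under reindexing fix all values. Test operators are therefore matched up to agreement on
  \<open>I\<close>.\<close>

lemma feasible_subset:
  assumes "feasible I K S P"
    and P: "\<And>x y. x \<in> I \<times> K \<Longrightarrow> y \<in> I \<times> K \<Longrightarrow> P' x y = P x y"
    and S: "\<And>X. X \<in> S' \<Longrightarrow> \<exists>Y\<in>S. \<forall>i\<in>I. \<forall>j\<in>I. X i j = Y i j"
  shows "feasible I K S' P'"
  unfolding feasible_def
proof (intro conjI ballI)
  show "nonneg_kernel (I \<times> K) P'"
    using assms(1) nonneg_kernel_cong[of "I \<times> K" P' P] P by (simp add: feasible_def)
  fix X k l assume "X \<in> S'" and kl: "k \<in> K" "l \<in> K"
  then obtain Y where Y: "Y \<in> S" "\<And>i j. i \<in> I \<Longrightarrow> j \<in> I \<Longrightarrow> X i j = Y i j"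
    using S by blast
  have "(\<Sum>i\<in>I. \<Sum>j\<in>I. cnj (X i j) * P' (i, k) (j, l)) = (\<Sum>i\<in>I. \<Sum>j\<in>I. cnj (Y i j) * P (i, k) (j, l))"
    using kl by (intro sum.cong refl) (simp add: P Y(2))
  also have "\<dots> = (if k = l then \<Sum>i\<in>I. cnj (Y i i) else 0)"
    using assms(1) Y(1) kl by (simp add: feasible_def)
  also have "(\<Sum>i\<in>I. cnj (Y i i)) = (\<Sum>i\<in>I. cnj (X i i))"
    by (intro sum.cong refl) (simp add: Y(2))
  finally show "(\<Sum>i\<in>I. \<Sum>j\<in>I. cnj (X i j) * P' (i, k) (j, l)) = (if k = l then \<Sum>i\<in>I. cnj (X i i) else 0)" .
qed

section \<open>Feasible matrices and the suprema\<close>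

lemma theta_bound_mono: "theta_bound I S c \<Longrightarrow> c \<le> c' \<Longrightarrow> theta_bound I S c'"
  unfolding theta_bound_def by (meson mult_right_mono order_trans sqnorm_nonneg)

text \<open>Splits off the ancilla part: the inner product pairs \<open>Z\<close> with the defects
  of the feasibility equations of \<open>M\<close> at \<open>X\<close>. The subtracted trace stems
  from \<open>T = M - 1\<close>.\<close>

lemma hs_inner_kron:
  assumes X: "X \<in> carrier_mat d d" and Z: "Z \<in> carrier_mat n n" and M: "M \<in> carrier_mat (d * n) (d * n)"
  shows "hs_inner (kron X Z) (M - 1\<^sub>m (d * n)) = (\<Sum>k<n. \<Sum>l<n. cnj (entries Z k l) *
    ((\<Sum>i<d. \<Sum>j<d. cnj (entries X i j) * entries M (enc n (i, k)) (enc n (j, l))) -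
      (if k = l then \<Sum>i<d. cnj (entries X i i) else 0)))"
proof -
  let ?J = "{..<d} \<times> {..<n}"
  define N where "N = (\<lambda>x y. entries M (enc n x) (enc n y))"
  have inj: "inj_on (enc n) ?J" using bij_betw_enc by (rule bij_betw_imp_inj_on)
  have "hs_inner (kron X Z) (M - 1\<^sub>m (d * n)) =
      (\<Sum>p<d*n. \<Sum>q<d*n. cnj (entries (kron X Z) p q) * entries (M - 1\<^sub>m (d * n)) p q)"
    using kron_carrier[OF X Z] by (intro hs_inner_entries) auto
  also have "\<dots> = (\<Sum>x\<in>?J. \<Sum>y\<in>?J. cnj (entries (kron X Z) (enc n x) (enc n y)) * entries (M - 1\<^sub>m (d * n)) (enc n x) (enc n y))"
    unfolding sum.reindex_bij_betw[OF bij_betw_enc, symmetric] ..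
  also have "\<dots> = (\<Sum>x\<in>?J. \<Sum>y\<in>?J. cnj (tensor (entries X) (entries Z) x y) * (N x y - (if x = y then 1 else 0)))"
  proof (intro sum.cong refl)
    fix x y assume xy: "x \<in> ?J" "y \<in> ?J"
    then have "entries (kron X Z) (enc n x) (enc n y) = tensor (entries X) (entries Z) x y"
      by (subst entries_kron[OF X Z]) (auto simp: dec_enc enc_less)
    moreover have "entries (M - 1\<^sub>m (d * n)) (enc n x) (enc n y) = N x y - (if x = y then 1 else 0)"
      using M enc_less[OF xy(1)] enc_less[OF xy(2)] inj_onD[OF inj _ xy] by (auto simp: entries_def N_def)
    ultimately show "cnj (entries (kron X Z) (enc n x) (enc n y)) * entries (M - 1\<^sub>m (d * n)) (enc n x) (enc n y) =
      cnj (tensor (entries X) (entries Z) x y) * (N x y - (if x = y then 1 else 0))" by simp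
  qed
  also have "\<dots> = (\<Sum>i<d. \<Sum>k<n. \<Sum>j<d. \<Sum>l<n. cnj (entries Z k l) * (cnj (entries X i j) * N (i, k) (j, l) -
      (if i = j then if k = l then cnj (entries X i j) else 0 else 0)))"
    unfolding sum_Times by (intro sum.cong refl) (simp add: tensor_def algebra_simps)
  also have "\<dots> = (\<Sum>k<n. \<Sum>l<n. \<Sum>i<d. \<Sum>j<d. cnj (entries Z k l) * (cnj (entries X i j) * N (i, k) (j, l) -
      (if i = j then if k = l then cnj (entries X i j) else 0 else 0)))"
    unfolding sum.cartesian_product
    by (rule sum.reindex_bij_witness[where i = "\<lambda>(k, l, i, j). (i, k, j, l)" and j = "\<lambda>(i, k, j, l). (k, l, i, j)"]) auto
  also have "\<dots> = (\<Sum>k<n. \<Sum>l<n. cnj (entries Z k l) *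
    ((\<Sum>i<d. \<Sum>j<d. cnj (entries X i j) * N (i, k) (j, l)) - (if k = l then \<Sum>i<d. cnj (entries X i i) else 0)))"
    unfolding sum_distrib_left [symmetric] sum_subtractf by (intro sum.cong refl) simp
  finally show ?thesis by (simp add: N_def)
qed

lemma hs_inner_add:
  assumes "X \<in> carrier_mat m m" "Y \<in> carrier_mat m m" "T \<in> carrier_mat m m"
  shows "hs_inner (X + Y) T = hs_inner X T + hs_inner Y T"
proof -
  have "hs_inner (X + Y) T = (\<Sum>p<m. \<Sum>q<m. cnj (entries X p q + entries Y p q) * entries T p q)"
    using assms by (subst hs_inner_entries) (auto simp: entries_def intro!: sum.cong)
  then show ?thesis
    using assms by (simp add: hs_inner_entries ring_distribs sum.distrib)
qed

lemma hs_inner_smult: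
  assumes "X \<in> carrier_mat m m" "T \<in> carrier_mat m m"
  shows "hs_inner (a \<cdot>\<^sub>m X) T = cnj a * hs_inner X T"
proof -
  have "hs_inner (a \<cdot>\<^sub>m X) T = (\<Sum>p<m. \<Sum>q<m. cnj (a * entries X p q) * entries T p q)"
    using assms by (subst hs_inner_entries) (auto simp: entries_def intro!: sum.cong)
  then show ?thesis
    using assms by (simp add: hs_inner_entries sum_distrib_left mult.assoc)
qed

lemma orth_compl_span:
  assumes "G \<subseteq> carrier_mat m m"
  shows "orth_compl m (LinearCombinations.module.span class_ring (module_mat TYPE(complex) m m) G) = orth_compl m G"
proof (intro equalityI subsetI)
  fix T assume "T \<in> orth_compl m (LinearCombinations.module.span class_ring (module_mat TYPE(complex) m m) G)"
  then show "T \<in> orth_compl m G"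
    using span_superset[OF assms] by (auto simp: orth_compl_def)
next
  fix T assume T: "T \<in> orth_compl m G"
  then have Tc: "T \<in> carrier_mat m m" by (simp add: orth_compl_def)
  have "hs_inner X T = 0" if "X \<in> LinearCombinations.module.span class_ring (module_mat TYPE(complex) m m) G" for X
    using that assms
  proof (rule mat_span_induct[where C = "\<lambda>X. hs_inner X T = 0"])
    show "hs_inner (0\<^sub>m m m) T = 0"
      using Tc by (subst hs_inner_entries) (auto simp: entries_def)
  qed (use T Tc in \<open>auto simp: orth_compl_def hs_inner_add hs_inner_smult\<close>)
  then show "T \<in> orth_compl m (LinearCombinations.module.span class_ring (module_mat TYPE(complex) m m) G)"
    using Tc by (simp add: orth_compl_def)
qed

lemma feasible_mat_iff:
  assumes S: "S \<subseteq> carrier_mat d d" and M: "M \<in> carrier_mat (d * n) (d * n)"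
  shows "M - 1\<^sub>m (d * n) \<in> orth_compl (d * n) (tensor_space d n S (carrier_mat n n)) \<and> psd M \<longleftrightarrow>
    feasible {..<d} {..<n} (kernels d S) (\<lambda>x y. entries M (enc n x) (enc n y))"
proof -
  define D where "D = (\<lambda>X k l. (\<Sum>i<d. \<Sum>j<d. cnj (entries X i j) * entries M (enc n (i, k)) (enc n (j, l))) -
      (if k = l then \<Sum>i<d. cnj (entries X i i) else 0))"
  have gens: "{kron X Z | X Z. X \<in> S \<and> Z \<in> carrier_mat n n} \<subseteq> carrier_mat (d * n) (d * n)"
    using S kron_carrier by blast
  have "M - 1\<^sub>m (d * n) \<in> orth_compl (d * n) (tensor_space d n S (carrier_mat n n)) \<longleftrightarrow>
      (\<forall>X\<in>S. \<forall>Z\<in>carrier_mat n n. (\<Sum>k<n. \<Sum>l<n. cnj (entries Z k l) * D X k l) = 0)"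
  proof -
    have "hs_inner (kron X Z) (M - 1\<^sub>m (d * n)) = (\<Sum>k<n. \<Sum>l<n. cnj (entries Z k l) * D X k l)"
      if "X \<in> S" "Z \<in> carrier_mat n n" for X Z
      unfolding D_def using that S M by (intro hs_inner_kron) auto
    moreover have "M - 1\<^sub>m (d * n) \<in> carrier_mat (d * n) (d * n)" by auto
    moreover have "M - 1\<^sub>m (d * n) \<in> orth_compl (d * n) (tensor_space d n S (carrier_mat n n)) \<longleftrightarrow>
        M - 1\<^sub>m (d * n) \<in> carrier_mat (d * n) (d * n) \<and>
        (\<forall>X\<in>S. \<forall>Z\<in>carrier_mat n n. hs_inner (kron X Z) (M - 1\<^sub>m (d * n)) = 0)"
      unfolding tensor_space_def orth_compl_span[OF gens] unfolding orth_compl_def by blast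
    ultimately show ?thesis by simp
  qed
  also have "\<dots> \<longleftrightarrow> (\<forall>X\<in>S. \<forall>k<n. \<forall>l<n. D X k l = 0)"
  proof (intro iffI ballI allI impI)
    fix X k l assume *: "\<forall>X\<in>S. \<forall>Z\<in>carrier_mat n n. (\<Sum>k<n. \<Sum>l<n. cnj (entries Z k l) * D X k l) = 0"
      and "X \<in> S" and kl: "k < n" "l < n"
    \<comment> \<open>A matrix unit, isolating the defect at \<open>(k, l)\<close>.\<close>
    let ?Z = "mat n n (\<lambda>(k', l'). if l' = l then if k' = k then 1 else 0 else 0) :: complex mat"
    have "(\<Sum>k'<n. \<Sum>l'<n. cnj (entries ?Z k' l') * D X k' l') = 0"
      using * \<open>X \<in> S\<close> by simp
    also have "(\<Sum>k'<n. \<Sum>l'<n. cnj (entries ?Z k' l') * D X k' l') =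
        (\<Sum>k'<n. \<Sum>l'<n. if l' = l then if k' = k then D X k' l' else 0 else 0)"
      by (intro sum.cong refl) (auto simp: entries_def)
    also have "\<dots> = D X k l" using kl by simp
    finally show "D X k l = 0" .
  qed simp
  also have "\<dots> \<longleftrightarrow> (\<forall>f\<in>kernels d S. \<forall>k<n. \<forall>l<n.
      (\<Sum>i<d. \<Sum>j<d. cnj (f i j) * entries M (enc n (i, k)) (enc n (j, l))) =
      (if k = l then \<Sum>i<d. cnj (f i i) else 0))"
  proof (intro iffI ballI)
    fix X assume "\<forall>f\<in>kernels d S. \<forall>k<n. \<forall>l<n.
      (\<Sum>i<d. \<Sum>j<d. cnj (f i j) * entries M (enc n (i, k)) (enc n (j, l))) =
      (if k = l then \<Sum>i<d. cnj (f i i) else 0)" and "X \<in> S"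
    then show "\<forall>k<n. \<forall>l<n. D X k l = 0"
      using entries_kernels[OF S \<open>X \<in> S\<close>] by (simp add: D_def)
  next
    fix f assume *: "\<forall>X\<in>S. \<forall>k<n. \<forall>l<n. D X k l = 0" and f: "f \<in> kernels d S"
    have "D (mat d d (\<lambda>(i, j). f i j)) k l =
        (\<Sum>i<d. \<Sum>j<d. cnj (f i j) * entries M (enc n (i, k)) (enc n (j, l))) -
        (if k = l then \<Sum>i<d. cnj (f i i) else 0)" for k l
      by (simp add: D_def entries_def)
    then show "\<forall>k<n. \<forall>l<n. (\<Sum>i<d. \<Sum>j<d. cnj (f i j) * entries M (enc n (i, k)) (enc n (j, l))) =
      (if k = l then \<Sum>i<d. cnj (f i i) else 0)"
      using * f by (auto simp: kernels_def)
  qed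
  finally have orth: "M - 1\<^sub>m (d * n) \<in> orth_compl (d * n) (tensor_space d n S (carrier_mat n n)) \<longleftrightarrow>
    (\<forall>f\<in>kernels d S. \<forall>k<n. \<forall>l<n. (\<Sum>i<d. \<Sum>j<d. cnj (f i j) * entries M (enc n (i, k)) (enc n (j, l))) =
      (if k = l then \<Sum>i<d. cnj (f i i) else 0))" .
  have "nonneg_kernel {..<d * n} (entries M) \<longleftrightarrow> nonneg_kernel ({..<d} \<times> {..<n}) (\<lambda>x y. entries M (enc n x) (enc n y))"
  proof
    assume "nonneg_kernel ({..<d} \<times> {..<n}) (\<lambda>x y. entries M (enc n x) (enc n y))"
    from nonneg_kernel_reindex[OF bij_betw_dec this] show "nonneg_kernel {..<d * n} (entries M)"
      by (simp add: enc_dec)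
  qed (rule nonneg_kernel_reindex[OF bij_betw_enc])
  then show ?thesis
    using orth by (auto simp: feasible_def psd_iff[OF M])
qed

lemma feasible_mat_le:
  assumes S: "S \<subseteq> carrier_mat d d" and c: "theta_bound {..<d} (kernels d S) c" "0 < c" and n: "1 \<le> n"
    and T: "T \<in> orth_compl (d * n) (tensor_space d n S (carrier_mat n n))" "psd (1\<^sub>m (d * n) + T)"
  shows "sqnorm {..<d * n} (apply_kernel {..<d * n} (entries (1\<^sub>m (d * n) + T)) v) \<le> c\<^sup>2 * sqnorm {..<d * n} v"
proof -
  let ?M = "1\<^sub>m (d * n) + T"
  have Tc: "T \<in> carrier_mat (d * n) (d * n)" using T(1) by (simp add: orth_compl_def)
  then have M: "?M \<in> carrier_mat (d * n) (d * n)" by simp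
  have "?M - 1\<^sub>m (d * n) = T" using Tc by (intro eq_matI) auto
  then have feas: "feasible {..<d} {..<n} (kernels d S) (\<lambda>x y. entries ?M (enc n x) (enc n y))"
    using feasible_mat_iff[OF S M] T by simp
  show ?thesis
  proof (rule sqnorm_apply_le)
    show "nonneg_kernel {..<d * n} (entries ?M)" using T(2) psd_iff[OF M] by simp
    show "Re (qform {..<d * n} (entries ?M) v) \<le> c * sqnorm {..<d * n} v" for v
    proof -
      have "Re (qform ({..<d} \<times> {..<n}) (\<lambda>x y. entries ?M (enc n x) (enc n y)) (\<lambda>x. v (enc n x)))
          \<le> c * sqnorm ({..<d} \<times> {..<n}) (\<lambda>x. v (enc n x))"
        using n by (intro theta_boundD[OF c(1) feas]) (auto simp: lessThan_empty_iff)
      then show ?thesis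
        by (simp only: qform_reindex[OF bij_betw_enc, where A = "entries ?M"] sqnorm_reindex[OF bij_betw_enc])
    qed
  qed (use c in auto)
qed

text \<open>Keeps the suprema away from the empty set and yields nonnegativity of the value.\<close>

lemma zero_feasible:
  assumes S: "S \<subseteq> carrier_mat d d"
  shows "0\<^sub>m (d * n) (d * n) \<in> {T \<in> orth_compl (d * n) (tensor_space d n S (carrier_mat n n)). psd (1\<^sub>m (d * n) + T)}"
proof -
  let ?m = "d * n"
  have gens: "{kron X Z | X Z. X \<in> S \<and> Z \<in> carrier_mat n n} \<subseteq> carrier_mat ?m ?m"
    using S kron_carrier by blast
  have "hs_inner X (0\<^sub>m ?m ?m) = 0" if "X \<in> carrier_mat ?m ?m" for X
    using that by (subst hs_inner_entries) (auto simp: entries_def)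
  then have "0\<^sub>m ?m ?m \<in> orth_compl ?m (tensor_space d n S (carrier_mat n n))"
    using gens unfolding tensor_space_def orth_compl_span[OF gens] by (auto simp: orth_compl_def)
  moreover have "nonneg_kernel {..<?m} (entries (1\<^sub>m ?m))"
    using nonneg_kernel_id[of "{..<?m}"]
    by (subst nonneg_kernel_cong[where B = "\<lambda>x y. if x = y then 1 else 0"]) (auto simp: entries_def)
  ultimately show ?thesis by (simp add: psd_iff[of _ "d * n"])
qed

lemma lovasz_theta_le:
  assumes S: "S \<subseteq> carrier_mat d d" and c: "theta_bound {..<d} (kernels d S) c" "0 < c" and n: "1 \<le> n"
  shows "lovasz_theta (d * n) (tensor_space d n S (carrier_mat n n)) \<le> c"
    and "T \<in> orth_compl (d * n) (tensor_space d n S (carrier_mat n n)) \<Longrightarrow> psd (1\<^sub>m (d * n) + T) \<Longrightarrow>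
      op_norm (1\<^sub>m (d * n) + T) \<le> lovasz_theta (d * n) (tensor_space d n S (carrier_mat n n))"
proof -
  let ?F = "{T \<in> orth_compl (d * n) (tensor_space d n S (carrier_mat n n)). psd (1\<^sub>m (d * n) + T)}"
  have le: "op_norm (1\<^sub>m (d * n) + T) \<le> c" if "T \<in> ?F" for T
    using that feasible_mat_le[OF S c n, of T]
    by (intro op_norm_le(2)[of _ "d * n"] c) (auto simp: orth_compl_def)
  show "lovasz_theta (d * n) (tensor_space d n S (carrier_mat n n)) \<le> c"
    unfolding lovasz_theta_def using zero_feasible[OF S, of n] le by (intro cSUP_least) auto
  show "op_norm (1\<^sub>m (d * n) + T) \<le> lovasz_theta (d * n) (tensor_space d n S (carrier_mat n n))"
    if "T \<in> orth_compl (d * n) (tensor_space d n S (carrier_mat n n))" "psd (1\<^sub>m (d * n) + T)"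
    unfolding lovasz_theta_def
    using that le by (intro cSUP_upper bdd_aboveI2[where M = c]) auto
qed

lemma quantum_lovasz_theta_le:
  assumes S: "S \<subseteq> carrier_mat d d" and c: "theta_bound {..<d} (kernels d S) c" "0 \<le> c"
  shows "quantum_lovasz_theta d S \<le> c"
proof (rule field_le_epsilon)
  \<comment> \<open>The norm estimates ask for a positive constant; enlarging \<open>c\<close> by
    \<open>e\<close> covers \<open>c = 0\<close>, which occurs in dimension 0.\<close>
  fix e :: real assume e: "0 < e"
  have "theta_bound {..<d} (kernels d S) (c + e)"
    using c e by (intro theta_bound_mono[OF c(1)]) simp
  with e c show "quantum_lovasz_theta d S \<le> c + e"
    unfolding quantum_lovasz_theta_def by (intro cSUP_least lovasz_theta_le(1)[OF S]) auto
qed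

text \<open>An a priori bound \<open>c\<close> makes all suprema finite, and then the value is
  itself a bound. With \<open>quantum_lovasz_theta_le\<close> it is the least nonnegative
  one.\<close>

lemma quantum_lovasz_theta_bound:
  assumes S: "S \<subseteq> carrier_mat d d" and c: "theta_bound {..<d} (kernels d S) c" "0 < c"
  shows "theta_bound {..<d} (kernels d S) (quantum_lovasz_theta d S)" "0 \<le> quantum_lovasz_theta d S"
proof -
  define \<theta> where "\<theta> = quantum_lovasz_theta d S"
  have le: "op_norm (1\<^sub>m (d * n) + T) \<le> \<theta>"
    if "1 \<le> n" "T \<in> orth_compl (d * n) (tensor_space d n S (carrier_mat n n))" "psd (1\<^sub>m (d * n) + T)" for n T
  proof -
    have "op_norm (1\<^sub>m (d * n) + T) \<le> lovasz_theta (d * n) (tensor_space d n S (carrier_mat n n))"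
      using that by (intro lovasz_theta_le(2)[OF S c])
    also have "\<dots> \<le> \<theta>"
      unfolding \<theta>_def quantum_lovasz_theta_def
      using that(1) lovasz_theta_le(1)[OF S c] by (intro cSUP_upper bdd_aboveI2[where M = c]) auto
    finally show ?thesis .
  qed
  have "0 \<le> op_norm (1\<^sub>m (d * 1) + 0\<^sub>m (d * 1) (d * 1))"
  proof (rule op_norm_nonneg_bound(1)[OF _ c(2)])
    show "sqnorm {..<d * 1} (apply_kernel {..<d * 1} (entries (1\<^sub>m (d * 1) + 0\<^sub>m (d * 1) (d * 1))) v) \<le>
        c\<^sup>2 * sqnorm {..<d * 1} v" for v
      using zero_feasible[OF S, of 1] by (intro feasible_mat_le[OF S c]) auto
  qed simp
  also have "\<dots> \<le> \<theta>"
    using zero_feasible[OF S, of 1] by (intro le) auto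
  finally show nonneg: "0 \<le> quantum_lovasz_theta d S" by (simp add: \<theta>_def)
  show "theta_bound {..<d} (kernels d S) (quantum_lovasz_theta d S)"
    unfolding theta_bound_def \<theta>_def [symmetric]
  proof (intro allI impI)
    fix n :: nat and P and v :: "nat \<times> nat \<Rightarrow> complex" assume n: "1 \<le> n" and P: "feasible {..<d} {..<n} (kernels d S) P"
    define m where "m = d * n"
    define M where "M = mat m m (\<lambda>(p, q). P (dec n p) (dec n q))"
    define T where "T = M - 1\<^sub>m m"
    have M: "M \<in> carrier_mat (d * n) (d * n)" by (simp add: M_def m_def)
    have MP: "entries M (enc n x) (enc n y) = P x y" if "x \<in> {..<d} \<times> {..<n}" "y \<in> {..<d} \<times> {..<n}" for x y
      using that enc_less[OF that(1)] enc_less[OF that(2)] by (auto simp: M_def entries_def m_def dec_enc)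
    have "feasible {..<d} {..<n} (kernels d S) (\<lambda>x y. entries M (enc n x) (enc n y))"
      using P by (rule feasible_subset) (auto simp: MP)
    then have "T \<in> orth_compl (d * n) (tensor_space d n S (carrier_mat n n))" "psd M"
      using feasible_mat_iff[OF S M] by (simp_all add: T_def m_def)
    moreover have MT: "1\<^sub>m (d * n) + T = M"
      using M by (intro eq_matI) (auto simp: T_def m_def)
    ultimately have T: "T \<in> orth_compl (d * n) (tensor_space d n S (carrier_mat n n))" "psd (1\<^sub>m (d * n) + T)"
      by simp_all
    note bound = feasible_mat_le[OF S c n T, unfolded MT]
    note op = op_norm_nonneg_bound[OF M c(2) bound]
    define w where "w = (\<lambda>p. v (dec n p))"
    have "Re (qform {..<d * n} (entries M) w) \<le> \<theta> * sqnorm {..<d * n} w"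
    proof (rule field_le_epsilon)
      fix e :: real assume e: "0 < e"
      define s where "s = sqnorm {..<d * n} w"
      have s: "0 \<le> s" by (simp add: s_def sqnorm_nonneg)
      \<comment> \<open>Slightly above the norm, since \<open>qform_le_apply\<close> asks for a
        positive constant and the norm may be 0. The error is e s/(s + 1), at most
        \<open>e\<close>.\<close>
      define k where "k = op_norm M + e / (s + 1)"
      have k: "op_norm M \<le> k" "0 < k" using e s op(1) by (auto simp: k_def add_nonneg_pos)
      have "sqnorm {..<d * n} (apply_kernel {..<d * n} (entries M) u) \<le> k\<^sup>2 * sqnorm {..<d * n} u" for u
        using op(2)[of u] k op(1) by (intro order_trans[OF op(2)] mult_right_mono power_mono) (auto simp: sqnorm_nonneg)
      from qform_le_apply[OF k(2) this] have "Re (qform {..<d * n} (entries M) w) \<le> k * s"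
        by (simp add: s_def)
      also have "\<dots> = op_norm M * s + e * (s / (s + 1))" by (simp add: k_def algebra_simps)
      also have "\<dots> \<le> \<theta> * s + e * 1"
        using le[OF n T] e s unfolding MT by (intro add_mono mult_right_mono mult_left_mono) (auto simp: divide_le_eq)
      finally show "Re (qform {..<d * n} (entries M) w) \<le> \<theta> * sqnorm {..<d * n} w + e"
        by (simp add: s_def)
    qed
    moreover have "qform {..<d * n} (entries M) w = qform ({..<d} \<times> {..<n}) P v"
    proof -
      have "qform {..<d * n} (entries M) w = qform ({..<d} \<times> {..<n}) (\<lambda>x y. entries M (enc n x) (enc n y)) (\<lambda>x. w (enc n x))"
        by (rule qform_reindex[OF bij_betw_enc, symmetric])
      also have "\<dots> = qform ({..<d} \<times> {..<n}) P v"
        by (rule qform_cong) (auto simp: MP w_def dec_enc)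
      finally show ?thesis .
    qed
    moreover have "sqnorm {..<d * n} w = sqnorm ({..<d} \<times> {..<n}) v"
      unfolding w_def by (rule sqnorm_reindex[OF bij_betw_dec])
    ultimately show "Re (qform ({..<d} \<times> {..<n}) P v) \<le> \<theta> * sqnorm ({..<d} \<times> {..<n}) v" by simp
  qed
qed

section \<open>Multiplicativity\<close>

text \<open>Feasible points are carried along \<open>enc\<close> and \<open>dec\<close>. In one
  direction (\<open>pull\<close>) the test operators shrink from the span to its generators; in the
  other (\<open>push\<close>) the condition, called \<open>C\<close> there, spreads from Kronecker
  products to the span by induction.\<close>

lemma theta_bound_tensor_space:
  assumes S1: "S1 \<subseteq> carrier_mat d1 d1" and S2: "S2 \<subseteq> carrier_mat d2 d2"
  shows "theta_bound {..<d1 * d2} (kernels (d1 * d2) (tensor_space d1 d2 S1 S2)) c \<longleftrightarrow>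
    theta_bound ({..<d1} \<times> {..<d2}) (tensor_set (kernels d1 S1) (kernels d2 S2)) c"
    (is "theta_bound ?I ?S c \<longleftrightarrow> theta_bound ?I' ?S' c")
proof -
  have id: "bij_betw (\<lambda>k. k) K K" for K :: "nat set"
    by (simp add: bij_betw_def inj_on_def)
  let ?G = "{kron X1 X2 | X1 X2. X1 \<in> S1 \<and> X2 \<in> S2}"
  have gens: "?G \<subseteq> carrier_mat (d1 * d2) (d1 * d2)"
    using S1 S2 kron_carrier by blast
  have pull: "feasible ?I' K ?S' (\<lambda>x y. P (map_prod (enc d2) (\<lambda>k. k) x) (map_prod (enc d2) (\<lambda>k. k) y))"
    if "feasible ?I K ?S P" for K :: "nat set" and P
  proof (rule feasible_subset[OF feasible_reindex[OF bij_betw_enc id that]])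
    fix X assume "X \<in> ?S'"
    then obtain X1 X2 where X: "X = tensor X1 X2" "X1 \<in> kernels d1 S1" "X2 \<in> kernels d2 S2"
      unfolding tensor_set_def by blast
    define Y1 :: "complex mat" where "Y1 = mat d1 d1 (\<lambda>(i, j). X1 i j)"
    define Y2 :: "complex mat" where "Y2 = mat d2 d2 (\<lambda>(i, j). X2 i j)"
    have Y: "Y1 \<in> S1" "Y2 \<in> S2" using X by (auto simp: kernels_def Y1_def Y2_def)
    then have Yc: "Y1 \<in> carrier_mat d1 d1" "Y2 \<in> carrier_mat d2 d2" using S1 S2 by auto
    have "kron Y1 Y2 \<in> tensor_space d1 d2 S1 S2"
      unfolding tensor_space_def using Y span_superset[OF gens] by blast
    moreover have "tensor_space d1 d2 S1 S2 \<subseteq> carrier_mat (d1 * d2) (d1 * d2)"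
      unfolding tensor_space_def by (rule span_carrier[OF gens])
    ultimately have "entries (kron Y1 Y2) \<in> ?S" by (intro entries_kernels)
    moreover have "\<forall>x\<in>?I'. \<forall>y\<in>?I'. X x y = entries (kron Y1 Y2) (enc d2 x) (enc d2 y)"
    proof (intro ballI)
      fix x y assume xy: "x \<in> ?I'" "y \<in> ?I'"
      have "entries (kron Y1 Y2) (enc d2 x) (enc d2 y) = tensor (entries Y1) (entries Y2) x y"
        using xy by (subst entries_kron[OF Yc]) (auto simp: enc_less dec_enc)
      then show "X x y = entries (kron Y1 Y2) (enc d2 x) (enc d2 y)"
        using xy by (auto simp: X tensor_def entries_def Y1_def Y2_def)
    qed
    ultimately show "\<exists>Y\<in>(\<lambda>X i j. X (enc d2 i) (enc d2 j)) ` ?S. \<forall>i\<in>?I'. \<forall>j\<in>?I'. X i j = Y i j"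
      by (intro bexI[OF _ imageI[of "entries (kron Y1 Y2)"]])
  qed simp
  have push: "feasible ?I K ?S (\<lambda>x y. P (map_prod (dec d2) (\<lambda>k. k) x) (map_prod (dec d2) (\<lambda>k. k) y))"
    if P: "feasible ?I' K ?S' P" for K :: "nat set" and P
  proof -
    define R where "R = (\<lambda>x y. P (map_prod (dec d2) (\<lambda>k. k) x) (map_prod (dec d2) (\<lambda>k. k) y))"
    note feas = feasible_reindex[OF bij_betw_dec id P, folded R_def]
    define C where "C = (\<lambda>X. \<forall>k\<in>K. \<forall>l\<in>K. (\<Sum>i\<in>?I. \<Sum>j\<in>?I. cnj (entries X i j) * R (i, k) (j, l)) =
      (if k = l then \<Sum>i\<in>?I. cnj (entries X i i) else 0))"
    have C: "C X" if "X \<in> tensor_space d1 d2 S1 S2" for X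
      using that[unfolded tensor_space_def] gens
    proof (rule mat_span_induct)
      show "C (0\<^sub>m (d1 * d2) (d1 * d2))" by (simp add: C_def entries_def)
    next
      fix X assume "X \<in> ?G"
      then obtain X1 X2 where X: "X = kron X1 X2" "X1 \<in> S1" "X2 \<in> S2" by blast
      then have Xc: "X1 \<in> carrier_mat d1 d1" "X2 \<in> carrier_mat d2 d2" using S1 S2 by auto
      let ?f = "\<lambda>i j. tensor (entries X1) (entries X2) (dec d2 i) (dec d2 j)"
      have "tensor (entries X1) (entries X2) \<in> ?S'"
        using X entries_kernels[OF S1] entries_kernels[OF S2] unfolding tensor_set_def by blast
      then have "?f \<in> (\<lambda>X i j. X (dec d2 i) (dec d2 j)) ` ?S'"
        by (rule image_eqI[rotated]) simp
      then have "\<forall>k\<in>K. \<forall>l\<in>K. (\<Sum>i\<in>?I. \<Sum>j\<in>?I. cnj (?f i j) * R (i, k) (j, l)) =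
          (if k = l then \<Sum>i\<in>?I. cnj (?f i i) else 0)"
        by (rule bspec[OF conjunct2[OF feas[unfolded feasible_def]]])
      moreover have "entries X i j = ?f i j" if "i < d1 * d2" "j < d1 * d2" for i j
        unfolding X using entries_kron[OF Xc that] .
      ultimately show "C X" by (simp add: C_def)
    next
      fix X Y assume *: "X \<in> carrier_mat (d1 * d2) (d1 * d2)" "Y \<in> carrier_mat (d1 * d2) (d1 * d2)" "C X" "C Y"
      have "entries (X + Y) i j = entries X i j + entries Y i j" if "i < d1 * d2" "j < d1 * d2" for i j
        using * that by (simp add: entries_def)
      then show "C (X + Y)" using *(3,4) by (simp add: C_def ring_distribs sum.distrib)
    next
      fix a X assume *: "X \<in> carrier_mat (d1 * d2) (d1 * d2)" "C X"
      have "entries (a \<cdot>\<^sub>m X) i j = a * entries X i j" if "i < d1 * d2" "j < d1 * d2" for i j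
        using * that by (simp add: entries_def)
      then show "C (a \<cdot>\<^sub>m X)" using *(2) by (simp add: C_def mult.assoc flip: sum_distrib_left)
    qed
    have "(\<Sum>i\<in>?I. \<Sum>j\<in>?I. cnj (f i j) * R (i, k) (j, l)) = (if k = l then \<Sum>i\<in>?I. cnj (f i i) else 0)"
      if "f \<in> ?S" "k \<in> K" "l \<in> K" for f k l
    proof -
      have "C (mat (d1 * d2) (d1 * d2) (\<lambda>(i, j). f i j))"
        using that(1) by (intro C) (simp add: kernels_def)
      then show ?thesis using that(2,3) by (simp add: C_def entries_def)
    qed
    then show ?thesis
      using feas unfolding feasible_def R_def [symmetric] by blast
  qed
  have "theta_bound ?I' ?S' c" if b: "theta_bound ?I ?S c"
    unfolding theta_bound_def
  proof (intro allI impI)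
    fix n :: nat and P v assume n: "1 \<le> n" and "feasible ?I' {..<n} ?S' P"
    note bij = bij_betw_map_prod[OF bij_betw_dec id]
    have "Re (qform (?I \<times> {..<n}) (\<lambda>x y. P (map_prod (dec d2) (\<lambda>k. k) x) (map_prod (dec d2) (\<lambda>k. k) y))
        (\<lambda>x. v (map_prod (dec d2) (\<lambda>k. k) x))) \<le> c * sqnorm (?I \<times> {..<n}) (\<lambda>x. v (map_prod (dec d2) (\<lambda>k. k) x))"
      using n by (intro theta_boundD[OF b] push \<open>feasible ?I' {..<n} ?S' P\<close>) (auto simp: lessThan_empty_iff)
    then show "Re (qform (?I' \<times> {..<n}) P v) \<le> c * sqnorm (?I' \<times> {..<n}) v"
      by (simp only: qform_reindex[OF bij, where A = P] sqnorm_reindex[OF bij])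
  qed
  moreover have "theta_bound ?I ?S c" if b: "theta_bound ?I' ?S' c"
    unfolding theta_bound_def
  proof (intro allI impI)
    fix n :: nat and P v assume n: "1 \<le> n" and "feasible ?I {..<n} ?S P"
    note bij = bij_betw_map_prod[OF bij_betw_enc id]
    have "Re (qform (?I' \<times> {..<n}) (\<lambda>x y. P (map_prod (enc d2) (\<lambda>k. k) x) (map_prod (enc d2) (\<lambda>k. k) y))
        (\<lambda>x. v (map_prod (enc d2) (\<lambda>k. k) x))) \<le> c * sqnorm (?I' \<times> {..<n}) (\<lambda>x. v (map_prod (enc d2) (\<lambda>k. k) x))"
      using n by (intro theta_boundD[OF b] pull \<open>feasible ?I {..<n} ?S P\<close>) (auto simp: lessThan_empty_iff)
    then show "Re (qform (?I \<times> {..<n}) P v) \<le> c * sqnorm (?I \<times> {..<n}) v"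
      by (simp only: qform_reindex[OF bij, where A = P] sqnorm_reindex[OF bij])
  qed
  ultimately show ?thesis by blast
qed

lemma theta_bound_dual: "finite I \<Longrightarrow> dual_witness I S \<mu> Y \<Longrightarrow> theta_bound I S \<mu>"
  unfolding theta_bound_def by (intro allI impI weak_duality) auto

text \<open>A large multiple of the identity will do.\<close>

lemma dual_witness_exists:
  assumes "finite I" "operator_system S"
  shows "\<exists>\<mu> Y. dual_witness I S \<mu> Y"
proof -
  define t where "t = (\<Sum>x\<in>I\<times>I. \<Sum>y\<in>I\<times>I. cmod (entangled x y))"
  define Y where "Y = (\<lambda>x y :: 'a \<times> 'a. complex_of_real t * (if x = y then 1 else 0))"
  have S: "(\<lambda>i j. a * (if i = j then 1 else 0)) \<in> S" for a
    using assms(2) by (simp add: operator_system_def)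
  have slice: "(\<lambda>i j. Y (i, a) (j, b)) = (\<lambda>i j. (if a = b then of_real t else 0) * (if i = j then 1 else 0))" for a b
    by (auto simp: Y_def fun_eq_iff)
  have "nonneg_kernel (I \<times> I) (\<lambda>x y. Y x y - entangled x y)"
    unfolding nonneg_kernel_def
  proof
    fix v
    have "qform (I \<times> I) (\<lambda>x y. Y x y - entangled x y) v =
        of_real (t * sqnorm (I \<times> I) v) - qform (I \<times> I) entangled v"
      unfolding Y_def qform_diff qform_scale using assms(1) by (simp add: qform_id)
    moreover have "Re (qform (I \<times> I) entangled v) \<le> t * sqnorm (I \<times> I) v"
      unfolding t_def using assms(1) by (intro qform_bound) simp
    moreover have "Im (qform (I \<times> I) entangled v) = 0"
      by (rule nonneg_kernelD[OF nonneg_kernel_entangled])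
    ultimately show "Im (qform (I \<times> I) (\<lambda>x y. Y x y - entangled x y) v) = 0 \<and>
        0 \<le> Re (qform (I \<times> I) (\<lambda>x y. Y x y - entangled x y) v)" by simp
  qed
  then have "dual_witness I S (t * card I) Y"
    using S by (simp add: dual_witness_def slice) (simp add: Y_def mult.commute)
  then show ?thesis by blast
qed

text \<open>\<open>\<mu>\<close> is a diagonal entry of the partial trace of \<open>Y\<close>, and
  \<open>Y\<close> is the sum of the nonnegative kernels \<open>Y - entangled\<close> and
  \<open>entangled\<close>.\<close>

lemma dual_witness_nonneg:
  assumes "finite I" "I \<noteq> {}" "dual_witness I S \<mu> Y"
  shows "0 \<le> \<mu>"
proof -
  have Y: "nonneg_kernel (I \<times> I) Y"
    using nonneg_kernel_add[of "I \<times> I" "\<lambda>x y. Y x y - entangled x y" entangled] assms(3)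
    by (simp add: dual_witness_def nonneg_kernel_entangled)
  obtain a where a: "a \<in> I" using assms(2) by blast
  then have "of_real \<mu> = (\<Sum>i\<in>I. Y (i, a) (i, a))"
    using assms(3) by (simp add: dual_witness_def)
  then have "\<mu> = (\<Sum>i\<in>I. Re (Y (i, a) (i, a)))"
    by (metis Re_complex_of_real Re_sum)
  also have "\<dots> \<ge> 0"
    using a assms(1) by (intro sum_nonneg nonneg_kernel_diag(2)[OF Y]) auto
  finally show ?thesis .
qed

text \<open>Submultiplicativity: dual points of values below c1 + \<epsilon> and c2 + \<epsilon> are
  multiplied, weak duality turns the product into a bound, and \<open>\<epsilon>\<close> tends to
  0.\<close>

lemma theta_bound_mult:
  fixes d1 d2 :: nat
  assumes "operator_system S1" "operator_system S2"
    and b: "theta_bound {..<d1} S1 c1" "theta_bound {..<d2} S2 c2" and c: "0 \<le> c1" "0 \<le> c2"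
  shows "theta_bound ({..<d1} \<times> {..<d2}) (tensor_set S1 S2) (c1 * c2)"
\<comment> \<open>\<open>strong_duality\<close> starts at dimension 1; over an empty index set all
  sums are empty.\<close>
proof (cases "d1 = 0 \<or> d2 = 0")
  case True
  then have "{..<d1} \<times> {..<d2} = {}" by auto
  then show ?thesis
    by (simp only: theta_bound_def qform_def sqnorm_def Sigma_empty1 sum.empty) simp
next
  case False
  then have d: "1 \<le> d1" "1 \<le> d2" by auto
  let ?I = "{..<d1} \<times> {..<d2}"
  have bound: "theta_bound ?I (tensor_set S1 S2) ((c1 + \<epsilon>) * (c2 + \<epsilon>))" if \<epsilon>: "\<epsilon> > 0" for \<epsilon>
  proof -
    obtain \<mu>1 Y1 where Y1: "\<mu>1 < c1 + \<epsilon>" "dual_witness {..<d1} S1 \<mu>1 Y1"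
      using strong_duality[OF assms(1) b(1) d(1) \<epsilon>] by blast
    obtain \<mu>2 Y2 where Y2: "\<mu>2 < c2 + \<epsilon>" "dual_witness {..<d2} S2 \<mu>2 Y2"
      using strong_duality[OF assms(2) b(2) d(2) \<epsilon>] by blast
    have "0 \<le> \<mu>2"
      using d(2) by (intro dual_witness_nonneg[OF _ _ Y2(2)]) (auto simp: lessThan_empty_iff)
    then have "\<mu>1 * \<mu>2 \<le> (c1 + \<epsilon>) * (c2 + \<epsilon>)"
      using Y1 Y2 c \<epsilon> by (intro mult_mono) auto
    moreover have "theta_bound ?I (tensor_set S1 S2) (\<mu>1 * \<mu>2)"
      using dual_witness_tensor[OF _ _ Y1(2) Y2(2)] by (intro theta_bound_dual) auto
    ultimately show ?thesis by (rule theta_bound_mono[rotated])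
  qed
  show ?thesis
    unfolding theta_bound_def
  proof (intro allI impI)
    fix n :: nat and P v
    assume n: "1 \<le> n" and P: "feasible ?I {..<n} (tensor_set S1 S2) P"
    define s where "s = sqnorm (?I \<times> {..<n}) v"
    have s: "0 \<le> s" by (simp add: s_def sqnorm_nonneg)
    show "Re (qform (?I \<times> {..<n}) P v) \<le> c1 * c2 * sqnorm (?I \<times> {..<n}) v"
      unfolding s_def [symmetric]
    proof (rule field_le_epsilon)
      fix e :: real assume e: "0 < e"
      \<comment> \<open>The excess of (c1 + \<epsilon>)(c2 + \<epsilon>) over c1 c2 is \<epsilon>
        (c1 + c2 + \<epsilon>), and \<epsilon> \<le> 1; using \<open>s + 1\<close> for
        \<open>s\<close> keeps \<open>D\<close> positive.\<close>
      define D where "D = (c1 + c2 + 1) * (s + 1)"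
      have D: "0 < D" unfolding D_def using c s by (intro mult_pos_pos) auto
      define \<epsilon> where "\<epsilon> = min 1 (e / D)"
      have \<epsilon>: "0 < \<epsilon>" "\<epsilon> \<le> 1" "\<epsilon> * D \<le> e"
        using e D by (auto simp: \<epsilon>_def min_def field_simps)
      have "Re (qform (?I \<times> {..<n}) P v) \<le> (c1 + \<epsilon>) * (c2 + \<epsilon>) * s"
        unfolding s_def using n by (intro theta_boundD[OF bound[OF \<epsilon>(1)] P]) (auto simp: lessThan_empty_iff)
      also have "\<dots> = c1 * c2 * s + \<epsilon> * ((c1 + c2 + \<epsilon>) * s)"
        by (simp add: algebra_simps)
      also have "(c1 + c2 + \<epsilon>) * s \<le> D"
        unfolding D_def using c s \<epsilon> by (intro mult_mono) auto
      then have "c1 * c2 * s + \<epsilon> * ((c1 + c2 + \<epsilon>) * s) \<le> c1 * c2 * s + \<epsilon> * D"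
        using \<epsilon>(1) by simp
      also have "\<dots> \<le> c1 * c2 * s + e" using \<epsilon>(3) by simp
      finally show "Re (qform (?I \<times> {..<n}) P v) \<le> c1 * c2 * s + e" .
    qed
  qed
qed

theorem corollary10:
  fixes d1 d2 :: nat and S1 S2 :: "complex mat set"
  assumes "noncomm_graph d1 S1"
    and "noncomm_graph d2 S2"
  shows "quantum_lovasz_theta (d1 * d2) (tensor_space d1 d2 S1 S2) =
    quantum_lovasz_theta d1 S1 * quantum_lovasz_theta d2 S2"
proof -
  define \<theta>1 where "\<theta>1 = quantum_lovasz_theta d1 S1"
  define \<theta>2 where "\<theta>2 = quantum_lovasz_theta d2 S2"
  define \<theta> where "\<theta> = quantum_lovasz_theta (d1 * d2) (tensor_space d1 d2 S1 S2)"
  let ?I = "{..<d1} \<times> {..<d2}" and ?T = "tensor_set (kernels d1 S1) (kernels d2 S2)"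
  note sys = assms[THEN operator_system_kernels]
  note S = assms[THEN noncomm_graph_carrier]
  have ST: "tensor_space d1 d2 S1 S2 \<subseteq> carrier_mat (d1 * d2) (d1 * d2)"
    unfolding tensor_space_def
  proof (rule span_carrier)
    show "{kron X1 X2 | X1 X2. X1 \<in> S1 \<and> X2 \<in> S2} \<subseteq> carrier_mat (d1 * d2) (d1 * d2)"
      using S(1) S(2) kron_carrier by blast
  qed
  \<comment> \<open>\<open>quantum_lovasz_theta_bound\<close> asks for a positive bound, and the
    value of a dual point may fail to be positive.\<close>
  have pos: "theta_bound I X (max \<mu> 1)" if "theta_bound I X \<mu>" for I :: "'x set" and X \<mu>
    using that by (rule theta_bound_mono) simp
  obtain \<mu>1 Y1 \<mu>2 Y2 where Y: "dual_witness {..<d1} (kernels d1 S1) \<mu>1 Y1"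
    "dual_witness {..<d2} (kernels d2 S2) \<mu>2 Y2"
    using dual_witness_exists[OF finite_lessThan sys(1)] dual_witness_exists[OF finite_lessThan sys(2)] by blast
  have b1: "theta_bound {..<d1} (kernels d1 S1) \<theta>1" "0 \<le> \<theta>1"
    unfolding \<theta>1_def using quantum_lovasz_theta_bound[OF S(1) pos[OF theta_bound_dual[OF _ Y(1)]]] by simp_all
  have b2: "theta_bound {..<d2} (kernels d2 S2) \<theta>2" "0 \<le> \<theta>2"
    unfolding \<theta>2_def using quantum_lovasz_theta_bound[OF S(2) pos[OF theta_bound_dual[OF _ Y(2)]]] by simp_all
  have "theta_bound ?I ?T (\<mu>1 * \<mu>2)"
    using dual_witness_tensor[OF _ _ Y] by (intro theta_bound_dual) auto
  then have "theta_bound {..<d1 * d2} (kernels (d1 * d2) (tensor_space d1 d2 S1 S2)) (max (\<mu>1 * \<mu>2) 1)"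
    using theta_bound_tensor_space[OF S] by (intro pos) simp
  then have b: "theta_bound ?I ?T \<theta>" "0 \<le> \<theta>"
    using quantum_lovasz_theta_bound[OF ST] theta_bound_tensor_space[OF S] by (simp_all add: \<theta>_def)
  have "\<theta> \<le> \<theta>1 * \<theta>2"
    unfolding \<theta>_def using theta_bound_mult[OF sys b1(1) b2(1) b1(2) b2(2)] b1(2) b2(2) theta_bound_tensor_space[OF S]
    by (intro quantum_lovasz_theta_le[OF ST]) simp_all
  moreover have "\<theta>1 * \<theta>2 \<le> \<theta>"
  \<comment> \<open>\<open>\<theta>1\<close> becomes a denominator; it is 0 in dimension 0.\<close>
  proof (cases "\<theta>1 = 0")
    case True
    then show ?thesis using b by simp
  next
    case False
    then have "\<theta>1 > 0" using b1 by simp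
    \<comment> \<open>The two suprema are taken one after the other. With the point and vector of
      the second factor fixed, the inequality for product vectors is a bound for the first factor,
      so \<open>\<theta>1\<close> obeys it; then the second point varies.\<close>
    have "theta_bound {..<d2} (kernels d2 S2) (\<theta> / \<theta>1)"
      unfolding theta_bound_def
    proof (intro allI impI)
      fix n2 :: nat and P2 v2
      assume n2: "1 \<le> n2" and P2: "feasible {..<d2} {..<n2} (kernels d2 S2) P2"
      define x2 where "x2 = Re (qform ({..<d2} \<times> {..<n2}) P2 v2)"
      define s2 where "s2 = sqnorm ({..<d2} \<times> {..<n2}) v2"
      have s2: "0 \<le> s2" by (simp add: s2_def sqnorm_nonneg)
      have x2: "0 \<le> x2"
        unfolding x2_def using P2 by (intro nonneg_kernelD(2)) (simp add: feasible_def)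
      have "\<theta>1 * x2 \<le> \<theta> * s2"
      proof (cases "x2 = 0")
        case True
        then show ?thesis using b s2 by simp
      next
        case False
        then have pos: "x2 > 0" using x2 by simp
        have "theta_bound {..<d1} (kernels d1 S1) (\<theta> * s2 / x2)"
          unfolding theta_bound_def
        proof (intro allI impI)
          fix n1 :: nat and P1 v1
          assume n1: "1 \<le> n1" and P1: "feasible {..<d1} {..<n1} (kernels d1 S1) P1"
          have "Re (qform ({..<d1} \<times> {..<n1}) P1 v1) * x2 \<le> \<theta> * (sqnorm ({..<d1} \<times> {..<n1}) v1 * s2)"
            unfolding x2_def s2_def using n1 n2
            by (intro theta_bound_tensorD[OF _ _ _ _ _ _ P1 P2 b(1)]) (auto simp: lessThan_empty_iff)
          then show "Re (qform ({..<d1} \<times> {..<n1}) P1 v1) \<le> \<theta> * s2 / x2 * sqnorm ({..<d1} \<times> {..<n1}) v1"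
            using pos by (simp add: pos_le_divide_eq mult_ac)
        qed
        then have "\<theta>1 \<le> \<theta> * s2 / x2"
          unfolding \<theta>1_def using b s2 pos by (intro quantum_lovasz_theta_le[OF S(1)]) simp_all
        then show ?thesis using pos by (simp add: pos_le_divide_eq)
      qed
      then show "Re (qform ({..<d2} \<times> {..<n2}) P2 v2) \<le> \<theta> / \<theta>1 * sqnorm ({..<d2} \<times> {..<n2}) v2"
        using \<open>\<theta>1 > 0\<close> by (simp add: x2_def s2_def pos_le_divide_eq mult.commute)
    qed
    then have "\<theta>2 \<le> \<theta> / \<theta>1"
      unfolding \<theta>2_def using b \<open>\<theta>1 > 0\<close> by (intro quantum_lovasz_theta_le[OF S(2)]) simp_all
    then show ?thesis using \<open>\<theta>1 > 0\<close> by (simp add: pos_le_divide_eq mult.commute)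
  qed
  ultimately show ?thesis by (simp add: \<theta>_def \<theta>1_def \<theta>2_def)
qed

end
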